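(* Let $(\sigma^t)_{t\ge 0}$ be the zero-temperature stochastic homogeneous Ising ferromagnet on $\mathbf{Z}^2$ started from the symmetric Bernoulli product measure. Let $\mathcal{A}\subset\{-1,+1\}^{\mathbf{Z}^2}$ be the set of absorbing states, and for $L\in\mathbf{N}$ let $\mathcal{A}_L$ be the set of all configurations that agree on the square $Q_L$ with some element of $\mathcal{A}$. Then for all $L\in\mathbf{N}$, $$\lim_{t\to\infty} P(\sigma^t\in\mathcal{A}_L)=1.$$
   Context: Model. The state space is $\mathcal{S}=\{-1,+1\}^{\mathbf{Z}^2}$. The initial state $\sigma^0$ has law $\mu^0$, the product measure under which the spins $\sigma^0_x$ are i.i.d. and equal to $+1$ or $-1$ with probability $1/2$ each. The continuous-time dynamics are: to each site $x\in\mathbf{Z}^2$ is attached an independent rate-$1$ Poisson process of "clock rings", with an independent fair coin toss attached to each ring. When the clock at $x$ rings, let $k$ be the number of the $4$ nearest neighbors $y$ of $x$ (Euclidean distance $\|x-y\|=1$) with $\sigma_y\ne\sigma_x$: if $k\ge 3$ the spin at $x$ flips ($\sigma_x\to-\sigma_x$); if $k=2$ it flips with probability $1/2$, according to the coin toss; if $k\le 1$ it does not flip. $P=\mu^0\times P_{dyn}$ is the joint law of the initial configuration and the clock rings and coin tosses. $Q_L=\{-L,\dots,L\}^2$. Absorbing states: $\mathcal{A}$ is the set of $\sigma\in\mathcal{S}$ such that every site agrees with at least three of its four nearest neighbors. For $\mathcal{U}\subset\mathcal{S}$, $\mathcal{U}_L=\{\tilde\sigma\in\mathcal{S}:\exists\,\sigma\in\mathcal{U}\text{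 with }\sigma|_{Q_L}=\tilde\sigma|_{Q_L}\}$. *)

theory Defs
  imports "HOL-Probability.Probability"
begin

type_synonym site = "int \<times> int"

text \<open>Spins are Booleans: \<open>True\<close> stands for \<open>+1\<close> and \<open>False\<close> for \<open>-1\<close>.\<close>

type_synonym config = "site \<Rightarrow> bool"

definition nbrs :: "site \<Rightarrow> site set" where
  "nbrs x = {y. (fst x - fst y)\<^sup>2 + (snd x - snd y)\<^sup>2 = 1}"

lemma nbrs_eq: "nbrs (a, b) = {(a + 1, b), (a - 1, b), (a, b + 1), (a, b - 1)}"
proof -
  have *: "p\<^sup>2 + q\<^sup>2 = 1 \<longleftrightarrow> (p = 0 \<and> (q = 1 \<or> q = -1)) \<or> (q = 0 \<and> (p = 1 \<or> p = -1))"
    for p q :: int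
  proof
    assume eq: "p\<^sup>2 + q\<^sup>2 = 1"
    show "(p = 0 \<and> (q = 1 \<or> q = -1)) \<or> (q = 0 \<and> (p = 1 \<or> p = -1))"
    proof (cases "p = 0")
      case True
      then show ?thesis using eq by (simp add: power2_eq_1_iff)
    next
      case False
      then have "p\<^sup>2 \<ge> 1" by (simp add: int_one_le_iff_zero_less)
      then have "q\<^sup>2 = 0" "p\<^sup>2 = 1" using eq zero_le_power2[of q] by linarith+
      then show ?thesis by (simp add: power2_eq_1_iff)
    qed
  qed auto
  show ?thesis unfolding nbrs_def by (auto simp: *)
qed

text \<open>The initial law, and the law of the clocks and coins. The rate-1 Poisson process at a site
  is given by its i.i.d. \<open>Exp(1)\<close> gaps between successive rings; the \<open>n\<close>-th gap is paired with the
  coin tossed at the \<open>n\<close>-th ring.\<close>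

type_synonym clocks = "site \<Rightarrow> nat \<Rightarrow> real \<times> bool"

definition \<mu>0 :: "config measure" where
  "\<mu>0 = (\<Pi>\<^sub>M x\<in>UNIV. measure_pmf (bernoulli_pmf (1/2)))"

definition P_dyn :: "clocks measure" where
  "P_dyn = (\<Pi>\<^sub>M x\<in>UNIV. \<Pi>\<^sub>M n\<in>UNIV.
     density lborel (exponential_density 1) \<Otimes>\<^sub>M measure_pmf (bernoulli_pmf (1/2)))"

definition P_joint :: "(config \<times> clocks) measure" where
  "P_joint = \<mu>0 \<Otimes>\<^sub>M P_dyn"

lemma prob_space_P_joint: "prob_space P_joint"
proof -
  let ?e = "density lborel (\<lambda>x. ennreal (exponential_density 1 x))"
  let ?b = "measure_pmf (bernoulli_pmf (1/2))"
  have e: "prob_space ?e"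
    by (rule prob_space_exponential_density) simp
  have 1: "prob_space (?e \<Otimes>\<^sub>M ?b)"
    by (intro prob_space_pair e measure_pmf.prob_space_axioms)
  have "prob_space \<mu>0"
    unfolding \<mu>0_def by (intro prob_space_PiM measure_pmf.prob_space_axioms)
  moreover have "prob_space P_dyn"
    unfolding P_dyn_def by (intro prob_space_PiM 1)
  ultimately show ?thesis
    unfolding P_joint_def by (rule prob_space_pair)
qed

definition ring_time :: "clocks \<Rightarrow> site \<Rightarrow> nat \<Rightarrow> real" where
  "ring_time d x n = (\<Sum>i\<le>n. fst (d x i))"

definition coin :: "clocks \<Rightarrow> site \<Rightarrow> nat \<Rightarrow> bool" where
  "coin d x n = snd (d x n)"

definition disagreements :: "config \<Rightarrow> site \<Rightarrow> nat" where
  "disagreements \<sigma> x = card {y \<in> nbrs x. \<sigma> y \<noteq> \<sigma> x}"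

definition updated_spin :: "config \<Rightarrow> site \<Rightarrow> bool \<Rightarrow> bool" where
  "updated_spin \<sigma> x c =
     (if disagreements \<sigma> x \<ge> 3 \<or> disagreements \<sigma> x = 2 \<and> c then \<not> \<sigma> x else \<sigma> x)"

definition left_limit :: "(real \<Rightarrow> config) \<Rightarrow> real \<Rightarrow> config \<Rightarrow> bool" where
  "left_limit s t \<zeta> \<longleftrightarrow> (\<forall>y. eventually (\<lambda>u. s u y = \<zeta> y) (at_left t))"

text \<open>The trajectory \<open>s\<close> (only times \<open>t \<ge> 0\<close> matter) starts at \<open>\<eta>\<close>; a spin is constant as long as
  its clock does not ring; and when it rings, the spin is updated according to the configuration
  just before the ring.\<close>

definition follows_dynamics :: "config \<Rightarrow> clocks \<Rightarrow> (real \<Rightarrow> config) \<Rightarrow> bool" where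
  "follows_dynamics \<eta> d s \<longleftrightarrow>
     s 0 = \<eta> \<and>
     (\<forall>x t u. 0 \<le> t \<and> t \<le> u \<and> (\<forall>n. ring_time d x n \<notin> {t<..u}) \<longrightarrow> s u x = s t x) \<and>
     (\<forall>x n. \<exists>\<zeta>. left_limit s (ring_time d x n) \<zeta> \<and>
        s (ring_time d x n) x = updated_spin \<zeta> x (coin d x n))"

text \<open>In infinite volume there is no first ring, so the rules above determine the trajectory
  from the initial state, the clocks and the coins only almost surely (Harris' graphical
  construction). Hence the process is specified up to modification on a null set.\<close>

definition zero_temp_ising :: "(real \<Rightarrow> config \<times> clocks \<Rightarrow> config) \<Rightarrow> bool" where
  "zero_temp_ising \<sigma> \<longleftrightarrow>
     (\<forall>t\<ge>0. \<sigma> t \<in> P_joint \<rightarrow>\<^sub>M (\<Pi>\<^sub>M x\<in>UNIV. count_space UNIV)) \<and>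
     (AE \<omega> in P_joint. follows_dynamics (fst \<omega>) (snd \<omega>) (\<lambda>t. \<sigma> t \<omega>))"

definition Q :: "nat \<Rightarrow> site set" where
  "Q L = {- int L..int L} \<times> {- int L..int L}"

definition absorbing :: "config set" where
  "absorbing = {\<sigma>. \<forall>x. card {y \<in> nbrs x. \<sigma> y = \<sigma> x} \<ge> 3}"

definition local_ext :: "nat \<Rightarrow> config set \<Rightarrow> config set" where
  "local_ext L U = {\<sigma>'. \<exists>\<sigma>\<in>U. restrict \<sigma> (Q L) = restrict \<sigma>' (Q L)}"

end

theory Submission imports Defs begin

text \<open>
  If no site of \<open>Q L\<close> disagrees with two or more neighbours, then the spins on \<open>Q L\<close> form stripes that extend
  to an absorbing configuration. So it suffices that the origin is flippable at time \<open>t\<close> with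
  probability tending to \<open>0\<close>.

  The trajectory is almost surely unique, because for small windows the ringing sites do not percolate.
  Hence its law is translation invariant, and comparing the energy in a large box with the number of rings on the
  boundary shows that the density of walls decreases in time. Its decrements tend to \<open>0\<close>. By the Markov
  property, a pattern in a fixed box from which finitely many legal flips lead to an energy-lowering flip
  would cause a definite decrement, so the probability of seeing such a bad pattern tends to \<open>0\<close>.

  The remaining patterns in \<open>Q M\<close> have only \<open>O(M)\<close> flippable sites, against \<open>O(M\<^sup>2)\<close> sites in the box. Let
  \<open>\<tau>\<close> be the bootstrap closure of the plus spins of \<open>\<sigma>\<close>; it has the same energy. A run of plus
  spins capped by minus spins leads to an energy-lowering flip, so \<open>\<tau>\<close> has at most one corner of each
  orientation and its walls are, up to \<open>O(M)\<close> edges, full lines in a single direction, say vertical. In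
  each row, \<open>\<sigma>\<close> has a plus spin in each plus strip of \<open>\<tau>\<close>, so \<open>\<sigma>\<close> has almost as many vertical wall edges
  as \<open>\<tau>\<close>. By equality of the energies only \<open>O(M)\<close> horizontal wall edges remain, and these control
  the flippable sites.
\<close>

section \<open>Configurations in a box without energy-lowering paths\<close>

text \<open>The hypothesis admits every process that almost surely obeys the local rules for the
  given clocks. Translation invariance and the Markov property are therefore not part of the data
  and have to be extracted from uniqueness. The total energy is infinite, so only the energy per
  site makes sense: a box of side \<open>N\<close> has an error of order \<open>N\<close> from its
  boundary against a volume of order \<open>N * N\<close>. The main obstacle is that a decreasing
  energy excludes only patterns from which energy can be lost, while a site on a staircase may flip
  back and forth at no cost. Such sites are not excluded one by one; they are shown to be rare in a
  large box, and translation invariance turns rarity into a small probability at one site. A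
  configuration that is not bad can itself have many corners, so corners are counted in its closure
  instead. The closure is reached by flips of zero cost and so is not bad either. Since it may hide
  bends of the original walls, the information has to be carried back, by the equality of the
  energies and by counting sign changes in each row.\<close>

lemma disagreements_eq:
  "disagreements \<sigma> (a, b) =
     of_bool (\<sigma> (a + 1, b) \<noteq> \<sigma> (a, b)) + of_bool (\<sigma> (a - 1, b) \<noteq> \<sigma> (a, b)) +
     of_bool (\<sigma> (a, b + 1) \<noteq> \<sigma> (a, b)) + of_bool (\<sigma> (a, b - 1) \<noteq> \<sigma> (a, b))"
proof -
  have count: "card {y \<in> A. p y} = (\<Sum>y\<in>A. of_bool (p y))" if "finite A" for A and p :: "site \<Rightarrow> bool"
    using that by (simp add: Int_def)
  show ?thesis
    unfolding disagreements_def by (subst count) (simp_all add: nbrs_eq)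
qed

lemma finite_nbrs [simp]: "finite (nbrs x)"
  by (cases x) (simp add: nbrs_eq)

section \<open>Walls, the energy of a box, and single flips\<close>

lemma finite_Q [simp]: "finite (Q M)" by (simp add: Q_def)

text \<open>These are the sites whose four neighbours all lie in \<open>Q M\<close>. A flip at such
  a site changes the energy of the box by an amount determined by its disagreements.\<close>

definition core :: "nat \<Rightarrow> site set" where
  "core M = {(a, b). \<bar>a\<bar> < int M \<and> \<bar>b\<bar> < int M}"

lemma core_iff [simp]: "(a, b) \<in> core M \<longleftrightarrow> \<bar>a\<bar> < int M \<and> \<bar>b\<bar> < int M"
  by (simp add: core_def)

lemma core_Suc: "core (Suc M) = Q M"
  by (auto simp: core_def Q_def)

lemma core_subset_Q: "core M \<subseteq> Q M" by (auto simp: core_def Q_def)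

lemma finite_core [simp]: "finite (core M)"
  by (rule finite_subset[OF core_subset_Q]) simp

lemma nbrs_core_subset_Q: "x \<in> core M \<Longrightarrow> nbrs x \<subseteq> Q M"
  by (cases x) (auto simp: nbrs_eq Q_def)

text \<open>Walls are edges of the dual lattice. A horizontal wall separates a site from the one
  above it and is recorded by the lower site; a vertical wall is recorded by the site on its
  left.\<close>

definition hwalls :: "nat \<Rightarrow> config \<Rightarrow> site set" where
  "hwalls M \<sigma> = {(a, b). \<bar>a\<bar> \<le> int M \<and> - int M \<le> b \<and> b < int M \<and> \<sigma> (a, b) \<noteq> \<sigma> (a, b + 1)}"

definition vwalls :: "nat \<Rightarrow> config \<Rightarrow> site set" where
  "vwalls M \<sigma> = {(a, b). - int M \<le> a \<and> a < int M \<and> \<bar>b\<bar> \<le> int M \<and> \<sigma> (a, b) \<noteq> \<sigma> (a + 1, b)}"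

definition energy :: "nat \<Rightarrow> config \<Rightarrow> nat" where
  "energy M \<sigma> = card (hwalls M \<sigma>) + card (vwalls M \<sigma>)"

lemma hwalls_subset: "hwalls M \<sigma> \<subseteq> Q M" and vwalls_subset: "vwalls M \<sigma> \<subseteq> Q M"
  by (auto simp: hwalls_def vwalls_def Q_def)

lemma finite_hwalls [simp]: "finite (hwalls M \<sigma>)" and finite_vwalls [simp]: "finite (vwalls M \<sigma>)"
  by (auto intro: finite_subset[OF hwalls_subset] finite_subset[OF vwalls_subset])

lemma energy_cong: "(\<And>x. x \<in> Q M \<Longrightarrow> \<sigma> x = \<tau> x) \<Longrightarrow> energy M \<sigma> = energy M \<tau>"
proof -
  assume *: "\<And>x. x \<in> Q M \<Longrightarrow> \<sigma> x = \<tau> x"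
  have "hwalls M \<sigma> = hwalls M \<tau>" "vwalls M \<sigma> = vwalls M \<tau>"
    unfolding hwalls_def vwalls_def using * by (auto simp: Q_def abs_le_iff)
  then show ?thesis by (simp add: energy_def)
qed

lemma card_diff_on:
  assumes "finite D" "S \<subseteq> D" "\<And>x. x \<in> D - S \<Longrightarrow> p x = q x"
  shows "card {x \<in> D. q x} + card {x \<in> S. p x} = card {x \<in> D. p x} + card {x \<in> S. q x}"
proof -
  have *: "card {x \<in> D. r x} = card {x \<in> S. r x} + card {x \<in> D - S. r x}" for r
    using assms by (subst card_Un_disjoint[symmetric]) (auto intro: arg_cong[where f=card] finite_subset)
  have "{x \<in> D - S. p x} = {x \<in> D - S. q x}" using assms by auto
  with *[of p] *[of q] show ?thesis by simp
qed

lemma card_filter_two: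
  "x \<noteq> y \<Longrightarrow> card {z \<in> {x, y}. p z} = of_bool (p x) + of_bool (p y)"
proof -
  assume "x \<noteq> y"
  have "{z \<in> {x, y}. p z} = (if p x then {x} else {}) \<union> (if p y then {y} else {})" by auto
  with \<open>x \<noteq> y\<close> show ?thesis by auto
qed

definition flip :: "config \<Rightarrow> site \<Rightarrow> config" where
  "flip \<sigma> x = \<sigma>(x := \<not> \<sigma> x)"

lemma flip_apply: "flip \<sigma> x y = (if y = x then \<not> \<sigma> x else \<sigma> y)"
  by (simp add: flip_def)

text \<open>A flip exchanges agreeing and disagreeing edges at \<open>x\<close>, so \<open>k\<close>
  walls become \<open>4 - k\<close>. The additive form avoids subtraction of natural
  numbers.\<close>

lemma energy_flip_core:
  assumes "x \<in> core M"
  shows "energy M (flip \<sigma> x) + 2 * disagreements \<sigma> x = energy M \<sigma> + 4"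
proof -
  obtain a b where x: "x = (a, b)" by force
  with assms have ab: "\<bar>a\<bar> < int M" "\<bar>b\<bar> < int M" by auto
  let ?DH = "{(a, b). \<bar>a\<bar> \<le> int M \<and> - int M \<le> b \<and> b < int M}"
  let ?DV = "{(a, b). - int M \<le> a \<and> a < int M \<and> \<bar>b\<bar> \<le> int M}"
  let ?H = "\<lambda>\<sigma> x. \<sigma> x \<noteq> \<sigma> (fst x, snd x + 1)"
  let ?V = "\<lambda>\<sigma> x. \<sigma> x \<noteq> \<sigma> (fst x + 1, snd x)"
  have h: "hwalls M \<sigma> = {x \<in> ?DH. ?H \<sigma> x}" "vwalls M \<sigma> = {x \<in> ?DV. ?V \<sigma> x}" for \<sigma> :: config
    by (auto simp: hwalls_def vwalls_def)
  have fin: "finite ?DH" "finite ?DV"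
    by (rule finite_subset[OF _ finite_Q[of M]]; auto simp: Q_def)+
  have H: "card {y \<in> ?DH. ?H \<sigma> y} + card {y \<in> {(a, b), (a, b - 1)}. ?H (flip \<sigma> x) y}
    = card {y \<in> ?DH. ?H (flip \<sigma> x) y} + card {y \<in> {(a, b), (a, b - 1)}. ?H \<sigma> y}"
  proof (rule card_diff_on)
    fix y assume y: "y \<in> ?DH - {(a, b), (a, b - 1)}"
    obtain c d where cd: "y = (c, d)" by force
    have "(c, d) \<noteq> x" "(c, d + 1) \<noteq> x" using y by (auto simp: cd x)
    then show "?H (flip \<sigma> x) y = ?H \<sigma> y" by (simp add: cd flip_apply)
  qed (use ab fin in auto)
  have V: "card {y \<in> ?DV. ?V \<sigma> y} + card {y \<in> {(a, b), (a - 1, b)}. ?V (flip \<sigma> x) y}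
    = card {y \<in> ?DV. ?V (flip \<sigma> x) y} + card {y \<in> {(a, b), (a - 1, b)}. ?V \<sigma> y}"
  proof (rule card_diff_on)
    fix y assume y: "y \<in> ?DV - {(a, b), (a - 1, b)}"
    obtain c d where cd: "y = (c, d)" by force
    have "(c, d) \<noteq> x" "(c + 1, d) \<noteq> x" using y by (auto simp: cd x)
    then show "?V (flip \<sigma> x) y = ?V \<sigma> y" by (simp add: cd flip_apply)
  qed (use ab fin in auto)
  have H': "card {y \<in> {(a, b), (a, b - 1)}. ?H \<tau> y} =
      of_bool (\<tau> (a, b) \<noteq> \<tau> (a, b + 1)) + of_bool (\<tau> (a, b - 1) \<noteq> \<tau> (a, b))" for \<tau> :: config
    by (subst card_filter_two) auto
  have V': "card {y \<in> {(a, b), (a - 1, b)}. ?V \<tau> y} =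
      of_bool (\<tau> (a, b) \<noteq> \<tau> (a + 1, b)) + of_bool (\<tau> (a - 1, b) \<noteq> \<tau> (a, b))" for \<tau> :: config
    by (subst card_filter_two) auto
  have F: "flip \<sigma> x (a, b) = (\<not> \<sigma> (a, b))" "flip \<sigma> x (a + 1, b) = \<sigma> (a + 1, b)"
    "flip \<sigma> x (a - 1, b) = \<sigma> (a - 1, b)" "flip \<sigma> x (a, b + 1) = \<sigma> (a, b + 1)"
    "flip \<sigma> x (a, b - 1) = \<sigma> (a, b - 1)"
    by (simp_all add: flip_apply x)
  define h h' v v' where hv: "h = card (hwalls M \<sigma>)" "h' = card (hwalls M (flip \<sigma> x))"
    "v = card (vwalls M \<sigma>)" "v' = card (vwalls M (flip \<sigma> x))"
  note H [unfolded H' F, folded h hv] and V [unfolded V' F, folded h hv]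
  then show ?thesis
    unfolding energy_def hv[symmetric] unfolding x disagreements_eq
    by (cases "\<sigma> (a, b)"; cases "\<sigma> (a + 1, b)"; cases "\<sigma> (a - 1, b)"; cases "\<sigma> (a, b + 1)";
        cases "\<sigma> (a, b - 1)"; simp)
qed

text \<open>Only four edges touch the flipped site. This crude bound serves for sites on the
  boundary of the box, where disagreements may involve neighbours outside.\<close>

lemma energy_flip_le: "energy M (flip \<sigma> x) \<le> energy M \<sigma> + 4"
proof -
  obtain a b where x: "x = (a, b)" by force
  have "hwalls M (flip \<sigma> x) \<subseteq> hwalls M \<sigma> \<union> {(a, b), (a, b - 1)}"
    by (auto simp: hwalls_def flip_apply x)
  then have "card (hwalls M (flip \<sigma> x)) \<le> card (hwalls M \<sigma> \<union> {(a, b), (a, b - 1)})"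
    by (intro card_mono) auto
  also have "\<dots> \<le> card (hwalls M \<sigma>) + card {(a, b), (a, b - 1)}" by (rule card_Un_le)
  finally have H: "card (hwalls M (flip \<sigma> x)) \<le> card (hwalls M \<sigma>) + 2" by simp
  have "vwalls M (flip \<sigma> x) \<subseteq> vwalls M \<sigma> \<union> {(a, b), (a - 1, b)}"
    by (auto simp: vwalls_def flip_apply x)
  then have "card (vwalls M (flip \<sigma> x)) \<le> card (vwalls M \<sigma> \<union> {(a, b), (a - 1, b)})"
    by (intro card_mono) auto
  also have "\<dots> \<le> card (vwalls M \<sigma>) + card {(a, b), (a - 1, b)}" by (rule card_Un_le)
  finally have V: "card (vwalls M (flip \<sigma> x)) \<le> card (vwalls M \<sigma>) + 2" by simp
  from H V show ?thesis by (simp add: energy_def)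
qed

text \<open>A derivation is a finite path of legal flips in the core that ends at an energy-lowering
  one. The inductive form lets probabilities be estimated backwards along the path.\<close>

inductive bad :: "nat \<Rightarrow> config \<Rightarrow> bool" for M where
  lower: "x \<in> core M \<Longrightarrow> 3 \<le> disagreements \<sigma> x \<Longrightarrow> bad M \<sigma>"
| step: "x \<in> core M \<Longrightarrow> 2 \<le> disagreements \<sigma> x \<Longrightarrow> bad M (flip \<sigma> x) \<Longrightarrow> bad M \<sigma>"

section \<open>Lattice symmetries\<close>

definition lattice_sym :: "(site \<Rightarrow> site) \<Rightarrow> bool" where
  "lattice_sym T \<longleftrightarrow> bij T \<and> (\<forall>x. T ` nbrs x = nbrs (T x)) \<and> (\<forall>M x. T x \<in> core M \<longleftrightarrow> x \<in> core M)"

lemma lattice_symD: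
  assumes "lattice_sym T"
  shows "bij T" "T ` nbrs x = nbrs (T x)" "T x \<in> core M \<longleftrightarrow> x \<in> core M"
  using assms unfolding lattice_sym_def by blast+

lemma disagreements_comp:
  assumes "inj T" "T ` nbrs x = nbrs (T x)"
  shows "disagreements (\<sigma> \<circ> T) x = disagreements \<sigma> (T x)"
proof -
  have "bij_betw T {y \<in> nbrs x. (\<sigma> \<circ> T) y \<noteq> (\<sigma> \<circ> T) x} {y \<in> nbrs (T x). \<sigma> y \<noteq> \<sigma> (T x)}"
    unfolding bij_betw_def assms(2)[symmetric]
    using assms(1) by (auto simp: inj_on_def)
  then show ?thesis unfolding disagreements_def by (rule bij_betw_same_card)
qed

lemma disagreements_sym:
  "lattice_sym T \<Longrightarrow> disagreements (\<sigma> \<circ> T) x = disagreements \<sigma> (T x)"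
  by (intro disagreements_comp) (auto dest: lattice_symD bij_is_inj)

text \<open>A symmetry carries a path of legal flips to another such path. Each geometric argument
  below is thus made in one orientation and transferred by reflections and by the exchange of
  coordinates.\<close>

lemma bad_comp:
  assumes T: "lattice_sym T" and "bad M \<sigma>"
  shows "bad M (\<sigma> \<circ> T)"
  using assms(2)
proof induction
  case (lower x \<sigma>)
  obtain y where y: "x = T y" using lattice_symD(1)[OF T] by (metis bij_pointE)
  show ?case
    by (rule bad.lower[of y]) (use lower T in \<open>auto simp: y disagreements_sym lattice_symD simp del: o_apply\<close>)
next
  case (step x \<sigma>)
  obtain y where y: "x = T y" using lattice_symD(1)[OF T] by (metis bij_pointE)
  have "flip \<sigma> x \<circ> T = flip (\<sigma> \<circ> T) y"
    using bij_is_inj[OF lattice_symD(1)[OF T]] by (auto simp: y flip_apply fun_eq_iff inj_eq)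
  with step.IH have "bad M (flip (\<sigma> \<circ> T) y)" by simp
  moreover have "y \<in> core M" "2 \<le> disagreements (\<sigma> \<circ> T) y"
    using step.hyps T by (simp_all only: y disagreements_sym[OF T] lattice_symD(3)[OF T])
  ultimately show ?case by (rule bad.step[rotated 2])
qed

definition reflect_x :: "site \<Rightarrow> site" where "reflect_x x = (- fst x, snd x)"
definition reflect_y :: "site \<Rightarrow> site" where "reflect_y x = (fst x, - snd x)"

lemma reflect_simps [simp]:
  "reflect_x (a, b) = (- a, b)" "reflect_x (reflect_x x) = x"
  "reflect_y (a, b) = (a, - b)" "reflect_y (reflect_y x) = x"
  by (simp_all add: reflect_x_def reflect_y_def)

lemma lattice_sym_swap: "lattice_sym prod.swap"
  unfolding lattice_sym_def by (auto simp: nbrs_eq image_iff)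

lemma lattice_sym_reflect_x: "lattice_sym reflect_x"
  unfolding lattice_sym_def
proof (intro conjI allI)
  show "bij reflect_x" by (rule involuntory_imp_bij) simp
qed (auto simp: nbrs_eq)

lemma lattice_sym_reflect_y: "lattice_sym reflect_y"
  unfolding lattice_sym_def
proof (intro conjI allI)
  show "bij reflect_y" by (rule involuntory_imp_bij) simp
qed (auto simp: nbrs_eq)

lemma bad_swap_iff: "bad M (\<sigma> \<circ> prod.swap) \<longleftrightarrow> bad M \<sigma>"
  using bad_comp[OF lattice_sym_swap, of M \<sigma>] bad_comp[OF lattice_sym_swap, of M "\<sigma> \<circ> prod.swap"]
  by (auto simp: o_def)

lemma bad_reflect_x_iff: "bad M (\<sigma> \<circ> reflect_x) \<longleftrightarrow> bad M \<sigma>"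
  using bad_comp[OF lattice_sym_reflect_x, of M \<sigma>] bad_comp[OF lattice_sym_reflect_x, of M "\<sigma> \<circ> reflect_x"]
  by (auto simp: o_def)

lemma bad_reflect_y_iff: "bad M (\<sigma> \<circ> reflect_y) \<longleftrightarrow> bad M \<sigma>"
  using bad_comp[OF lattice_sym_reflect_y, of M \<sigma>] bad_comp[OF lattice_sym_reflect_y, of M "\<sigma> \<circ> reflect_y"]
  by (auto simp: o_def)

text \<open>The run is eaten from its left end: the leftmost plus disagrees with its left and upper
  neighbours, so its flip is legal and leaves a shorter run. The last remaining plus also disagrees
  on the right and lowers the energy.\<close>

lemma cap_bad:
  assumes "p \<le> q" "\<And>x. p \<le> x \<Longrightarrow> x \<le> q \<Longrightarrow> (x, b) \<in> core M \<and> \<sigma> (x, b) \<and> \<not> \<sigma> (x, b + 1)"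
    "\<not> \<sigma> (p - 1, b)" "\<not> \<sigma> (q + 1, b)"
  shows "bad M \<sigma>"
  using assms
proof (induction "nat (q - p)" arbitrary: p \<sigma>)
  case 0
  then have "p = q" by simp
  then show ?case using 0 by (intro bad.lower[of "(p, b)"]) (auto simp: disagreements_eq)
next
  case (Suc n)
  then have "p < q" by simp
  have p: "(p, b) \<in> core M" "\<sigma> (p, b)" "\<not> \<sigma> (p, b + 1)" using Suc.prems(2)[of p] \<open>p < q\<close> by auto
  have "bad M (flip \<sigma> (p, b))"
  proof (rule Suc.hyps(1)[of "p + 1"])
    show "n = nat (q - (p + 1))" using Suc.hyps(2) by simp
    show "p + 1 \<le> q" using \<open>p < q\<close> by simp
    show "(x, b) \<in> core M \<and> flip \<sigma> (p, b) (x, b) \<and> \<not> flip \<sigma> (p, b) (x, b + 1)"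
      if "p + 1 \<le> x" "x \<le> q" for x
      using Suc.prems(2)[of x] that by (auto simp: flip_apply)
    show "\<not> flip \<sigma> (p, b) (p + 1 - 1, b)" using p by (simp add: flip_apply)
    show "\<not> flip \<sigma> (p, b) (q + 1, b)" using Suc.prems(4) \<open>p < q\<close> by (simp add: flip_apply)
  qed
  moreover have "2 \<le> disagreements \<sigma> (p, b)"
    using p Suc.prems(3) by (simp add: disagreements_eq)
  ultimately show ?case using bad.step p(1) by blast
qed

section \<open>Closure under bootstrap percolation\<close>

definition up_closed :: "nat \<Rightarrow> config \<Rightarrow> bool" where
  "up_closed M \<tau> \<longleftrightarrow> (\<forall>x\<in>core M. \<not> \<tau> x \<longrightarrow> disagreements \<tau> x \<le> 1)"

text \<open>At a minus site the disagreements count the plus neighbours, so closedness is stability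
  under the rule that two plus neighbours make a site plus.\<close>

lemma up_closedD:
  assumes "up_closed M \<tau>" "\<bar>a\<bar> < int M" "\<bar>b\<bar> < int M" "\<not> \<tau> (a, b)"
  shows "of_bool (\<tau> (a + 1, b)) + of_bool (\<tau> (a - 1, b)) + of_bool (\<tau> (a, b + 1)) + of_bool (\<tau> (a, b - 1)) \<le> (1 :: nat)"
proof -
  have "(a, b) \<in> core M" using assms by simp
  with assms(1,4) have "disagreements \<tau> (a, b) \<le> 1" unfolding up_closed_def by blast
  then show ?thesis using assms(4) unfolding disagreements_eq by simp
qed

lemma up_closed_sym: "lattice_sym T \<Longrightarrow> up_closed M \<tau> \<Longrightarrow> up_closed M (\<tau> \<circ> T)"
  unfolding up_closed_def by (simp only: disagreements_sym o_apply lattice_symD(3)) (simp add: lattice_symD(3))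

text \<open>\<open>\<tau>\<close> is the closure of the plus spins of \<open>\<sigma>\<close> under bootstrap percolation inside the box.\<close>

definition filled :: "nat \<Rightarrow> config \<Rightarrow> config \<Rightarrow> bool" where
  "filled M \<sigma> \<tau> \<longleftrightarrow>
     (\<forall>x. \<sigma> x \<longrightarrow> \<tau> x) \<and> (\<forall>x. x \<notin> core M \<longrightarrow> \<tau> x = \<sigma> x) \<and> \<not> bad M \<tau> \<and> energy M \<tau> = energy M \<sigma> \<and>
     up_closed M \<tau> \<and> (\<forall>P. (\<forall>x. \<sigma> x \<longrightarrow> P x) \<longrightarrow> up_closed M P \<longrightarrow> (\<forall>x. \<tau> x \<longrightarrow> P x))"

lemma filledD:
  assumes "filled M \<sigma> \<tau>"
  shows "\<sigma> x \<Longrightarrow> \<tau> x" "x \<notin> core M \<Longrightarrow> \<tau> x = \<sigma> x" "\<not> bad M \<tau>" "energy M \<tau> = energy M \<sigma>"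
    "up_closed M \<tau>" "(\<And>x. \<sigma> x \<Longrightarrow> P x) \<Longrightarrow> up_closed M P \<Longrightarrow> \<tau> x \<Longrightarrow> P x"
  using assms unfolding filled_def by blast+

text \<open>Sites are filled one at a time, by induction on the number of minus sites in the core. A
  site to be filled has exactly two plus neighbours, as a third would make \<open>\<sigma>\<close>
  bad; so the energy is unchanged, and \<open>bad.step\<close> shows that the new configuration is
  not bad. Every closed configuration above \<open>\<sigma>\<close> must contain the site, which
  gives minimality.\<close>

lemma filled_exists: "\<not> bad M \<sigma> \<Longrightarrow> \<exists>\<tau>. filled M \<sigma> \<tau>"
proof (induction "card {x \<in> core M. \<not> \<sigma> x}" arbitrary: \<sigma> rule: less_induct)
  case less
  show ?case
  proof (cases "up_closed M \<sigma>")
    case True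
    then show ?thesis using less.prems by (intro exI[of _ \<sigma>]) (auto simp: filled_def)
  next
    case False
    then obtain x where x: "x \<in> core M" "\<not> \<sigma> x" "2 \<le> disagreements \<sigma> x"
      by (auto simp: up_closed_def not_le Suc_le_eq numeral_2_eq_2)
    let ?\<sigma> = "flip \<sigma> x"
    have nb: "\<not> bad M ?\<sigma>" using less.prems bad.step x by blast
    have d2: "disagreements \<sigma> x = 2" using less.prems bad.lower[OF x(1), of \<sigma>] x(3) by linarith
    have "card {x \<in> core M. \<not> ?\<sigma> x} < card {x \<in> core M. \<not> \<sigma> x}"
      using x by (intro psubset_card_mono) (auto simp: flip_apply)
    from less.hyps[OF this nb] obtain \<tau> where \<tau>: "filled M ?\<sigma> \<tau>" by blast
    have "energy M ?\<sigma> = energy M \<sigma>" using energy_flip_core[OF x(1), of \<sigma>] d2 by simp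
    moreover have "P x" if P: "\<forall>x. \<sigma> x \<longrightarrow> P x" "up_closed M P" for P
    proof (rule ccontr)
      assume "\<not> P x"
      have "disagreements \<sigma> x \<le> disagreements P x"
        unfolding disagreements_def using P(1) x(2) \<open>\<not> P x\<close>
        by (intro card_mono) auto
      then show False using P(2) x \<open>\<not> P x\<close> by (auto simp: up_closed_def)
    qed
    moreover have "\<sigma> y \<longrightarrow> ?\<sigma> y" "?\<sigma> y \<longleftrightarrow> \<sigma> y \<or> y = x" for y using x by (auto simp: flip_apply)
    ultimately have e: "energy M ?\<sigma> = energy M \<sigma>"
      and P: "\<And>P. \<forall>x. \<sigma> x \<longrightarrow> P x \<Longrightarrow> up_closed M P \<Longrightarrow> P x"
      and s: "\<And>y. ?\<sigma> y \<longleftrightarrow> \<sigma> y \<or> y = x" by blast+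
    have "filled M \<sigma> \<tau>"
      unfolding filled_def
    proof (intro conjI allI impI)
      show "\<tau> y" if "\<sigma> y" for y using that \<tau> s unfolding filled_def by blast
      show "\<tau> y = \<sigma> y" if "y \<notin> core M" for y
      proof -
        have "\<tau> y = ?\<sigma> y" using that \<tau> unfolding filled_def by blast
        then show ?thesis using that x(1) s by auto
      qed
      show "\<not> bad M \<tau>" "up_closed M \<tau>" using \<tau> unfolding filled_def by blast+
      show "energy M \<tau> = energy M \<sigma>" using \<tau> e unfolding filled_def by simp
      fix P y assume *: "\<forall>x. \<sigma> x \<longrightarrow> P x" "up_closed M P" "\<tau> y"
      have "\<forall>z. ?\<sigma> z \<longrightarrow> P z" using s P[OF *(1,2)] *(1) by blast
      with \<tau> *(2,3) show "P y" unfolding filled_def by blast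
    qed
    then show ?thesis by blast
  qed
qed

section \<open>Corners of the closure\<close>

lemma constant_on_interval:
  fixes x y :: int
  assumes "x \<le> y" "\<And>z. x \<le> z \<Longrightarrow> z < y \<Longrightarrow> P z = P (z + 1)"
  shows "P x = P y"
  using assms by (induction rule: int_ge_induct) auto

lemma adjacent_change:
  fixes x y :: int
  assumes "P x" "\<not> P y" "\<bar>x\<bar> < m" "\<bar>y\<bar> < m"
  shows "\<exists>z. \<bar>z\<bar> < m \<and> \<bar>z + 1\<bar> < m \<and> P z \<noteq> P (z + 1)"
proof (rule ccontr)
  assume "\<not> ?thesis"
  then have *: "P z = P (z + 1)" if "\<bar>z\<bar> < m" "\<bar>z + 1\<bar> < m" for z using that by blast
  show False
  proof (cases "x \<le> y")
    case True
    from constant_on_interval[OF this, of P] * assms show False by auto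
  next
    case False
    from constant_on_interval[of y x P] * assms False show False by auto
  qed
qed

text \<open>An outer corner of the plus region pointing up and to the right; the other orientations
  are obtained by reflection.\<close>

definition corner :: "nat \<Rightarrow> config \<Rightarrow> int \<Rightarrow> int \<Rightarrow> bool" where
  "corner M \<tau> a b \<longleftrightarrow> \<bar>a\<bar> < int M \<and> \<bar>a + 1\<bar> < int M \<and> \<bar>b\<bar> < int M \<and> \<bar>b + 1\<bar> < int M \<and>
     \<tau> (a, b) \<and> \<not> \<tau> (a + 1, b) \<and> \<not> \<tau> (a, b + 1)"

text \<open>The wall above the corner continues left to the edge of the core. If the plus run ended
  earlier, \<open>cap_bad\<close> would apply to it; and a minus site above the run already has a
  plus neighbour below, so closedness keeps its left neighbour minus once the run is
  extended.\<close>

lemma corner_row: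
  assumes cl: "up_closed M \<tau>" and nb: "\<not> bad M \<tau>" and c: "corner M \<tau> a b" and "x \<le> a" "- int M < x"
  shows "\<tau> (x, b) \<and> \<not> \<tau> (x, b + 1)"
proof -
  have ab: "\<bar>a\<bar> < int M" "\<bar>a + 1\<bar> < int M" "\<bar>b\<bar> < int M" "\<bar>b + 1\<bar> < int M"
    "\<tau> (a, b)" "\<not> \<tau> (a + 1, b)" "\<not> \<tau> (a, b + 1)"
    using c by (auto simp: corner_def)
  have "- int M < x \<longrightarrow> (\<forall>x'. x \<le> x' \<and> x' \<le> a \<longrightarrow> \<tau> (x', b) \<and> \<not> \<tau> (x', b + 1))"
    using \<open>x \<le> a\<close>
  proof (induction rule: int_le_induct)
    case base
    then show ?case using ab by auto
  next
    case (step x)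
    show ?case
    proof
      assume x: "- int M < x - 1"
      with step have IH: "\<tau> (x', b) \<and> \<not> \<tau> (x', b + 1)" if "x \<le> x'" "x' \<le> a" for x'
        using that by auto
      have 1: "\<tau> (x - 1, b)"
      proof (rule ccontr)
        assume "\<not> \<tau> (x - 1, b)"
        then have "bad M \<tau>"
          by (intro cap_bad[of x a b]) (use IH step.hyps ab x in auto)
        with nb show False ..
      qed
      moreover have "\<not> \<tau> (x - 1, b + 1)"
        using up_closedD[OF cl, of x "b + 1"] IH[of x] step.hyps x ab 1 by auto
      ultimately show "\<forall>x'. x - 1 \<le> x' \<and> x' \<le> a \<longrightarrow> \<tau> (x', b) \<and> \<not> \<tau> (x', b + 1)"
        using IH by (metis add1_zle_eq diff_add_cancel order_le_less)
    qed
  qed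
  then show ?thesis using assms by auto
qed

lemma corner_swap: "corner M (\<tau> \<circ> prod.swap) b a \<longleftrightarrow> corner M \<tau> a b"
  by (auto simp: corner_def)

lemma corner_column:
  assumes "up_closed M \<tau>" "\<not> bad M \<tau>" "corner M \<tau> a b" "y \<le> b" "- int M < y"
  shows "\<tau> (a, y) \<and> \<not> \<tau> (a + 1, y)"
proof -
  have "(\<tau> \<circ> prod.swap) (y, a) \<and> \<not> (\<tau> \<circ> prod.swap) (y, a + 1)"
    by (rule corner_row[OF up_closed_sym[OF lattice_sym_swap assms(1)], where a = b])
      (use assms in \<open>simp_all only: corner_swap bad_swap_iff not_False_eq_True\<close>)
  then show ?thesis by simp
qed

text \<open>Induction on the distance to the corner \<open>(a, b)\<close>: a site off the two given
  sides has plus neighbours to its right and above, and closedness makes it plus.\<close>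

lemma up_closed_rectangle:
  assumes cl: "up_closed M \<tau>" and ab: "\<bar>a\<bar> < int M" "\<bar>b\<bar> < int M"
    and row: "\<And>x. - int M < x \<Longrightarrow> x \<le> a \<Longrightarrow> \<tau> (x, b)" and col: "\<And>y. - int M < y \<Longrightarrow> y \<le> b \<Longrightarrow> \<tau> (a, y)"
    and xy: "- int M < x" "x \<le> a" "- int M < y" "y \<le> b"
  shows "\<tau> (x, y)"
  using xy
proof (induction "nat (a - x) + nat (b - y)" arbitrary: x y rule: less_induct)
  case less
  show ?case
  proof (cases "x = a \<or> y = b")
    case True
    then show ?thesis using less.prems row col by auto
  next
    case False
    have "\<tau> (x + 1, y)" by (rule less.hyps) (use less.prems False in auto)
    moreover have "\<tau> (x, y + 1)" by (rule less.hyps) (use less.prems False in auto)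
    ultimately show ?thesis using up_closedD[OF cl, of x y] less.prems ab by (auto simp: abs_less_iff)
  qed
qed

text \<open>Suppose the second corner is higher. In the same column, or further right, the plus
  region below and left of it contains \<open>(a, b + 1)\<close>, which the first corner requires to
  be minus. Further left, its vertical wall meets row \<open>b\<close> at
  \<open>(a' + 1, b)\<close>, which the row of the first corner requires to be plus.\<close>

lemma corner_unique_aux:
  assumes cl: "up_closed M \<tau>" and nb: "\<not> bad M \<tau>" and c: "corner M \<tau> a b" "corner M \<tau> a' b'"
  shows "b' \<le> b"
proof (rule ccontr)
  assume "\<not> b' \<le> b"
  then have "b < b'" by simp
  have i: "\<bar>a\<bar> < int M" "\<bar>a + 1\<bar> < int M" "\<bar>b\<bar> < int M" "\<bar>b + 1\<bar> < int M" "\<not> \<tau> (a, b + 1)"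
    "\<bar>a'\<bar> < int M" "\<bar>a' + 1\<bar> < int M" "\<bar>b'\<bar> < int M"
    using c by (auto simp: corner_def)
  note row = corner_row[OF cl nb] and col = corner_column[OF cl nb]
  consider "a' = a" | "a' < a" | "a < a'" by linarith
  then show False
  proof cases
    case 1
    with col[OF c(2), of "b + 1"] i \<open>b < b'\<close> show False by (auto simp: abs_less_iff)
  next
    case 2
    with col[OF c(2), of b] row[OF c(1), of "a' + 1"] i \<open>b < b'\<close> show False by (auto simp: abs_less_iff)
  next
    case 3
    have "\<tau> (a, b + 1)"
      by (rule up_closed_rectangle[OF cl, of a' b']) (use row[OF c(2)] col[OF c(2)] i 3 \<open>b < b'\<close> in auto)
    with i show False by simp
  qed
qed

lemma corner_unique:
  assumes "up_closed M \<tau>" "\<not> bad M \<tau>" "corner M \<tau> a b" "corner M \<tau> a' b'"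
  shows "b' = b"
  using corner_unique_aux[OF assms(1,2)] assms(3,4) by (meson order_antisym)

lemma corner_height:
  assumes "up_closed M \<tau>" "\<not> bad M \<tau>"
  obtains c where "\<And>a b. corner M \<tau> a b \<Longrightarrow> b = c"
  using corner_unique[OF assms] by metis

text \<open>A line that is a wall only in part changes at a corner, and there is at most one corner of each
  of the four orientations.\<close>

lemma broken_lines:
  assumes cl: "up_closed M \<tau>" and nb: "\<not> bad M \<tau>"
  obtains C where "finite C" "card C \<le> 4"
    "\<And>b x x'. \<bar>b\<bar> < int M \<Longrightarrow> \<bar>b + 1\<bar> < int M \<Longrightarrow> \<bar>x\<bar> < int M \<Longrightarrow> \<bar>x'\<bar> < int M \<Longrightarrow>
      \<tau> (x, b) \<noteq> \<tau> (x, b + 1) \<Longrightarrow> \<tau> (x', b) = \<tau> (x', b + 1) \<Longrightarrow> b \<in> C"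
proof -
  let ?X = "\<tau> \<circ> reflect_x" and ?Y = "\<tau> \<circ> reflect_y" and ?XY = "\<tau> \<circ> reflect_x \<circ> reflect_y"
  note sx = up_closed_sym[OF lattice_sym_reflect_x] and sy = up_closed_sym[OF lattice_sym_reflect_y]
  obtain c1 where c1: "\<And>a b. corner M \<tau> a b \<Longrightarrow> b = c1" using corner_height[OF cl nb] by blast
  obtain c2 where c2: "\<And>a b. corner M ?X a b \<Longrightarrow> b = c2"
    by (rule corner_height[OF sx[OF cl]]) (auto simp only: bad_reflect_x_iff nb)
  obtain c3 where c3: "\<And>a b. corner M ?Y a b \<Longrightarrow> b = c3"
    by (rule corner_height[OF sy[OF cl]]) (auto simp only: bad_reflect_y_iff nb)
  obtain c4 where c4: "\<And>a b. corner M ?XY a b \<Longrightarrow> b = c4"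
    by (rule corner_height[OF sy[OF sx[OF cl]]]) (auto simp only: bad_reflect_y_iff bad_reflect_x_iff nb)
  \<comment> \<open>Reflection in the horizontal axis sends the pair of rows \<open>b\<close>,
    \<open>b + 1\<close> to \<open>- (b + 1)\<close>, \<open>- b\<close>, so a reflected corner of
    height \<open>c\<close> belongs to the line \<open>b = - c - 1\<close>.\<close>
  let ?C = "{c1, c2, - c3 - 1, - c4 - 1}"
  have add_shift: "- (x + 1) + 1 = - x" for x :: int by simp
  show thesis
  proof (rule that[of ?C])
    show "card ?C \<le> 4" using card_length[of "[c1, c2, - c3 - 1, - c4 - 1]"] by simp
    fix b x x' assume *: "\<bar>b\<bar> < int M" "\<bar>b + 1\<bar> < int M" "\<bar>x\<bar> < int M" "\<bar>x'\<bar> < int M"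
      "\<tau> (x, b) \<noteq> \<tau> (x, b + 1)" "\<tau> (x', b) = \<tau> (x', b + 1)"
    have "\<exists>z. \<bar>z\<bar> < int M \<and> \<bar>z + 1\<bar> < int M \<and>
        (\<tau> (z, b) \<noteq> \<tau> (z, b + 1)) \<noteq> (\<tau> (z + 1, b) \<noteq> \<tau> (z + 1, b + 1))"
      by (rule adjacent_change[of "\<lambda>x. \<tau> (x, b) \<noteq> \<tau> (x, b + 1)" x x']) (use * in simp_all)
    then obtain z where z: "\<bar>z\<bar> < int M" "\<bar>z + 1\<bar> < int M"
      "(\<tau> (z, b) \<noteq> \<tau> (z, b + 1)) \<noteq> (\<tau> (z + 1, b) \<noteq> \<tau> (z + 1, b + 1))"
      by blast
    let ?p = "\<tau> (z, b)" and ?q = "\<tau> (z + 1, b)" and ?r = "\<tau> (z, b + 1)" and ?s = "\<tau> (z + 1, b + 1)"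
    \<comment> \<open>The wall along line \<open>b\<close> is present on exactly one side of the 2
      by 2 square, so the square has an odd number of plus spins. Three are excluded, since the
      minus site would have two plus neighbours; the single plus left is a corner.\<close>
    have n: "\<not> (?p \<and> ?q \<and> ?r \<and> \<not> ?s)" "\<not> (?p \<and> ?q \<and> \<not> ?r \<and> ?s)" "\<not> (?p \<and> \<not> ?q \<and> ?r \<and> ?s)" "\<not> (\<not> ?p \<and> ?q \<and> ?r \<and> ?s)"
      using up_closedD[OF cl, of "z + 1" "b + 1"] up_closedD[OF cl, of z "b + 1"]
        up_closedD[OF cl, of "z + 1" b] up_closedD[OF cl, of z b] z * by auto
    consider "?p" "\<not> ?q" "\<not> ?r" | "?q" "\<not> ?p" "\<not> ?s" | "?r" "\<not> ?s" "\<not> ?p" | "?s" "\<not> ?r" "\<not> ?q"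
      using n z(3) by blast
    then show "b \<in> ?C"
    proof cases
      case 1
      then have "corner M \<tau> z b" using z * by (auto simp: corner_def)
      from c1[OF this] show ?thesis by simp
    next
      case 2
      then have "corner M ?X (- (z + 1)) b" using z *
        by (simp only: corner_def o_apply reflect_simps minus_minus abs_minus_cancel add_shift not_False_eq_True simp_thms)
      from c2[OF this] show ?thesis by simp
    next
      case 3
      then have "corner M ?Y z (- (b + 1))" using z *
        by (simp only: corner_def o_apply reflect_simps minus_minus abs_minus_cancel add_shift not_False_eq_True simp_thms)
      from c3[OF this] show ?thesis by simp
    next
      case 4
      then have "corner M ?XY (- (z + 1)) (- (b + 1))" using z *
        by (simp only: corner_def o_apply reflect_simps minus_minus abs_minus_cancel add_shift not_False_eq_True simp_thms)
      from c4[OF this] show ?thesis by simp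
    qed
  qed simp
qed

section \<open>Full wall lines and plus strips\<close>

lemma filled_swap: "filled M \<sigma> \<tau> \<Longrightarrow> filled M (\<sigma> \<circ> prod.swap) (\<tau> \<circ> prod.swap)"
proof -
  have hw: "hwalls M (\<rho> \<circ> prod.swap) = prod.swap ` vwalls M \<rho>" for \<rho>
    by (auto simp: hwalls_def vwalls_def image_iff)
  have vw: "vwalls M (\<rho> \<circ> prod.swap) = prod.swap ` hwalls M \<rho>" for \<rho>
    by (auto simp: hwalls_def vwalls_def image_iff)
  have e: "energy M (\<rho> \<circ> prod.swap) = energy M \<rho>" for \<rho>
    unfolding energy_def hw vw by (simp add: card_image add.commute)
  have c: "prod.swap x \<in> core M \<longleftrightarrow> x \<in> core M" for x by (cases x) auto
  assume f: "filled M \<sigma> \<tau>"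
  show ?thesis
    unfolding filled_def
  proof (intro conjI allI impI)
    show "(\<tau> \<circ> prod.swap) x" if "(\<sigma> \<circ> prod.swap) x" for x
      using that filledD(1)[OF f] by simp
    show "(\<tau> \<circ> prod.swap) x = (\<sigma> \<circ> prod.swap) x" if "x \<notin> core M" for x
      using that filledD(2)[OF f] c by simp
    show "\<not> bad M (\<tau> \<circ> prod.swap)" using filledD(3)[OF f] by (simp only: bad_swap_iff not_False_eq_True)
    show "energy M (\<tau> \<circ> prod.swap) = energy M (\<sigma> \<circ> prod.swap)" using filledD(4)[OF f] by (simp only: e)
    show "up_closed M (\<tau> \<circ> prod.swap)" by (rule up_closed_sym[OF lattice_sym_swap filledD(5)[OF f]])
    fix P x assume P: "\<forall>x. (\<sigma> \<circ> prod.swap) x \<longrightarrow> P x" "up_closed M P" and x: "(\<tau> \<circ> prod.swap) x"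
    have "(P \<circ> prod.swap) (prod.swap x)"
    proof (rule filledD(6)[OF f])
      show "(P \<circ> prod.swap) y" if "\<sigma> y" for y using P(1)[rule_format, of "prod.swap y"] that by simp
      show "up_closed M (P \<circ> prod.swap)" by (rule up_closed_sym[OF lattice_sym_swap P(2)])
    qed (use x in simp)
    then show "P x" by simp
  qed
qed

text \<open>Opposite orientations in two consecutive rows would form a 2 by 2 checkerboard, in which
  a minus site has two plus neighbours. The same fact forbids a full vertical and a full horizontal
  wall line from crossing.\<close>

lemma no_checkerboard:
  assumes "up_closed M \<tau>" "\<bar>a\<bar> < int M" "\<bar>b\<bar> < int M" "\<bar>a + 1\<bar> < int M" "\<bar>b + 1\<bar> < int M"
    and "\<tau> (a, b) \<noteq> \<tau> (a + 1, b)" "\<tau> (a, b + 1) \<noteq> \<tau> (a + 1, b + 1)"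
  shows "\<tau> (a, b) = \<tau> (a, b + 1)"
  using up_closedD[OF assms(1-3)] up_closedD[OF assms(1,4,3)] assms(6,7) by auto

lemma straight_wall:
  assumes "up_closed M \<tau>" "\<bar>a\<bar> < int M" "\<bar>a + 1\<bar> < int M" "\<bar>y\<bar> < int M" "\<bar>y'\<bar> < int M"
    and "\<And>y. \<bar>y\<bar> < int M \<Longrightarrow> \<tau> (a, y) \<noteq> \<tau> (a + 1, y)"
  shows "\<tau> (a, y) = \<tau> (a, y')"
proof (rule ccontr)
  assume "\<tau> (a, y) \<noteq> \<tau> (a, y')"
  then obtain z where "\<bar>z\<bar> < int M" "\<bar>z + 1\<bar> < int M" "\<tau> (a, z) \<noteq> \<tau> (a, z + 1)"
    using adjacent_change[of "\<lambda>y. \<tau> (a, y)" y y' "int M"] adjacent_change[of "\<lambda>y. \<tau> (a, y)" y' y "int M"] assms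
    by (metis (full_types))
  then show False using no_checkerboard[of M \<tau> a z] assms by blast
qed

text \<open>Each element marks a full vertical wall line of the core with minus on its left and plus
  on its right, that is, the left edge of a plus strip. Only this orientation is counted, because
  only plus strips of the closure are forced to contain plus spins of
  \<open>\<sigma>\<close>.\<close>

definition ascents :: "nat \<Rightarrow> config \<Rightarrow> int set" where
  "ascents M \<tau> = {a. \<bar>a\<bar> < int M \<and> \<bar>a + 1\<bar> < int M \<and> (\<forall>y. \<bar>y\<bar> < int M \<longrightarrow> \<not> \<tau> (a, y) \<and> \<tau> (a + 1, y))}"

lemma ascentsD:
  assumes "a \<in> ascents M \<tau>"
  shows "\<bar>a\<bar> < int M" "\<bar>a + 1\<bar> < int M" "\<bar>y\<bar> < int M \<Longrightarrow> \<not> \<tau> (a, y)" "\<bar>y\<bar> < int M \<Longrightarrow> \<tau> (a + 1, y)"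
  using assms by (auto simp: ascents_def)

text \<open>The minus spins at \<open>a\<close> and \<open>a'\<close> bound the leftmost plus run of
  row \<open>y\<close> on both sides, and the empty row above caps it, so \<open>cap_bad\<close>
  applies.\<close>

lemma strip_cap:
  assumes "\<bar>a\<bar> < int M" "\<bar>a'\<bar> < int M" "\<bar>y\<bar> < int M" "\<not> \<sigma> (a, y)" "\<not> \<sigma> (a', y)"
    and x: "a < x" "x < a'" "\<sigma> (x, y)" and empty: "\<And>x. a < x \<Longrightarrow> x < a' \<Longrightarrow> \<not> \<sigma> (x, y + 1)"
  shows "bad M \<sigma>"
proof -
  let ?S = "{x \<in> {a<..<a'}. \<sigma> (x, y)}"
  have finS: "finite ?S" by (rule finite_subset[of _ "{a<..<a'}"]) auto
  define p where "p = Min ?S"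
  have p: "p \<in> ?S" unfolding p_def using x by (intro Min_in[OF finS]) auto
  have pmin: "p \<le> z" if "z \<in> ?S" for z unfolding p_def using that by (rule Min_le[OF finS])
  let ?R = "{x \<in> {p<..a'}. \<not> \<sigma> (x, y)}"
  have finR: "finite ?R" by (rule finite_subset[of _ "{p<..a'}"]) auto
  define r where "r = Min ?R"
  have r: "r \<in> ?R" unfolding r_def using p assms by (intro Min_in[OF finR]) auto
  have rmin: "r \<le> z" if "z \<in> ?R" for z unfolding r_def using that by (rule Min_le[OF finR])
  show ?thesis
  proof (rule cap_bad[of p "r - 1" y])
    show "p \<le> r - 1" using r by auto
    show "\<not> \<sigma> (p - 1, y)" using pmin[of "p - 1"] p assms by (cases "p - 1 = a") auto
    show "\<not> \<sigma> (r - 1 + 1, y)" using r by simp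
    fix z assume z: "p \<le> z" "z \<le> r - 1"
    have "\<sigma> (z, y)"
    proof (cases "z = p")
      case False
      then show ?thesis using rmin[of z] z r by force
    qed (use p in simp)
    moreover have "a < z" "z < a'" using z p r by auto
    ultimately show "(z, y) \<in> core M \<and> \<sigma> (z, y) \<and> \<not> \<sigma> (z, y + 1)"
      using empty assms by auto
  qed
qed

text \<open>Minimality of \<open>\<tau>\<close> puts some plus spin of \<open>\<sigma>\<close> into
  the strip: otherwise erasing the strip from \<open>\<tau>\<close> leaves a smaller closed
  configuration above \<open>\<sigma>\<close>. If some row of the strip were empty, an occupied row
  would adjoin an empty one, and \<open>strip_cap\<close>, used upwards or after a reflection, would
  make \<open>\<sigma>\<close> bad.\<close>

lemma strip_occupied:
  assumes f: "filled M \<sigma> \<tau>" and nb: "\<not> bad M \<sigma>" and M: "2 \<le> M"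
    and a: "a \<in> ascents M \<tau>" and a': "a' \<in> ascents M \<tau>" and less: "a < a'" and b: "\<bar>b\<bar> < int M"
  shows "\<exists>x. a < x \<and> x < a' \<and> \<sigma> (x, b)"
proof (rule ccontr)
  assume none: "\<not> ?thesis"
  define N where "N y \<longleftrightarrow> (\<exists>x. a < x \<and> x < a' \<and> \<sigma> (x, y))" for y
  note le = filledD(1)[OF f] and cl = filledD(5)[OF f]
  note A = ascentsD[OF a] and A' = ascentsD[OF a']
  have "\<exists>y. \<bar>y\<bar> < int M \<and> N y"
  proof (rule ccontr)
    assume e: "\<not> ?thesis"
    \<comment> \<open>This is \<open>\<tau>\<close> with the part of the strip in the core erased.
      The columns \<open>a\<close> and \<open>a'\<close> are minus, so an erased site has no plus
      neighbour to its left or right.\<close>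
    define P where "P x \<longleftrightarrow> \<tau> x \<and> \<not> (x \<in> core M \<and> a < fst x \<and> fst x < a')" for x
    have "\<forall>x. \<sigma> x \<longrightarrow> P x" using e le by (auto simp: P_def N_def)
    moreover have "up_closed M P"
      unfolding up_closed_def
    proof (intro ballI impI)
      fix x assume x: "x \<in> core M" "\<not> P x"
      obtain c d where cd: "x = (c, d)" by force
      have i: "\<bar>c\<bar> < int M" "\<bar>d\<bar> < int M" using x by (auto simp: cd)
      have d: "disagreements P (c, d) = of_bool (P (c + 1, d)) + of_bool (P (c - 1, d)) + of_bool (P (c, d + 1)) + of_bool (P (c, d - 1))"
        using x(2) unfolding disagreements_eq cd by simp
      show "disagreements P x \<le> 1"
      proof (cases "\<tau> (c, d)")
        case False
        have Pt: "of_bool (P z) \<le> (of_bool (\<tau> z) :: nat)" for z by (simp add: P_def)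
        show ?thesis unfolding cd d using up_closedD[OF cl i False]
          by (rule order_trans[rotated]) (intro add_mono Pt)
      next
        case True
        then have s: "a < c" "c < a'" using x by (auto simp: P_def cd)
        have "\<not> P (c + 1, d)"
          using A' i s by (cases "c + 1 = a'") (auto simp: P_def abs_less_iff)
        moreover have "\<not> P (c - 1, d)"
          using A i s by (cases "c - 1 = a") (auto simp: P_def abs_less_iff)
        \<comment> \<open>Since \<open>2 \<le> M\<close>, at least one vertical neighbour is in the
          core and is erased too; the other may be a plus site on the boundary of the box.\<close>
        moreover have "\<not> P (c, d + 1) \<or> \<not> P (c, d - 1)"
          using i s M unfolding P_def by auto
        ultimately show ?thesis unfolding cd d by auto
      qed
    qed
    ultimately have "\<forall>x. \<tau> x \<longrightarrow> P x" using filledD(6)[OF f] by blast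
    with A(4)[OF b] have "P (a + 1, b)" by blast
    moreover have "a + 1 \<noteq> a'" using A(4)[OF b] A'(3)[OF b] by auto
    ultimately show False using A less b by (auto simp: P_def)
  qed
  then obtain y where y: "\<bar>y\<bar> < int M" "N y" by blast
  have "\<not> N b" using none by (auto simp: N_def)
  from adjacent_change[of N, OF y(2) this y(1) b]
  obtain z where z: "\<bar>z\<bar> < int M" "\<bar>z + 1\<bar> < int M" "N z \<noteq> N (z + 1)" by blast
  have s: "\<not> \<sigma> (a, w)" "\<not> \<sigma> (a', w)" if "\<bar>w\<bar> < int M" for w
    using A(3)[OF that] A'(3)[OF that] le by blast+
  have "bad M \<sigma>"
  proof (cases "N z")
    case True
    then obtain x where "a < x" "x < a'" "\<sigma> (x, z)" by (auto simp: N_def)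
    then show ?thesis
      by (rule strip_cap[of a M a' z \<sigma> x, OF A(1) A'(1) z(1) s(1)[OF z(1)] s(2)[OF z(1)]])
        (use True z in \<open>auto simp: N_def\<close>)
  next
    case False
    with z obtain x where "a < x" "x < a'" "\<sigma> (x, z + 1)" by (auto simp: N_def)
    moreover have "(\<sigma> \<circ> reflect_y) (w, - (z + 1)) = \<sigma> (w, z + 1)" "(\<sigma> \<circ> reflect_y) (w, - (z + 1) + 1) = \<sigma> (w, z)" for w
    proof -
      have "- (- (z + 1) + 1) = z" by simp
      then show "(\<sigma> \<circ> reflect_y) (w, - (z + 1)) = \<sigma> (w, z + 1)" "(\<sigma> \<circ> reflect_y) (w, - (z + 1) + 1) = \<sigma> (w, z)"
        by (simp_all only: o_apply reflect_simps minus_minus)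
    qed
    ultimately have "bad M (\<sigma> \<circ> reflect_y)"
      using False s[OF z(2)] z(2)
      by (intro strip_cap[of a M a' "- (z + 1)" _ x, OF A(1) A'(1)]) (simp_all only: abs_minus_cancel N_def, blast+)
    then show ?thesis by (simp only: bad_reflect_y_iff)
  qed
  with nb show False ..
qed

section \<open>Counting walls row by row\<close>

definition row_ups :: "nat \<Rightarrow> config \<Rightarrow> int \<Rightarrow> int set" where
  "row_ups M \<sigma> b = {x. - int M \<le> x \<and> x < int M \<and> \<not> \<sigma> (x, b) \<and> \<sigma> (x + 1, b)}"

definition row_walls :: "nat \<Rightarrow> config \<Rightarrow> int \<Rightarrow> int set" where
  "row_walls M \<sigma> b = {x. - int M \<le> x \<and> x < int M \<and> \<sigma> (x, b) \<noteq> \<sigma> (x + 1, b)}"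

lemma finite_row [simp]: "finite (row_ups M \<sigma> b)" "finite (row_walls M \<sigma> b)"
  by (rule finite_subset[of _ "{- int M..int M}"]; auto simp: row_ups_def row_walls_def)+

text \<open>Steps up and steps down along an interval telescope to the difference of the end values.
  Hence they alternate in number up to one, and counting steps up determines the number of walls up
  to one.\<close>

lemma interval_balance:
  fixes lo hi :: int
  assumes "lo \<le> hi"
  shows "card {x. lo \<le> x \<and> x < hi \<and> \<not> f x \<and> f (x + 1)} + of_bool (f lo) =
    card {x. lo \<le> x \<and> x < hi \<and> f x \<and> \<not> f (x + 1)} + of_bool (f hi)"
  using assms
proof (induction rule: int_ge_induct)
  case base
  have e: "{x. lo \<le> x \<and> x < lo \<and> p x} = {}" for p by auto
  show ?case unfolding e[of "\<lambda>x. \<not> f x \<and> f (x + 1)"] e[of "\<lambda>x. f x \<and> \<not> f (x + 1)"] by simp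
next
  case (step i)
  have fin: "finite {x. lo \<le> x \<and> x < i \<and> p x}" for p
    by (rule finite_subset[of _ "{lo..i}"]) auto
  have "{x. lo \<le> x \<and> x < i + 1 \<and> p x} = {x. lo \<le> x \<and> x < i \<and> p x} \<union> (if p i then {i} else {})" for p
    using step.hyps by (auto simp: order_le_less)
  note split = this
  have *: "card {x. lo \<le> x \<and> x < i + 1 \<and> p x} = card {x. lo \<le> x \<and> x < i \<and> p x} + of_bool (p i)" for p
    unfolding split using fin[of p] by (subst card_Un_disjoint) auto
  show ?case
    using step.IH unfolding *[of "\<lambda>x. \<not> f x \<and> f (x + 1)"] *[of "\<lambda>x. f x \<and> \<not> f (x + 1)"]
    by (cases "f i"; cases "f (i + 1)") simp_all
qed

lemma row_walls_ups: "card (row_walls M \<sigma> b) \<le> 2 * card (row_ups M \<sigma> b) + 1" (is ?A)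
  "2 * card (row_ups M \<sigma> b) \<le> card (row_walls M \<sigma> b) + 1" (is ?B)
proof -
  let ?D = "{x. - int M \<le> x \<and> x < int M \<and> \<sigma> (x, b) \<and> \<not> \<sigma> (x + 1, b)}"
  have "finite ?D" by (rule finite_subset[of _ "{- int M..int M}"]) auto
  moreover have "row_walls M \<sigma> b = row_ups M \<sigma> b \<union> ?D" "row_ups M \<sigma> b \<inter> ?D = {}"
    by (auto simp: row_walls_def row_ups_def)
  ultimately have "card (row_walls M \<sigma> b) = card (row_ups M \<sigma> b) + card ?D"
    by (simp add: card_Un_disjoint)
  moreover have "card (row_ups M \<sigma> b) + of_bool (\<sigma> (- int M, b)) = card ?D + of_bool (\<sigma> (int M, b))"
    using interval_balance[of "- int M" "int M" "\<lambda>x. \<sigma> (x, b)"] by (simp add: row_ups_def)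
  ultimately show ?A ?B by (auto split: if_splits simp: of_bool_def)
qed

lemma card_vwalls: "card (vwalls M \<sigma>) = (\<Sum>b\<in>{- int M..int M}. card (row_walls M \<sigma> b))"
proof -
  have "vwalls M \<sigma> = prod.swap ` Sigma {- int M..int M} (row_walls M \<sigma>)"
    by (auto simp: vwalls_def row_walls_def image_iff)
  then have "card (vwalls M \<sigma>) = card (Sigma {- int M..int M} (row_walls M \<sigma>))"
    by (simp add: card_image)
  then show ?thesis by simp
qed

lemma finite_ascents [simp]: "finite (ascents M \<tau>)"
  by (rule finite_subset[of _ "{- int M..int M}"]) (auto simp: ascents_def)

text \<open>Every ascent except the last is sent to the step up of \<open>\<sigma>\<close> just
  before the first plus spin to its right. By \<open>strip_occupied\<close> that step comes before
  the next ascent, so the map is injective. No strip follows the last ascent, whence the added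
  \<open>1\<close>.\<close>

lemma card_ascents:
  assumes f: "filled M \<sigma> \<tau>" and nb: "\<not> bad M \<sigma>" and M: "2 \<le> M" and b: "\<bar>b\<bar> < int M"
  shows "card (ascents M \<tau>) \<le> card (row_ups M \<sigma> b) + 1"
proof (cases "ascents M \<tau> = {}")
  case False
  let ?A = "ascents M \<tau>"
  let ?X = "\<lambda>a. {x \<in> {a<..int M}. \<sigma> (x, b)}"
  define m where "m a = Min (?X a) - 1" for a
  have finX: "finite (?X a)" for a by (rule finite_subset[of _ "{a<..int M}"]) auto
  have occ: "\<exists>x. a < x \<and> x < a' \<and> \<sigma> (x, b)" if "a \<in> ?A" "a' \<in> ?A" "a < a'" for a a'
    using strip_occupied[OF f nb M that b] .
  have m_less: "m a < a'" if "a \<in> ?A" "a' \<in> ?A" "a < a'" for a a'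
  proof -
    from occ[OF that] obtain x where x: "a < x" "x < a'" "\<sigma> (x, b)" by blast
    then have "Min (?X a) \<le> x" using ascentsD(1)[OF that(2)] by (intro Min_le[OF finX]) auto
    with x show ?thesis by (simp add: m_def)
  qed
  have m_ge: "a \<le> m a" and m_up: "m a \<in> row_ups M \<sigma> b" if "a \<in> ?A - {Max ?A}" for a
  proof -
    have "a \<le> Max ?A" "a \<noteq> Max ?A" using that by (auto intro: Max_ge)
    then have "a < Max ?A" by (rule order_le_neq_trans)
    with that have aA: "a \<in> ?A" "a < Max ?A" by blast+
    have mA: "Max ?A \<in> ?A" using False by simp
    from occ[OF aA(1) mA aA(2)] have "?X a \<noteq> {}" using ascentsD(1)[OF mA] by force
    then have in_X: "Min (?X a) \<in> ?X a" by (intro Min_in[OF finX])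
    then show "a \<le> m a" by (auto simp: m_def)
    moreover have "\<not> \<sigma> (m a, b)"
    proof (cases "m a = a")
      case True
      then show ?thesis using ascentsD(3)[OF aA(1) b] filledD(1)[OF f] by auto
    next
      case False
      show ?thesis
      proof
        assume "\<sigma> (m a, b)"
        then have "Min (?X a) \<le> m a" using \<open>a \<le> m a\<close> False in_X by (intro Min_le[OF finX]) (auto simp: m_def)
        then show False by (simp add: m_def)
      qed
    qed
    ultimately show "m a \<in> row_ups M \<sigma> b"
      using in_X ascentsD(1)[OF aA(1)] by (auto simp: row_ups_def m_def)
  qed
  have "inj_on m (?A - {Max ?A})"
  proof (rule linorder_inj_onI)
    fix a a' assume "a < a'" "a \<in> ?A - {Max ?A}" "a' \<in> ?A - {Max ?A}"
    then show "m a \<noteq> m a'" using m_less[of a a'] m_ge[of a'] by auto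
  qed auto
  then have "card (?A - {Max ?A}) \<le> card (row_ups M \<sigma> b)"
    by (rule card_inj_on_le) (use m_up in auto)
  then show ?thesis using False by (simp add: card_Diff_singleton)
qed simp

text \<open>In a row of the core, the steps up of \<open>\<tau>\<close> are ascents except on at
  most four broken lines and the two outermost positions. So \<open>\<tau>\<close> has at most seven
  more steps up than \<open>\<sigma>\<close>, and the conversion between steps up and walls costs
  two more, giving \<open>16 = 2 * 7 + 2\<close>. In the rows outside the core the two
  configurations coincide.\<close>

lemma vwalls_filled:
  assumes f: "filled M \<sigma> \<tau>" and nb: "\<not> bad M \<sigma>" and M: "2 \<le> M"
  shows "card (vwalls M \<tau>) \<le> card (vwalls M \<sigma>) + 16 * (2 * M + 1)"
proof -
  note cl = filledD(5)[OF f] and nb' = filledD(3)[OF f] and off = filledD(2)[OF f]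
  have "up_closed M (\<tau> \<circ> prod.swap)" "\<not> bad M (\<tau> \<circ> prod.swap)"
    using cl nb' by (simp_all only: up_closed_sym[OF lattice_sym_swap] bad_swap_iff not_False_eq_True)
  from broken_lines[OF this] obtain C where C: "finite C" "card C \<le> 4"
    "\<And>b x x'. \<bar>b\<bar> < int M \<Longrightarrow> \<bar>b + 1\<bar> < int M \<Longrightarrow> \<bar>x\<bar> < int M \<Longrightarrow> \<bar>x'\<bar> < int M \<Longrightarrow>
      (\<tau> \<circ> prod.swap) (x, b) \<noteq> (\<tau> \<circ> prod.swap) (x, b + 1) \<Longrightarrow>
      (\<tau> \<circ> prod.swap) (x', b) = (\<tau> \<circ> prod.swap) (x', b + 1) \<Longrightarrow> b \<in> C" by metis
  have row: "card (row_walls M \<tau> b) \<le> card (row_walls M \<sigma> b) + 16" if "\<bar>b\<bar> \<le> int M" for b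
  proof (cases "\<bar>b\<bar> < int M")
    case False
    then have "row_walls M \<tau> b = row_walls M \<sigma> b" by (simp add: row_walls_def off)
    then show ?thesis by simp
  next
    case b: True
    have "row_ups M \<tau> b \<subseteq> ascents M \<tau> \<union> (C \<union> {- int M, int M - 1})"
    proof
      fix x assume x: "x \<in> row_ups M \<tau> b"
      show "x \<in> ascents M \<tau> \<union> (C \<union> {- int M, int M - 1})"
      proof (cases "\<bar>x\<bar> < int M \<and> \<bar>x + 1\<bar> < int M \<and> x \<notin> C")
        case False
        then show ?thesis using x by (auto simp: row_ups_def)
      next
        case i: True
        have ne: "\<tau> (x, y) \<noteq> \<tau> (x + 1, y)" if "\<bar>y\<bar> < int M" for y
          using C(3)[of x b y] i b that x by (auto simp: row_ups_def)
        have "\<tau> (x, b) = \<tau> (x, y)" if "\<bar>y\<bar> < int M" for y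
          by (rule straight_wall[OF cl _ _ b that]) (use i ne in auto)
        then show ?thesis using ne i x b by (auto simp: ascents_def row_ups_def)
      qed
    qed
    then have "card (row_ups M \<tau> b) \<le> card (ascents M \<tau> \<union> (C \<union> {- int M, int M - 1}))"
      using C(1) by (intro card_mono) auto
    also have "\<dots> \<le> card (ascents M \<tau>) + (card C + card {- int M, int M - 1})"
      by (intro order_trans[OF card_Un_le] add_mono card_Un_le order_refl)
    also have "card {- int M, int M - 1} \<le> 2" by (simp add: card_insert_if)
    finally have "card (row_ups M \<tau> b) \<le> card (ascents M \<tau>) + 6" using C(2) by simp
    with card_ascents[OF f nb M b] row_walls_ups(1)[of M \<tau> b] row_walls_ups(2)[of M \<sigma> b]
    show ?thesis by linarith
  qed
  have "card (vwalls M \<tau>) \<le> (\<Sum>b\<in>{- int M..int M}. card (row_walls M \<sigma> b) + 16)"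
    unfolding card_vwalls by (intro sum_mono row) auto
  also have "\<dots> = card (vwalls M \<sigma>) + 16 * (2 * M + 1)"
    unfolding card_vwalls by (simp add: sum.distrib)
  finally show ?thesis .
qed

text \<open>Without a full horizontal wall line, each horizontal wall lies on one of at most four
  broken lines, on one of the two extreme lines, or in one of the two extreme columns. Each of these
  eight families has at most \<open>2 * M + 1\<close> walls.\<close>

lemma hwalls_closed:
  assumes cl: "up_closed M \<tau>" and nb: "\<not> bad M \<tau>"
    and no_line: "\<And>b. \<bar>b\<bar> < int M \<Longrightarrow> \<bar>b + 1\<bar> < int M \<Longrightarrow> \<exists>x. \<bar>x\<bar> < int M \<and> \<tau> (x, b) = \<tau> (x, b + 1)"
  shows "card (hwalls M \<tau>) \<le> 8 * (2 * M + 1)"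
proof -
  from broken_lines[OF cl nb] obtain C where C: "finite C" "card C \<le> 4"
    "\<And>b x x'. \<bar>b\<bar> < int M \<Longrightarrow> \<bar>b + 1\<bar> < int M \<Longrightarrow> \<bar>x\<bar> < int M \<Longrightarrow> \<bar>x'\<bar> < int M \<Longrightarrow>
      \<tau> (x, b) \<noteq> \<tau> (x, b + 1) \<Longrightarrow> \<tau> (x', b) = \<tau> (x', b + 1) \<Longrightarrow> b \<in> C" by metis
  let ?I = "{- int M..int M}" and ?D = "C \<union> {- int M, int M - 1}" and ?E = "{- int M, int M}"
  have cardI: "card ?I = 2 * M + 1" by (simp add: nat_add_distrib nat_mult_distrib)
  have "hwalls M \<tau> \<subseteq> ?I \<times> ?D \<union> ?E \<times> ?I"
  proof
    fix z assume z: "z \<in> hwalls M \<tau>"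
    obtain x b where xb: "z = (x, b)" by force
    have h: "\<bar>x\<bar> \<le> int M" "- int M \<le> b" "b < int M" "\<tau> (x, b) \<noteq> \<tau> (x, b + 1)"
      using z by (auto simp: hwalls_def xb)
    show "z \<in> ?I \<times> ?D \<union> ?E \<times> ?I"
    proof (cases "\<bar>x\<bar> < int M \<and> \<bar>b\<bar> < int M \<and> \<bar>b + 1\<bar> < int M")
      case True
      then have "b \<in> C" using no_line[of b] C(3)[of b x] h by blast
      then show ?thesis using h by (auto simp: xb)
    next
      case False
      then have "x = - int M \<or> x = int M \<or> b = - int M \<or> b = int M - 1" using h by linarith
      then show ?thesis using h by (auto simp: xb)
    qed
  qed
  then have "card (hwalls M \<tau>) \<le> card (?I \<times> ?D \<union> ?E \<times> ?I)"
    using C(1) by (intro card_mono) auto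
  also have "\<dots> \<le> card (?I \<times> ?D) + card (?E \<times> ?I)" by (rule card_Un_le)
  also have "\<dots> = (2 * M + 1) * card ?D + card ?E * (2 * M + 1)"
    unfolding card_cartesian_product cardI ..
  also have "\<dots> \<le> (2 * M + 1) * 6 + 2 * (2 * M + 1)"
  proof (intro add_mono mult_mono order_refl)
    have "card ?D \<le> card C + card {- int M, int M - 1}" by (rule card_Un_le)
    also have "\<dots> \<le> 4 + 2" using C(2) by (intro add_mono) (auto simp: card_insert_if)
    finally show "card ?D \<le> 6" by simp
  qed (auto simp: card_insert_if)
  finally show ?thesis by simp
qed

text \<open>A flippable site whose vertical neighbours agree with it sits between two vertical walls;
  flipping it would make its upper neighbour energy-lowering unless one of the two walls bends there.\<close>

lemma flippable_hwalls:
  assumes nb: "\<not> bad M \<sigma>"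
  shows "card {x \<in> core (M - 1). 2 \<le> disagreements \<sigma> x} \<le> 4 * card (hwalls M \<sigma>)"
proof -
  let ?H = "hwalls M \<sigma>"
  let ?f = "\<lambda>i j (a, b). (a + i, b + j) :: site"
  \<comment> \<open>A flippable site lies directly below or above a horizontal wall, or beside a
    site directly below one; these are the four copies of \<open>?H\<close>. The margin of one site
    keeps the upper neighbour in the core.\<close>
  have "{x \<in> core (M - 1). 2 \<le> disagreements \<sigma> x} \<subseteq> (?H \<union> ?f 0 1 ` ?H) \<union> (?f 1 0 ` ?H \<union> ?f (-1) 0 ` ?H)"
  proof
    fix x assume x: "x \<in> {x \<in> core (M - 1). 2 \<le> disagreements \<sigma> x}"
    obtain a b where ab: "x = (a, b)" by force
    have i: "\<bar>a\<bar> < int M - 1" "\<bar>b\<bar> < int M - 1" using x by (auto simp: ab)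
    show "x \<in> (?H \<union> ?f 0 1 ` ?H) \<union> (?f 1 0 ` ?H \<union> ?f (-1) 0 ` ?H)"
    proof (cases "\<sigma> (a, b) \<noteq> \<sigma> (a, b + 1) \<or> \<sigma> (a, b) \<noteq> \<sigma> (a, b - 1)")
      case True
      then have "(a, b) \<in> ?H \<or> (a, b - 1) \<in> ?H" using i by (auto simp: hwalls_def)
      moreover have "(a, b) = ?f 0 1 (a, b - 1)" by simp
      ultimately show ?thesis unfolding ab by blast
    next
      case False
      then have d: "\<sigma> (a + 1, b) \<noteq> \<sigma> (a, b)" "\<sigma> (a - 1, b) \<noteq> \<sigma> (a, b)"
        using x by (auto simp: ab disagreements_eq of_bool_def split: if_splits)
      have "\<sigma> (a + 1, b + 1) \<noteq> \<sigma> (a + 1, b) \<or> \<sigma> (a - 1, b + 1) \<noteq> \<sigma> (a - 1, b)"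
      proof (rule ccontr)
        assume "\<not> ?thesis"
        then have "3 \<le> disagreements (flip \<sigma> (a, b)) (a, b + 1)"
          using d False by (auto simp: disagreements_eq flip_apply)
        then have "bad M (flip \<sigma> (a, b))" by (rule bad.lower[rotated]) (use i in auto)
        then have "bad M \<sigma>" by (rule bad.step[rotated 2]) (use i x in \<open>auto simp: ab\<close>)
        with nb show False ..
      qed
      then have "(a + 1, b) \<in> ?H \<or> (a - 1, b) \<in> ?H" using i by (auto simp: hwalls_def)
      moreover have "(a, b) = ?f 1 0 (a - 1, b)" "(a, b) = ?f (-1) 0 (a + 1, b)" by simp_all
      ultimately show ?thesis unfolding ab by blast
    qed
  qed
  then have "card {x \<in> core (M - 1). 2 \<le> disagreements \<sigma> x}
    \<le> card ((?H \<union> ?f 0 1 ` ?H) \<union> (?f 1 0 ` ?H \<union> ?f (-1) 0 ` ?H))"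
    by (intro card_mono) auto
  also have "\<dots> \<le> (card ?H + card ?H) + (card ?H + card ?H)"
    by (intro order_trans[OF card_Un_le] add_mono order_refl card_image_le) auto
  finally show ?thesis by simp
qed

text \<open>As the energies agree, a horizontal wall of \<open>\<sigma>\<close> that
  \<open>\<tau>\<close> lacks is paid for by a vertical wall that \<open>\<tau>\<close> has in
  excess. So \<open>\<sigma>\<close> has at most \<open>8 + 16 = 24\<close> times
  \<open>2 * M + 1\<close> horizontal walls, and each accounts for at most four flippable
  sites.\<close>

lemma few_flippable_aux:
  assumes f: "filled M \<sigma> \<tau>" and nb: "\<not> bad M \<sigma>" and M: "2 \<le> M"
    and no_line: "\<And>b. \<bar>b\<bar> < int M \<Longrightarrow> \<bar>b + 1\<bar> < int M \<Longrightarrow> \<exists>x. \<bar>x\<bar> < int M \<and> \<tau> (x, b) = \<tau> (x, b + 1)"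
  shows "card {x \<in> core (M - 1). 2 \<le> disagreements \<sigma> x} \<le> 96 * (2 * M + 1)"
proof -
  from hwalls_closed[OF filledD(5,3)[OF f] no_line] vwalls_filled[OF f nb M] filledD(4)[OF f]
  have "card (hwalls M \<sigma>) \<le> 24 * (2 * M + 1)" by (simp add: energy_def)
  with flippable_hwalls[OF nb] show ?thesis by linarith
qed

text \<open>If \<open>\<tau>\<close> has a full horizontal wall line, it has no full vertical one,
  because the crossing would be a checkerboard. Exchanging the coordinates then reduces to the
  previous situation.\<close>

lemma few_flippable:
  assumes nb: "\<not> bad M \<sigma>" and M: "2 \<le> M"
  shows "card {x \<in> core (M - 1). 2 \<le> disagreements \<sigma> x} \<le> 96 * (2 * M + 1)"
proof -
  from filled_exists[OF nb] obtain \<tau> where f: "filled M \<sigma> \<tau>" ..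
  show ?thesis
  proof (cases "\<forall>b. \<bar>b\<bar> < int M \<longrightarrow> \<bar>b + 1\<bar> < int M \<longrightarrow> (\<exists>x. \<bar>x\<bar> < int M \<and> \<tau> (x, b) = \<tau> (x, b + 1))")
    case True
    then show ?thesis by (intro few_flippable_aux[OF f nb M]) auto
  next
    case False
    then obtain b where b: "\<bar>b\<bar> < int M" "\<bar>b + 1\<bar> < int M"
      "\<And>x. \<bar>x\<bar> < int M \<Longrightarrow> \<tau> (x, b) \<noteq> \<tau> (x, b + 1)" by blast
    have no: "\<exists>y. \<bar>y\<bar> < int M \<and> (\<tau> \<circ> prod.swap) (y, a) = (\<tau> \<circ> prod.swap) (y, a + 1)"
      if a: "\<bar>a\<bar> < int M" "\<bar>a + 1\<bar> < int M" for a
    proof (rule ccontr)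
      assume "\<not> ?thesis"
      then have "\<tau> (a, y) \<noteq> \<tau> (a + 1, y)" if "\<bar>y\<bar> < int M" for y using that by auto
      from no_checkerboard[of M \<tau> a b, OF _ a(1) b(1) a(2) b(2) this[OF b(1)] this[OF b(2)]] b(3)[OF a(1)] filledD(5)[OF f]
      show False by blast
    qed
    have *: "card {x \<in> core (M - 1). 2 \<le> disagreements (\<sigma> \<circ> prod.swap) x} \<le> 96 * (2 * M + 1)"
      by (intro few_flippable_aux[OF filled_swap[OF f] _ M no]) (simp_all only: bad_swap_iff nb not_False_eq_True)
    have "{x \<in> core (M - 1). 2 \<le> disagreements (\<sigma> \<circ> prod.swap) x} =
      prod.swap ` {x \<in> core (M - 1). 2 \<le> disagreements \<sigma> x}"
      unfolding disagreements_sym[OF lattice_sym_swap]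
      by (force simp: image_iff simp del: disagreements_sym)
    with * show ?thesis by (simp add: card_image)
  qed
qed

section \<open>Poisson clocks\<close>

definition gap :: "(real \<times> bool) measure" where
  "gap = density lborel (exponential_density 1) \<Otimes>\<^sub>M measure_pmf (bernoulli_pmf (1/2))"

definition clk :: "(nat \<Rightarrow> real \<times> bool) measure" where
  "clk = (\<Pi>\<^sub>M n\<in>UNIV. gap)"

lemma P_dyn_clk: "P_dyn = (\<Pi>\<^sub>M x\<in>UNIV. clk)"
  by (simp add: P_dyn_def clk_def gap_def)

lemma prob_space_gap: "prob_space gap"
  unfolding gap_def
  by (intro prob_space_pair prob_space_exponential_density measure_pmf.prob_space_axioms) simp

interpretation gap: prob_space gap by (rule prob_space_gap)
interpretation clk: sequence_space gap by unfold_locales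

lemma prob_space_clk: "prob_space clk"
  unfolding clk_def by (rule clk.prob_space_axioms)

interpretation clkp: prob_space clk by (rule prob_space_clk)

lemma sets_gap [measurable_cong]: "sets gap = sets (borel \<Otimes>\<^sub>M count_space UNIV)"
  unfolding gap_def by (intro sets_pair_measure_cong) auto

lemma sets_clk [measurable_cong]: "sets clk = sets (\<Pi>\<^sub>M n\<in>UNIV. gap)"
  unfolding clk_def ..

lemma space_gap [simp]: "space gap = UNIV"
  by (simp add: gap_def space_pair_measure)

lemma space_clk [simp]: "space clk = UNIV"
  by (simp add: clk_def space_PiM)

lemma clk_UNIV [simp]: "emeasure clk UNIV = 1"
  using clkp.emeasure_space_1 by simp

lemma sets_Collect_UNIV:
  assumes "space M = UNIV" "Measurable.pred M P"
  shows "{x. P x} \<in> sets M"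
  using predE[OF assms(2)] assms(1) by simp

text \<open>Lack of memory of the exponential law, with the coin carried along. The set
  \<open>A\<close> is arbitrary, since the constraints on a gap and on its coin need not
  factorise.\<close>

lemma gap_memoryless:
  assumes t: "0 \<le> t" and A [measurable]: "A \<in> sets gap"
  shows "emeasure gap {z \<in> A. t < fst z} = ennreal (exp (- t)) * emeasure gap {y. (t + fst y, snd y) \<in> A}"
proof -
  let ?e = "density lborel (\<lambda>x. ennreal (exponential_density 1 x))"
  let ?b = "measure_pmf (bernoulli_pmf (1/2))"
  interpret e: prob_space ?e by (rule prob_space_exponential_density) simp
  interpret pair_prob_space ?e ?b by unfold_locales
  have A': "A \<in> sets (?e \<Otimes>\<^sub>M ?b)" using A by (simp add: gap_def)
  have sec [measurable]: "{s. (s, c) \<in> A} \<in> sets borel" for c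
    using sets_Pair2[OF A', of c] by (simp add: vimage_def)
  have 1: "{z \<in> A. t < fst z} \<in> sets (?e \<Otimes>\<^sub>M ?b)"
    unfolding gap_def[symmetric] by (subst sets_gap) (use A in \<open>simp add: sets_gap; measurable\<close>)
  have 2: "{y. (t + fst y, snd y) \<in> A} \<in> sets (?e \<Otimes>\<^sub>M ?b)"
  proof -
    have "(\<lambda>y. (t + fst y, snd y)) \<in> gap \<rightarrow>\<^sub>M gap" by measurable
    from measurable_sets[OF this A] show ?thesis unfolding gap_def[symmetric] by (simp add: vimage_def)
  qed
  have translate: "emeasure ?e {s. (s, c) \<in> A \<and> t < s} = ennreal (exp (- t)) * emeasure ?e {s. (t + s, c) \<in> A}" for c
  proof -
    have [measurable]: "{s. (t + s, c) \<in> A} \<in> sets borel"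
      using measurable_sets[of "\<lambda>s. t + s" borel borel, OF _ sec[of c]] by (simp add: vimage_def)
    have [measurable]: "{s. (s, c) \<in> A \<and> t < s} \<in> sets borel"
    proof -
      have "{s. (s, c) \<in> A \<and> t < s} = {s. (s, c) \<in> A} \<inter> {t<..}" by auto
      then show ?thesis by simp
    qed
    have "emeasure ?e {s. (s, c) \<in> A \<and> t < s} =
        (\<integral>\<^sup>+ s. ennreal (exponential_density 1 s) * indicator {s. (s, c) \<in> A \<and> t < s} s \<partial>lborel)"
      by (subst emeasure_density) auto
    also have "\<dots> = (\<integral>\<^sup>+ s. ennreal (exponential_density 1 (t + 1 * s)) * indicator {s. (s, c) \<in> A \<and> t < s} (t + 1 * s) \<partial>lborel)"
      by (subst nn_integral_real_affine[of _ 1 t]) auto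
    also have "\<dots> = (\<integral>\<^sup>+ s. ennreal (exp (- t)) * (ennreal (exponential_density 1 s) * indicator {s. (t + s, c) \<in> A} s) \<partial>lborel)"
    proof (rule nn_integral_cong_AE)
      show "AE s in lborel. ennreal (exponential_density 1 (t + 1 * s)) * indicator {s. (s, c) \<in> A \<and> t < s} (t + 1 * s) =
          ennreal (exp (- t)) * (ennreal (exponential_density 1 s) * indicator {s. (t + s, c) \<in> A} s)"
        \<comment> \<open>At \<open>s = 0\<close> the strict inequality \<open>t < t + s\<close>
          fails although the density is positive, so the integrands agree only off this
          point.\<close>
        using AE_lborel_singleton[of "0::real"]
      proof eventually_elim
        case (elim s)
        show ?case
        proof (cases "s < 0")
          case True
          then show ?thesis by (simp add: exponential_density_def indicator_def)
        next
          case False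
          with elim have "0 < s" by simp
          then show ?thesis using t
            by (simp add: exponential_density_def indicator_def ennreal_mult'[symmetric] exp_add[symmetric] mult.commute)
        qed
      qed
    qed
    also have "\<dots> = ennreal (exp (- t)) * emeasure ?e {s. (t + s, c) \<in> A}"
      by (subst nn_integral_cmult) (auto simp: emeasure_density)
    finally show ?thesis .
  qed
  have "emeasure gap {z \<in> A. t < fst z} = (\<integral>\<^sup>+ c. emeasure ?e {s. (s, c) \<in> A \<and> t < s} \<partial>?b)"
    unfolding gap_def by (subst emeasure_pair_measure_alt2[OF 1]) (simp add: vimage_def)
  also have "\<dots> = ennreal (exp (- t)) * (\<integral>\<^sup>+ c. emeasure ?e {s. (t + s, c) \<in> A} \<partial>?b)"
    unfolding translate by (rule nn_integral_cmult) simp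
  also have "(\<integral>\<^sup>+ c. emeasure ?e {s. (t + s, c) \<in> A} \<partial>?b) = emeasure gap {y. (t + fst y, snd y) \<in> A}"
    unfolding gap_def by (subst emeasure_pair_measure_alt2[OF 2]) (simp add: vimage_def)
  finally show ?thesis .
qed

lemma gap_gt: "0 \<le> t \<Longrightarrow> emeasure gap {z. t < fst z} = ennreal (exp (- t))"
  using gap_memoryless[of t UNIV] gap.emeasure_space_1 by (simp add: sets.top[of gap, simplified])

lemma AE_gap_pos: "AE z in gap. 0 < fst z"
proof -
  have [measurable]: "{z. 0 < fst z} \<in> sets gap"
    by (rule sets_Collect_UNIV) auto
  show ?thesis
    by (rule gap.AE_I_eq_1) (use gap_gt[of 0] in simp_all)
qed

lemma gap_eq: "emeasure gap {z. fst z = c} = 0"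
proof -
  let ?e = "density lborel (\<lambda>x. ennreal (exponential_density 1 x))"
  let ?b = "measure_pmf (bernoulli_pmf (1/2))"
  interpret e: prob_space ?e by (rule prob_space_exponential_density) simp
  interpret pair_prob_space ?e ?b by unfold_locales
  have "{z. fst z = c} = {c} \<times> (UNIV :: bool set)" by auto
  then have "emeasure gap {z. fst z = c} = emeasure ?e {c} * emeasure ?b UNIV"
    unfolding gap_def by (simp only:) (rule measure_pmf.emeasure_pair_measure_Times; simp)
  also have "emeasure ?e {c} = 0"
    by (subst emeasure_density) (auto simp: nn_integral_0_iff_AE intro: AE_mp[OF AE_lborel_singleton[of c]])
  finally show ?thesis by simp
qed

text \<open>The Laplace transform of the exponential law at \<open>1\<close>, which drives the
  bounds on ring times below.\<close>

lemma nn_integral_gap_exp: "(\<integral>\<^sup>+ z. ennreal (exp (- fst z)) \<partial>gap) = ennreal (1 / 2)"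
proof -
  let ?e = "density lborel (\<lambda>x. ennreal (exponential_density 1 x))"
  let ?b = "measure_pmf (bernoulli_pmf (1/2))"
  interpret e: prob_space ?e by (rule prob_space_exponential_density) simp
  interpret pair_prob_space ?e ?b by unfold_locales
  have "(\<integral>\<^sup>+ z. ennreal (exp (- fst z)) \<partial>gap) = (\<integral>\<^sup>+ s. ennreal (exp (- s)) \<partial>?e)"
    unfolding gap_def by (subst measure_pmf.nn_integral_fst[symmetric]) (auto simp: measure_pmf.emeasure_space_1)
  also have "\<dots> = (\<integral>\<^sup>+ s. ennreal (exponential_density 1 s) * ennreal (exp (- s)) \<partial>lborel)"
    by (subst nn_integral_density) auto
  also have "\<dots> = (\<integral>\<^sup>+ s. ennreal (1 / 2) * ennreal (exponential_density 2 s) \<partial>lborel)"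
    by (intro nn_integral_cong)
       (auto simp: exponential_density_def ennreal_mult'[symmetric] exp_add[symmetric] mult.commute
         simp del: ennreal_half)
  also have "\<dots> = ennreal (1 / 2) * (\<integral>\<^sup>+ s. ennreal (exponential_density 2 s) \<partial>lborel)"
    by (rule nn_integral_cmult) auto
  also have "(\<integral>\<^sup>+ s. ennreal (exponential_density 2 s) \<partial>lborel) = 1"
    using prob_space.emeasure_space_1[OF prob_space_exponential_density[of 2]]
    by (simp add: emeasure_density)
  finally show ?thesis by simp
qed

text \<open>Conditioning on the first gap: the remaining gaps form an independent clock with the
  same law. This is the recursion behind the inductions on the ring number.\<close>

lemma nn_integral_clk:
  assumes [measurable]: "f \<in> borel_measurable clk"
  shows "(\<integral>\<^sup>+ d. f d \<partial>clk) = (\<integral>\<^sup>+ z. \<integral>\<^sup>+ d. f (case_nat z d) \<partial>clk \<partial>gap)"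
proof -
  have m [measurable]: "(\<lambda>(z, d). case_nat z d) \<in> gap \<Otimes>\<^sub>M clk \<rightarrow>\<^sub>M clk"
    by measurable
  have "(\<integral>\<^sup>+ d. f d \<partial>clk) = (\<integral>\<^sup>+ d. f d \<partial>distr (gap \<Otimes>\<^sub>M clk) clk (\<lambda>(z, d). case_nat z d))"
    using clk.PiM_iter by (simp add: clk_def)
  also have "\<dots> = (\<integral>\<^sup>+ p. f (case p of (z, d) \<Rightarrow> case_nat z d) \<partial>(gap \<Otimes>\<^sub>M clk))"
    by (subst nn_integral_distr) auto
  also have "\<dots> = (\<integral>\<^sup>+ z. \<integral>\<^sup>+ d. f (case_nat z d) \<partial>clk \<partial>gap)"
    by (subst clkp.nn_integral_fst[symmetric]) auto
  finally show ?thesis .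
qed

section \<open>Ring times\<close>

definition ring :: "(nat \<Rightarrow> real \<times> bool) \<Rightarrow> nat \<Rightarrow> real" where
  "ring d n = (\<Sum>i\<le>n. fst (d i))"

lemma ring_time_ring: "ring_time d x n = ring (d x) n"
  by (simp add: ring_time_def ring_def)

lemma ring_0 [simp]: "ring d 0 = fst (d 0)" by (simp add: ring_def)

lemma ring_case_nat: "ring (case_nat z d) (Suc n) = fst z + ring d n"
  unfolding ring_def by (subst sum.atMost_Suc_shift) simp

lemma ring_Suc_shift: "ring d (Suc n) = fst (d 0) + ring (\<lambda>i. d (Suc i)) n"
  unfolding ring_def by (subst sum.atMost_Suc_shift) simp

lemma measurable_ring [measurable]: "(\<lambda>d. ring d n) \<in> borel_measurable clk"
  unfolding ring_def by measurable

lemma nn_integral_ring_exp: "(\<integral>\<^sup>+ d. ennreal (exp (- ring d n)) \<partial>clk) = ennreal ((1 / 2) ^ Suc n)"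
proof (induction n)
  case 0
  have "(\<integral>\<^sup>+ d. ennreal (exp (- ring d 0)) \<partial>clk) = (\<integral>\<^sup>+ z. ennreal (exp (- fst z)) \<partial>gap)"
    by (subst nn_integral_clk) (auto simp: clkp.emeasure_space_1)
  then show ?case by (simp add: nn_integral_gap_exp)
next
  case (Suc n)
  have "(\<integral>\<^sup>+ d. ennreal (exp (- ring d (Suc n))) \<partial>clk) =
      (\<integral>\<^sup>+ z. \<integral>\<^sup>+ d. ennreal (exp (- fst z)) * ennreal (exp (- ring d n)) \<partial>clk \<partial>gap)"
    by (subst nn_integral_clk) (auto simp: ring_case_nat ennreal_mult'[symmetric] exp_add[symmetric])
  also have "\<dots> = (\<integral>\<^sup>+ z. ennreal (exp (- fst z)) * ennreal ((1 / 2) ^ Suc n) \<partial>gap)"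
    by (subst nn_integral_cmult) (auto simp: Suc)
  also have "\<dots> = ennreal (1 / 2) * ennreal ((1 / 2) ^ Suc n)"
    by (subst nn_integral_multc) (auto simp: nn_integral_gap_exp)
  finally show ?case by (simp add: ennreal_mult'[symmetric] del: ennreal_half)
qed

text \<open>A Chernoff bound: the indicator of \<open>ring d n \<le> T\<close> is at most
  \<open>exp (T - ring d n)\<close>. It is summable in \<open>n\<close>, which is all that is used,
  so the exact Gamma law is avoided.\<close>

lemma emeasure_ring_le: "emeasure clk {d. ring d n \<le> T} \<le> ennreal (exp T * (1 / 2) ^ Suc n)"
proof -
  have "emeasure clk {d. ring d n \<le> T} = (\<integral>\<^sup>+ d. indicator {d. ring d n \<le> T} d \<partial>clk)"
    by (subst nn_integral_indicator) (auto intro!: sets_Collect_UNIV)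
  also have "\<dots> \<le> (\<integral>\<^sup>+ d. ennreal (exp T) * ennreal (exp (- ring d n)) \<partial>clk)"
    by (intro nn_integral_mono)
       (auto simp: indicator_def ennreal_mult'[symmetric] exp_add[symmetric] simp del: ennreal_1 simp flip: ennreal_1)
  also have "\<dots> = ennreal (exp T) * ennreal ((1 / 2) ^ Suc n)"
    by (subst nn_integral_cmult) (auto simp: nn_integral_ring_exp)
  finally show ?thesis by (simp only: ennreal_mult'[symmetric] exp_ge_zero)
qed

text \<open>\<open>graft t d d'\<close> follows the clock \<open>d\<close> up to time \<open>t\<close> and then \<open>d'\<close> started afresh. For independent
  \<open>d\<close> and \<open>d'\<close> this is again a Poisson clock, which is the form in which the Markov property enters.\<close>

primrec graft_at :: "nat \<Rightarrow> real \<Rightarrow> (nat \<Rightarrow> real \<times> bool) \<Rightarrow> (nat \<Rightarrow> real \<times> bool) \<Rightarrow> real \<times> bool" where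
  "graft_at 0 t d d' = (if t < fst (d 0) then (t + fst (d' 0), snd (d' 0)) else d 0)"
| "graft_at (Suc n) t d d' =
     (if t < fst (d 0) then d' (Suc n) else graft_at n (t - fst (d 0)) (\<lambda>i. d (Suc i)) d')"

definition graft :: "real \<Rightarrow> (nat \<Rightarrow> real \<times> bool) \<Rightarrow> (nat \<Rightarrow> real \<times> bool) \<Rightarrow> nat \<Rightarrow> real \<times> bool" where
  "graft t d d' n = graft_at n t d d'"

lemma graft_0: "graft t d d' 0 = (if t < fst (d 0) then (t + fst (d' 0), snd (d' 0)) else d 0)"
  and graft_Suc: "graft t d d' (Suc n) =
    (if t < fst (d 0) then d' (Suc n) else graft (t - fst (d 0)) (\<lambda>i. d (Suc i)) d' n)"
  by (simp_all add: graft_def)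

lemma measurable_clk_component:
  "h \<in> N \<rightarrow>\<^sub>M clk \<Longrightarrow> (\<lambda>x. h x n) \<in> N \<rightarrow>\<^sub>M gap"
  by (rule measurable_compose[of h N clk]) (auto simp: clk_def)

lemma measurable_clkI: "(\<And>n. (\<lambda>x. f x n) \<in> N \<rightarrow>\<^sub>M gap) \<Longrightarrow> (\<lambda>x n. f x n) \<in> N \<rightarrow>\<^sub>M clk"
  by (subst measurable_cong_sets[OF refl sets_clk]) (rule measurable_abs_UNIV)

lemma measurable_gap_Pair [measurable (raw)]:
  "f \<in> borel_measurable N \<Longrightarrow> Measurable.pred N g \<Longrightarrow> (\<lambda>x. (f x, g x)) \<in> N \<rightarrow>\<^sub>M gap"
  by (subst measurable_cong_sets[OF refl sets_gap]) measurable

lemma measurable_gap_fst [measurable (raw)]: "h \<in> N \<rightarrow>\<^sub>M gap \<Longrightarrow> (\<lambda>x. fst (h x)) \<in> borel_measurable N"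
  by (rule measurable_compose[of h N gap]) auto

lemma measurable_gap_snd [measurable (raw)]: "h \<in> N \<rightarrow>\<^sub>M gap \<Longrightarrow> Measurable.pred N (\<lambda>x. snd (h x))"
  by (rule measurable_compose[of h N gap]) auto

lemma measurable_graft_at:
  "f \<in> borel_measurable N \<Longrightarrow> g \<in> N \<rightarrow>\<^sub>M clk \<Longrightarrow> h \<in> N \<rightarrow>\<^sub>M clk \<Longrightarrow>
    (\<lambda>x. graft_at n (f x) (g x) (h x)) \<in> N \<rightarrow>\<^sub>M gap"
proof (induction n arbitrary: f g)
  case 0
  note [measurable] = 0 measurable_clk_component[OF 0(2), of 0] measurable_clk_component[OF 0(3), of 0]
  show ?case unfolding graft_at.simps by measurable
next
  case (Suc n)
  note [measurable] = Suc.prems measurable_clk_component[OF Suc.prems(2)] measurable_clk_component[OF Suc.prems(3)]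
  have [measurable]: "(\<lambda>x i. g x (Suc i)) \<in> N \<rightarrow>\<^sub>M clk"
    by (rule measurable_clkI) (rule measurable_clk_component[OF Suc.prems(2)])
  have [measurable]: "(\<lambda>x. graft_at n (f x - fst (g x 0)) (\<lambda>i. g x (Suc i)) (h x)) \<in> N \<rightarrow>\<^sub>M gap"
    by (rule Suc.IH) measurable
  show ?case by simp
qed

lemma measurable_graft [measurable (raw)]:
  "f \<in> borel_measurable N \<Longrightarrow> g \<in> N \<rightarrow>\<^sub>M clk \<Longrightarrow> h \<in> N \<rightarrow>\<^sub>M clk \<Longrightarrow>
    (\<lambda>x. graft (f x) (g x) (h x)) \<in> N \<rightarrow>\<^sub>M clk"
  unfolding clk_def[symmetric] graft_def[abs_def]
  by (subst measurable_cong_sets[OF refl sets_clk]) (intro measurable_abs_UNIV measurable_graft_at)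

interpretation clk2: pair_prob_space clk clk by unfold_locales

lemma space_clk2 [simp]: "space (clk \<Otimes>\<^sub>M clk) = UNIV"
  by (simp add: space_pair_measure)

lemma sets_clk_cylinder:
  assumes "\<And>i. i < n \<Longrightarrow> A i \<in> sets gap"
  shows "{d. \<forall>i<n. d i \<in> A i} \<in> sets clk"
proof (rule sets_Collect_UNIV)
  have "Measurable.pred clk (\<lambda>d. \<forall>i\<in>{..<n}. d i \<in> A i)"
  proof (rule pred_intros_finite)
    fix i assume "i \<in> {..<n}"
    then have [measurable]: "A i \<in> sets gap" using assms by auto
    have [measurable]: "(\<lambda>d. d i) \<in> clk \<rightarrow>\<^sub>M gap" by (rule measurable_clk_component) measurable
    show "Measurable.pred clk (\<lambda>d. d i \<in> A i)" by measurable
  qed simp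
  then show "Measurable.pred clk (\<lambda>d. \<forall>i<n. d i \<in> A i)" by (simp only: Ball_def lessThan_iff)
qed simp

lemma emeasure_clk_cylinder:
  assumes "\<And>i. i < n \<Longrightarrow> A i \<in> sets gap"
  shows "emeasure clk {d. \<forall>i<n. d i \<in> A i} = (\<Prod>i<n. emeasure gap (A i))"
  using clk.emeasure_PiM_Collect[of "{..<n}" A] assms by (simp add: clk_def[symmetric] Ball_def)

lemma nn_integral_clk2:
  assumes [measurable]: "f \<in> borel_measurable (clk \<Otimes>\<^sub>M clk)"
  shows "(\<integral>\<^sup>+ p. f p \<partial>(clk \<Otimes>\<^sub>M clk)) = (\<integral>\<^sup>+ z. \<integral>\<^sup>+ d. \<integral>\<^sup>+ d'. f (case_nat z d, d') \<partial>clk \<partial>clk \<partial>gap)"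
proof -
  have "(\<integral>\<^sup>+ p. f p \<partial>(clk \<Otimes>\<^sub>M clk)) = (\<integral>\<^sup>+ d. \<integral>\<^sup>+ d'. f (d, d') \<partial>clk \<partial>clk)"
    by (rule clkp.nn_integral_fst[symmetric]) measurable
  also have "\<dots> = (\<integral>\<^sup>+ z. \<integral>\<^sup>+ d. \<integral>\<^sup>+ d'. f (case_nat z d, d') \<partial>clk \<partial>clk \<partial>gap)"
    by (rule nn_integral_clk) measurable
  finally show ?thesis .
qed

text \<open>Condition on the first gap of \<open>d\<close>. If it exceeds \<open>t\<close>, the
  graft is \<open>d'\<close> with its first gap lengthened by \<open>t\<close>, and lack of memory
  yields the mass of \<open>A 0\<close> beyond \<open>t\<close>. If not, the gap is kept and the
  induction hypothesis applies to the remaining time. The two cases add up to the full mass of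
  \<open>A 0\<close>.\<close>

lemma emeasure_graft_cylinder:
  assumes "0 \<le> t" "\<And>i. i < n \<Longrightarrow> A i \<in> sets gap"
  shows "emeasure (clk \<Otimes>\<^sub>M clk) {p. \<forall>i<n. graft t (fst p) (snd p) i \<in> A i} = (\<Prod>i<n. emeasure gap (A i))"
  using assms
proof (induction n arbitrary: t A)
  case 0
  show ?case using clk2.emeasure_space_1 by simp
next
  case (Suc n)
  have A0 [measurable]: "A 0 \<in> sets gap" and AS: "\<And>i. i < n \<Longrightarrow> A (Suc i) \<in> sets gap" using Suc.prems by auto
  define K where "K = (\<Prod>i<n. emeasure gap (A (Suc i)))"
  define B where "B = {y. (t + fst y, snd y) \<in> A 0}"
  have B [measurable]: "B \<in> sets gap"
    unfolding B_def by (rule sets_Collect_UNIV) (simp, measurable)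
  let ?E = "\<lambda>n t A. {p. \<forall>i<n. graft t (fst p) (snd p) i \<in> A i}"
  have meas: "?E n t A \<in> sets (clk \<Otimes>\<^sub>M clk)" if *: "\<And>i. i < n \<Longrightarrow> A i \<in> sets gap" for n t A
  proof (rule sets_Collect_UNIV)
    have "Measurable.pred (clk \<Otimes>\<^sub>M clk) (\<lambda>p. \<forall>i\<in>{..<n}. graft t (fst p) (snd p) i \<in> A i)"
    proof (rule pred_intros_finite)
      fix i assume "i \<in> {..<n}"
      then have [measurable]: "A i \<in> sets gap" using * by auto
      have [measurable]: "(\<lambda>p. graft t (fst p) (snd p) i) \<in> clk \<Otimes>\<^sub>M clk \<rightarrow>\<^sub>M gap"
        by (rule measurable_clk_component) measurable
      show "Measurable.pred (clk \<Otimes>\<^sub>M clk) (\<lambda>p. graft t (fst p) (snd p) i \<in> A i)" by measurable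
    qed simp
    then show "Measurable.pred (clk \<Otimes>\<^sub>M clk) (\<lambda>p. \<forall>i<n. graft t (fst p) (snd p) i \<in> A i)" by (simp only: Ball_def lessThan_iff)
  qed simp
  have inner: "(\<integral>\<^sup>+ d. \<integral>\<^sup>+ d'. indicator (?E (Suc n) t A) (case_nat z d, d') \<partial>clk \<partial>clk) =
      indicator {z. t < fst z} z * (emeasure gap B * K) + indicator {z. z \<in> A 0 \<and> fst z \<le> t} z * K" for z
  proof (cases "t < fst z")
    case True
    have "indicator (?E (Suc n) t A) (case_nat z d, d') =
      (indicator {d'. \<forall>i<Suc n. d' i \<in> (case i of 0 \<Rightarrow> B | Suc i \<Rightarrow> A (Suc i))} d' :: ennreal)" for d d'
      using True by (auto simp: indicator_def graft_0 graft_Suc B_def All_less_Suc2)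
    then have "(\<integral>\<^sup>+ d. \<integral>\<^sup>+ d'. indicator (?E (Suc n) t A) (case_nat z d, d') \<partial>clk \<partial>clk) =
      (\<integral>\<^sup>+ d. emeasure clk {d'. \<forall>i<Suc n. d' i \<in> (case i of 0 \<Rightarrow> B | Suc i \<Rightarrow> A (Suc i))} \<partial>clk)"
      using sets_clk_cylinder[of "Suc n" "\<lambda>i. case i of 0 \<Rightarrow> B | Suc i \<Rightarrow> A (Suc i)"] AS B by (simp split: nat.split)
    also have "\<dots> = (\<Prod>i<Suc n. emeasure gap (case i of 0 \<Rightarrow> B | Suc i \<Rightarrow> A (Suc i)))"
      using AS B by (subst emeasure_clk_cylinder) (auto split: nat.split)
    also have "\<dots> = emeasure gap B * K"
      unfolding K_def by (subst prod.lessThan_Suc_shift) simp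
    finally show ?thesis using True by simp
  next
    case False
    have "indicator (?E (Suc n) t A) (case_nat z d, d') =
      indicator (A 0) z * (indicator (?E n (t - fst z) (\<lambda>i. A (Suc i))) (d, d') :: ennreal)" for d d'
      using False by (auto simp: indicator_def graft_0 graft_Suc All_less_Suc2)
    then have "(\<integral>\<^sup>+ d. \<integral>\<^sup>+ d'. indicator (?E (Suc n) t A) (case_nat z d, d') \<partial>clk \<partial>clk) =
      (\<integral>\<^sup>+ d. \<integral>\<^sup>+ d'. indicator (A 0) z * (indicator (?E n (t - fst z) (\<lambda>i. A (Suc i))) (d, d') :: ennreal) \<partial>clk \<partial>clk)"
      by simp
    also have "\<dots> = (\<integral>\<^sup>+ p. indicator (A 0) z * indicator (?E n (t - fst z) (\<lambda>i. A (Suc i))) p \<partial>(clk \<Otimes>\<^sub>M clk))"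
      using meas[of n "\<lambda>i. A (Suc i)" "t - fst z"] AS by (subst clkp.nn_integral_fst[symmetric]) auto
    also have "\<dots> = indicator (A 0) z * emeasure (clk \<Otimes>\<^sub>M clk) (?E n (t - fst z) (\<lambda>i. A (Suc i)))"
      using meas[of n "\<lambda>i. A (Suc i)" "t - fst z"] AS by (subst nn_integral_cmult) auto
    also have "\<dots> = indicator (A 0) z * K"
      unfolding K_def using False AS by (subst Suc.IH) auto
    finally show ?thesis using False by (auto simp: indicator_def)
  qed
  have E: "?E (Suc n) t A \<in> sets (clk \<Otimes>\<^sub>M clk)" by (rule meas) (use Suc.prems in auto)
  have s [measurable]: "{z. t < fst z} \<in> sets gap" "{z. z \<in> A 0 \<and> fst z \<le> t} \<in> sets gap"
    by (rule sets_Collect_UNIV; simp)+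
  have "emeasure (clk \<Otimes>\<^sub>M clk) (?E (Suc n) t A) = (\<integral>\<^sup>+ p. indicator (?E (Suc n) t A) p \<partial>(clk \<Otimes>\<^sub>M clk))"
    using E by simp
  also have "\<dots> = (\<integral>\<^sup>+ z. indicator {z. t < fst z} z * (emeasure gap B * K) + indicator {z. z \<in> A 0 \<and> fst z \<le> t} z * K \<partial>gap)"
    using E by (subst nn_integral_clk2) (auto simp: inner)
  also have "\<dots> = emeasure gap {z. t < fst z} * (emeasure gap B * K) + emeasure gap {z. z \<in> A 0 \<and> fst z \<le> t} * K"
    by (subst nn_integral_add) (auto simp: nn_integral_multc)
  also have "\<dots> = (emeasure gap {z \<in> A 0. t < fst z} + emeasure gap {z. z \<in> A 0 \<and> fst z \<le> t}) * K"
    using Suc.prems(1) by (simp add: gap_memoryless gap_gt B_def distrib_right mult.assoc)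
  also have "emeasure gap {z \<in> A 0. t < fst z} + emeasure gap {z. z \<in> A 0 \<and> fst z \<le> t} = emeasure gap (A 0)"
    by (subst plus_emeasure) (auto intro!: arg_cong[where f = "emeasure gap"] sets_Collect_UNIV)
  also have "emeasure gap (A 0) * K = (\<Prod>i<Suc n. emeasure gap (A i))"
    unfolding K_def by (subst prod.lessThan_Suc_shift) simp
  finally show ?case .
qed

lemma distr_graft:
  assumes "0 \<le> t"
  shows "distr (clk \<Otimes>\<^sub>M clk) clk (\<lambda>p. graft t (fst p) (snd p)) = clk"
proof -
  have m: "(\<lambda>p. graft t (fst p) (snd p)) \<in> clk \<Otimes>\<^sub>M clk \<rightarrow>\<^sub>M clk" by measurable
  have "distr (clk \<Otimes>\<^sub>M clk) clk (\<lambda>p. graft t (fst p) (snd p)) = (\<Pi>\<^sub>M n\<in>UNIV. gap)"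
  proof (rule clk.PiM_eq)
    fix J :: "nat set" and F assume J: "finite J" "J \<subseteq> UNIV" "\<And>j. j \<in> J \<Longrightarrow> F j \<in> sets gap"
    obtain n where n: "J \<subseteq> {..<n}" using J(1) finite_nat_iff_bounded by blast
    define A where "A i = (if i \<in> J then F i else UNIV)" for i
    have A: "A i \<in> sets gap" for i using J(3) sets.top[of gap] by (auto simp: A_def)
    let ?X = "prod_emb UNIV (\<lambda>_. gap) J (Pi\<^sub>E J F)"
    have X: "?X \<in> sets clk" unfolding clk_def using J by (intro sets_PiM_I) auto
    have "(\<lambda>p. graft t (fst p) (snd p)) -` ?X \<inter> space (clk \<Otimes>\<^sub>M clk) = {p. \<forall>i<n. graft t (fst p) (snd p) i \<in> A i}"
      using n by (auto simp: prod_emb_def A_def PiE_iff subset_iff)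
    then have "emeasure (distr (clk \<Otimes>\<^sub>M clk) clk (\<lambda>p. graft t (fst p) (snd p))) ?X = (\<Prod>i<n. emeasure gap (A i))"
      using emeasure_graft_cylinder[OF assms, of n A] A by (simp add: emeasure_distr[OF m X])
    also have "\<dots> = (\<Prod>i\<in>J. emeasure gap (F i))"
      using n gap.emeasure_space_1 by (intro prod.mono_neutral_cong_right) (auto simp: A_def)
    finally show "emeasure (distr (clk \<Otimes>\<^sub>M clk) clk (\<lambda>p. graft t (fst p) (snd p))) ?X = (\<Prod>i\<in>J. emeasure gap (F i))" .
  qed (simp add: clk_def)
  then show "distr (clk \<Otimes>\<^sub>M clk) clk (\<lambda>p. graft t (fst p) (snd p)) = clk" by (simp add: clk_def)
qed

text \<open>The clock as a marked point set. Grafting changes the index of a ring by the random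
  number of rings before \<open>t\<close>, and forgetting the indices makes its effect a plain
  union.\<close>

definition marks :: "(nat \<Rightarrow> real \<times> bool) \<Rightarrow> (real \<times> bool) set" where
  "marks d = range (\<lambda>n. (ring d n, snd (d n)))"

definition proper :: "(nat \<Rightarrow> real \<times> bool) \<Rightarrow> bool" where
  "proper d \<longleftrightarrow> (\<forall>n. 0 < fst (d n)) \<and> (\<forall>T. \<exists>n. T < ring d n)"

lemma strict_mono_ring: "proper d \<Longrightarrow> strict_mono (ring d)"
  by (rule strict_monoI_Suc) (simp add: proper_def ring_def)

lemma ring_ge_first: "proper d \<Longrightarrow> fst (d 0) \<le> ring d n"
  using strict_mono_less_eq[OF strict_mono_ring, of d 0 n] by simp

lemma ring_pos: "proper d \<Longrightarrow> 0 < ring d n"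
  using ring_ge_first[of d n] by (auto simp: proper_def intro: less_le_trans)

lemma finite_rings_le: "proper d \<Longrightarrow> finite {n. ring d n \<le> T}"
proof -
  assume d: "proper d"
  then obtain m where m: "T < ring d m" by (auto simp: proper_def)
  have "{n. ring d n \<le> T} \<subseteq> {..<m}"
  proof
    fix n assume "n \<in> {n. ring d n \<le> T}"
    with m have "ring d n < ring d m" by simp
    then show "n \<in> {..<m}" by (simp add: strict_mono_less[OF strict_mono_ring[OF d]])
  qed
  then show ?thesis by (rule finite_subset) simp
qed

lemma marks_shift:
  "marks d = insert (d 0) ((\<lambda>p. (fst (d 0) + fst p, snd p)) ` marks (\<lambda>i. d (Suc i)))"
proof -
  have "marks d = (\<lambda>n. (ring d n, snd (d n))) ` insert 0 (range Suc)"
    unfolding marks_def by (simp add: UNIV_nat_eq[symmetric])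
  then show ?thesis
    by (simp add: marks_def image_image ring_Suc_shift)
qed

lemma marks_graft_early:
  assumes pos: "\<And>n. 0 < fst (d n)" and t: "t < fst (d 0)"
  shows "marks (graft t d d') = {p \<in> marks d. fst p \<le> t} \<union> (\<lambda>p. (t + fst p, snd p)) ` marks d'"
proof -
  have le: "fst (d 0) \<le> ring d n" for n
    unfolding ring_def by (rule member_le_sum) (use pos less_imp_le in auto)
  have none: "{p \<in> marks d. fst p \<le> t} = {}"
    using less_le_trans[OF t le] by (auto simp: marks_def not_le)
  have s: "graft t d d' 0 = (t + fst (d' 0), snd (d' 0))" "(\<lambda>i. graft t d d' (Suc i)) = (\<lambda>i. d' (Suc i))"
    using t by (auto simp: graft_0 graft_Suc)
  show ?thesis
    unfolding none marks_shift[of d'] marks_shift[of "graft t d d'"] s by (simp add: image_image add.assoc)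
qed

text \<open>Induction on the index \<open>k\<close> of some ring after \<open>t\<close>: each step
  removes the first gap of \<open>d\<close> and shortens \<open>t\<close> by it, until the first
  ring comes after the remaining time.\<close>

lemma marks_graft:
  assumes "\<And>n. 0 < fst (d n)" "t < ring d k"
  shows "marks (graft t d d') = {p \<in> marks d. fst p \<le> t} \<union> (\<lambda>p. (t + fst p, snd p)) ` marks d'"
  using assms
proof (induction k arbitrary: d t)
  case 0
  with marks_graft_early[of d t] show ?case by simp
next
  case (Suc k)
  show ?case
  proof (cases "t < fst (d 0)")
    case True
    with marks_graft_early[of d t] Suc.prems show ?thesis by simp
  next
    case False
    let ?d = "\<lambda>i. d (Suc i)" and ?t = "t - fst (d 0)"
    have IH: "marks (graft ?t ?d d') = {p \<in> marks ?d. fst p \<le> ?t} \<union> (\<lambda>p. (?t + fst p, snd p)) ` marks d'"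
      by (rule Suc.IH) (use Suc.prems in \<open>auto simp: ring_Suc_shift\<close>)
    have s: "graft t d d' 0 = d 0" "(\<lambda>i. graft t d d' (Suc i)) = graft ?t ?d d'"
      using False by (auto simp: graft_0 graft_Suc)
    let ?sh = "\<lambda>p. (fst (d 0) + fst p, snd p) :: real \<times> bool"
    have "{p \<in> insert (d 0) (?sh ` marks ?d). fst p \<le> t} = insert (d 0) (?sh ` {p \<in> marks ?d. fst p \<le> ?t})"
    proof -
      have "{p \<in> insert (d 0) (?sh ` marks ?d). fst p \<le> t} = insert (d 0) {p \<in> ?sh ` marks ?d. fst p \<le> t}"
        using False by auto
      also have "{p \<in> ?sh ` marks ?d. fst p \<le> t} = ?sh ` {p \<in> marks ?d. fst p \<le> ?t}" by auto
      finally show ?thesis .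
    qed
    moreover have "?sh ` (\<lambda>p. (?t + fst p, snd p)) ` marks d' = (\<lambda>p. (t + fst p, snd p)) ` marks d'"
      by (simp add: image_image)
    ultimately show ?thesis
      unfolding marks_shift[of d] marks_shift[of "graft t d d'"] s IH by (simp only: image_Un Un_insert_left)
  qed
qed

lemma marks_ring: "(r, c) \<in> marks d \<longleftrightarrow> (\<exists>n. r = ring d n \<and> c = snd (d n))"
  by (auto simp: marks_def)

text \<open>Rings are unbounded because, by \<open>emeasure_ring_le\<close>, the probability that
  the \<open>n\<close>-th ring is still before a fixed time tends to \<open>0\<close>.\<close>

lemma AE_proper: "AE d in clk. proper d"
proof -
  have "AE d in clk. 0 < fst (d n)" for n
    unfolding clk_def by (rule AE_PiM_component[of UNIV "\<lambda>_. gap" n "\<lambda>z. 0 < fst z"]) (auto intro: prob_space_gap AE_gap_pos)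
  then have pos: "AE d in clk. \<forall>n. 0 < fst (d n)" by (simp add: AE_all_countable)
  have "AE d in clk. \<exists>n. real k < ring d n" for k
  proof (rule AE_I)
    let ?N = "{d. \<forall>n. ring d n \<le> real k}"
    show "?N \<in> sets clk" by (rule sets_Collect_UNIV) auto
    have "emeasure clk ?N \<le> ennreal (exp (real k) * (1 / 2) ^ Suc n)" for n
      by (rule order_trans[OF emeasure_mono emeasure_ring_le]) (auto intro!: sets_Collect_UNIV)
    moreover have "(\<lambda>n. ennreal (exp (real k) * (1 / 2) ^ Suc n)) \<longlonglongrightarrow> ennreal (exp (real k) * 0)"
      by (intro tendsto_ennrealI tendsto_mult tendsto_const LIMSEQ_Suc LIMSEQ_power_zero) auto
    ultimately have "emeasure clk ?N \<le> 0"
      by (intro LIMSEQ_le_const) (auto simp: ennreal_0)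
    then show "emeasure clk ?N = 0" by simp
  qed (auto simp: not_less)
  then have "AE d in clk. \<forall>k::nat. \<exists>n. real k < ring d n" by (simp add: AE_all_countable)
  with pos show ?thesis
  proof eventually_elim
    case (elim d)
    have "\<exists>n. T < ring d n" for T
    proof -
      obtain k :: nat where "T \<le> real k" using real_arch_simple by blast
      then show ?thesis using elim(2) by (meson le_less_trans)
    qed
    with elim show ?case by (simp add: proper_def)
  qed
qed

lemma AE_pair_fst:
  assumes "prob_space N" "AE x in M. P x"
  shows "AE p in M \<Otimes>\<^sub>M N. P (fst p)"
proof -
  interpret N: prob_space N by fact
  obtain A where A: "A \<in> null_sets M" "{x \<in> space M. \<not> P x} \<subseteq> A"
    using assms(2) by (auto simp: eventually_ae_filter)
  have "A \<times> space N \<in> null_sets (M \<Otimes>\<^sub>M N)"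
    using A(1) by (auto simp: null_sets_def N.emeasure_pair_measure_Times)
  then show ?thesis
    by (rule AE_I') (use A(2) in \<open>auto simp: space_pair_measure\<close>)
qed

lemma AE_pair_snd:
  assumes "prob_space N" "AE x in N. P x"
  shows "AE p in M \<Otimes>\<^sub>M N. P (snd p)"
proof -
  interpret N: prob_space N by fact
  obtain A where A: "A \<in> null_sets N" "{x \<in> space N. \<not> P x} \<subseteq> A"
    using assms(2) by (auto simp: eventually_ae_filter)
  have "space M \<times> A \<in> null_sets (M \<Otimes>\<^sub>M N)"
    using A(1) by (auto simp: null_sets_def N.emeasure_pair_measure_Times)
  then show ?thesis
    by (rule AE_I') (use A(2) in \<open>auto simp: space_pair_measure\<close>)
qed

lemma AE_proper2: "AE p in clk \<Otimes>\<^sub>M clk. proper (fst p) \<and> proper (snd p)"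
  by (rule AE_conjI[OF AE_pair_fst[OF prob_space_clk AE_proper] AE_pair_snd[OF prob_space_clk AE_proper]])

section \<open>Rings in a time window\<close>

definition window_count :: "real \<Rightarrow> real \<Rightarrow> (nat \<Rightarrow> real \<times> bool) \<Rightarrow> nat" where
  "window_count t u d = card {n. t < ring d n \<and> ring d n \<le> u}"

lemma finite_window: "proper d \<Longrightarrow> finite {n. t < ring d n \<and> ring d n \<le> u}"
  by (rule finite_subset[OF _ finite_rings_le[of d u]]) auto

text \<open>The series is measurable by construction and is the form to integrate. The cardinality
  suits the pathwise counting, where the clock is proper and the count is finite.\<close>

lemma window_count_suminf:
  assumes "proper d"
  shows "ennreal (window_count t u d) = (\<Sum>n. indicator {t<..u} (ring d n))"
proof -
  have "(\<Sum>n. indicator {t<..u} (ring d n) :: ennreal) =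
      (\<Sum>n\<in>{n. t < ring d n \<and> ring d n \<le> u}. indicator {t<..u} (ring d n))"
    by (rule suminf_finite) (use finite_window[OF assms] in \<open>auto simp: indicator_def\<close>)
  also have "\<dots> = ennreal (window_count t u d)"
    by (simp add: window_count_def indicator_def of_nat_sum[symmetric] ennreal_of_nat_eq_real_of_nat)
  finally show ?thesis ..
qed

lemma window_count_marks:
  assumes "proper d"
  shows "window_count t u d = card {r \<in> fst ` marks d. t < r \<and> r \<le> u}"
proof -
  have "{r \<in> fst ` marks d. t < r \<and> r \<le> u} = ring d ` {n. t < ring d n \<and> ring d n \<le> u}"
    by (auto simp: marks_def image_image)
  then show ?thesis unfolding window_count_def
    using strict_mono_imp_inj_on[OF strict_mono_ring[OF assms]] by (simp add: card_image inj_on_subset)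
qed

lemma window_graft:
  assumes "proper d" "proper d'"
  shows "{p \<in> marks (graft t d d'). t < fst p \<and> fst p \<le> t + h} =
    (\<lambda>p. (t + fst p, snd p)) ` {p \<in> marks d'. 0 < fst p \<and> fst p \<le> h}"
proof -
  have "\<exists>k. t < ring d k" using assms(1) by (simp add: proper_def)
  then obtain k where k: "t < ring d k" ..
  have "0 < fst p" if "p \<in> marks d'" for p using that ring_pos[OF assms(2)] by (auto simp: marks_def)
  then show ?thesis
    using assms(1) unfolding marks_graft[of d t k d', OF _ k, OF assms(1)[unfolded proper_def, THEN conjunct1, THEN spec]]
    by auto
qed

lemma fst_filter: "{r \<in> fst ` A. P r} = fst ` {p \<in> A. P (fst p)}" by auto

lemma window_count_graft:
  assumes "proper d" "proper d'" "proper (graft t d d')"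
  shows "window_count t (t + h) (graft t d d') = window_count 0 h d'"
proof -
  have "{r \<in> fst ` marks (graft t d d'). t < r \<and> r \<le> t + h} = (+) t ` {r \<in> fst ` marks d'. 0 < r \<and> r \<le> h}"
    unfolding fst_filter window_graft[OF assms(1,2)] by (simp add: image_image)
  then show ?thesis
    unfolding window_count_marks[OF assms(3)] window_count_marks[OF assms(2)] by (simp add: card_image)
qed

lemma AE_graft:
  assumes "0 \<le> t" "AE d in clk. P d"
  shows "AE p in clk \<Otimes>\<^sub>M clk. P (graft t (fst p) (snd p))"
proof (rule AE_distrD[where M' = clk and f = "\<lambda>p. graft t (fst p) (snd p)"])
  show "(\<lambda>p. graft t (fst p) (snd p)) \<in> clk \<Otimes>\<^sub>M clk \<rightarrow>\<^sub>M clk" by measurable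
  show "AE d in distr (clk \<Otimes>\<^sub>M clk) clk (\<lambda>p. graft t (fst p) (snd p)). P d"
    unfolding distr_graft[OF assms(1)] by fact
qed

text \<open>Stationarity of the clock: a quantity that sees only the part of a graft after
  \<open>t\<close> has the same mean as its version started at time \<open>0\<close>.\<close>

lemma nn_integral_graft:
  assumes "0 \<le> t" "f \<in> borel_measurable clk" "f' \<in> borel_measurable clk"
    and eq: "\<And>d d'. proper d \<Longrightarrow> proper d' \<Longrightarrow> proper (graft t d d') \<Longrightarrow> f (graft t d d') = f' d'"
  shows "(\<integral>\<^sup>+ d. f d \<partial>clk) = (\<integral>\<^sup>+ d. f' d \<partial>clk)"
proof -
  note [measurable] = assms(2,3)
  have "(\<integral>\<^sup>+ d. f d \<partial>clk) = (\<integral>\<^sup>+ d. f d \<partial>distr (clk \<Otimes>\<^sub>M clk) clk (\<lambda>p. graft t (fst p) (snd p)))"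
    by (simp add: distr_graft[OF assms(1)])
  also have "\<dots> = (\<integral>\<^sup>+ p. f (graft t (fst p) (snd p)) \<partial>(clk \<Otimes>\<^sub>M clk))"
    by (rule nn_integral_distr) measurable
  also have "\<dots> = (\<integral>\<^sup>+ p. f' (snd p) \<partial>(clk \<Otimes>\<^sub>M clk))"
  proof (rule nn_integral_cong_AE)
    show "AE p in clk \<Otimes>\<^sub>M clk. f (graft t (fst p) (snd p)) = f' (snd p)"
      using AE_proper2 AE_graft[OF assms(1) AE_proper] by eventually_elim (simp add: eq)
  qed
  also have "\<dots> = (\<integral>\<^sup>+ d. \<integral>\<^sup>+ d'. f' d' \<partial>clk \<partial>clk)"
    by (subst clkp.nn_integral_fst[symmetric]) auto
  finally show ?thesis by simp
qed

text \<open>After a shift to time \<open>0\<close>, the Chernoff bounds are summed over all rings.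
  The exact mean is \<open>h\<close>; what matters later is a finite bound independent of
  \<open>t\<close>.\<close>

lemma nn_integral_window_count:
  assumes "0 \<le> t" "0 \<le> h"
  shows "(\<integral>\<^sup>+ d. (\<Sum>n. indicator {t<..t + h} (ring d n)) \<partial>clk) \<le> ennreal (exp h)"
proof -
  have "(\<integral>\<^sup>+ d. (\<Sum>n. indicator {t<..t + h} (ring d n)) \<partial>clk) = (\<integral>\<^sup>+ d. (\<Sum>n. indicator {0<..h} (ring d n)) \<partial>clk)"
    by (rule nn_integral_graft[OF assms(1)]) (auto simp: window_count_suminf[symmetric] window_count_graft)
  also have "\<dots> = (\<Sum>n. \<integral>\<^sup>+ d. indicator {0<..h} (ring d n) \<partial>clk)"
    by (rule nn_integral_suminf) auto
  also have "\<dots> \<le> (\<Sum>n. ennreal (exp h * (1 / 2) ^ Suc n))"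
  proof (rule suminf_le)
    fix n
    have "(\<integral>\<^sup>+ d. indicator {0<..h} (ring d n) \<partial>clk) \<le> (\<integral>\<^sup>+ d. indicator {d. ring d n \<le> h} d \<partial>clk)"
      by (intro nn_integral_mono) (auto simp: indicator_def)
    also have "\<dots> = emeasure clk {d. ring d n \<le> h}"
      by (intro nn_integral_indicator sets_Collect_UNIV) auto
    finally show "(\<integral>\<^sup>+ d. indicator {0<..h} (ring d n) \<partial>clk) \<le> ennreal (exp h * (1 / 2) ^ Suc n)"
      using emeasure_ring_le by (rule order_trans)
  qed auto
  also have "\<dots> = ennreal (exp h)"
  proof (rule suminf_ennreal_eq)
    show "(\<lambda>n. exp h * (1 / 2) ^ Suc n) sums exp h"
      using sums_mult[OF power_half_series, of "exp h"] by simp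
  qed auto
  finally show ?thesis .
qed

text \<open>A ring in the window forces the first gap of the restarted clock to be at most
  \<open>h\<close>, which has probability \<open>1 - exp (- h)\<close>. The bound is small for short
  windows, as the path count below requires.\<close>

lemma emeasure_window:
  assumes "0 \<le> t" "0 \<le> h"
  shows "emeasure clk {d. \<exists>n. t < ring d n \<and> ring d n \<le> t + h} \<le> ennreal h"
proof -
  let ?I = "\<lambda>t u. {d. \<exists>n. t < ring d n \<and> ring d n \<le> u}"
  have [measurable]: "?I t u \<in> sets clk" for t u by (rule sets_Collect_UNIV) auto
  have pos: "(\<exists>n. t < ring d n \<and> ring d n \<le> u) \<longleftrightarrow> 0 < window_count t u d" if "proper d" for d t u
    unfolding window_count_def using finite_window[OF that] by (auto simp: card_gt_0_iff)
  have "emeasure clk (?I t (t + h)) = (\<integral>\<^sup>+ d. indicator (?I t (t + h)) d \<partial>clk)" by simp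
  also have "\<dots> = (\<integral>\<^sup>+ d. indicator (?I 0 h) d \<partial>clk)"
    by (rule nn_integral_graft[OF assms(1)]) (auto simp: indicator_def pos window_count_graft)
  also have "\<dots> = emeasure clk (?I 0 h)" by simp
  also have "\<dots> \<le> emeasure clk {d. \<forall>i<1. d i \<in> {z. fst z \<le> h}}"
  proof (rule emeasure_mono_AE)
    show "AE d in clk. d \<in> ?I 0 h \<longrightarrow> d \<in> {d. \<forall>i<1. d i \<in> {z. fst z \<le> h}}"
      using AE_proper by eventually_elim (auto intro: order_trans[OF ring_ge_first])
    show "{d. \<forall>i<1. d i \<in> {z. fst z \<le> h}} \<in> sets clk"
      by (rule sets_clk_cylinder) (auto intro: sets_Collect_UNIV)
  qed
  also have "\<dots> = emeasure gap {z. fst z \<le> h}"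
    by (subst emeasure_clk_cylinder) (auto intro: sets_Collect_UNIV)
  also have "{z. fst z \<le> h} = UNIV - {z :: real \<times> bool. h < fst z}" by auto
  also have "emeasure gap (UNIV - {z. h < fst z}) = 1 - ennreal (exp (- h))"
  proof -
    have "{z. h < fst z} \<in> sets gap" by (rule sets_Collect_UNIV) auto
    then show ?thesis
      using emeasure_compl[of "{z. h < fst z}" gap] gap_gt[OF assms(2)] gap.emeasure_space_1 by simp
  qed
  also have "\<dots> \<le> ennreal h"
  proof -
    have "1 - exp (- h) \<le> h" using exp_ge_add_one_self[of "- h"] by simp
    then show ?thesis by (simp add: ennreal_minus ennreal_1[symmetric] ennreal_leI del: ennreal_1)
  qed
  finally show ?thesis .
qed

definition quiet :: "real \<Rightarrow> real \<Rightarrow> (nat \<Rightarrow> real \<times> bool) \<Rightarrow> bool" where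
  "quiet t u d \<longleftrightarrow> (\<forall>n. \<not> (t < ring d n \<and> ring d n \<le> u))"

text \<open>The coin is required to be \<open>True\<close>, so that the ring performs a flip also in
  the case of a tie.\<close>

definition one_ring :: "real \<Rightarrow> real \<Rightarrow> (nat \<Rightarrow> real \<times> bool) \<Rightarrow> bool" where
  "one_ring t u d \<longleftrightarrow> (\<exists>n. t < ring d n \<and> ring d n \<le> u \<and> snd (d n) \<and>
     (\<forall>m. m \<noteq> n \<longrightarrow> \<not> (t < ring d m \<and> ring d m \<le> u)))"

lemma measurable_coin [measurable]: "Measurable.pred clk (\<lambda>d. snd (d n))"
  by (rule measurable_gap_snd, rule measurable_clk_component) measurable

lemma sets_quiet [measurable]: "{d. quiet t u d} \<in> sets clk"
  unfolding quiet_def by (rule sets_Collect_UNIV) auto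

lemma sets_one_ring [measurable]: "{d. one_ring t u d} \<in> sets clk"
  unfolding one_ring_def by (rule sets_Collect_UNIV) auto

lemma quiet_marks: "quiet t u d \<longleftrightarrow> {p \<in> marks d. t < fst p \<and> fst p \<le> u} = {}"
  by (auto simp: quiet_def marks_def)

text \<open>Properness makes ring times distinct, so a single mark means a single index. In this
  form the event can be followed through a graft.\<close>

lemma one_ring_marks:
  assumes "proper d"
  shows "one_ring t u d \<longleftrightarrow> (\<exists>r. {p \<in> marks d. t < fst p \<and> fst p \<le> u} = {(r, True)})"
proof
  assume "one_ring t u d"
  then obtain n where n: "t < ring d n" "ring d n \<le> u" "snd (d n)"
    "\<And>m. t < ring d m \<Longrightarrow> ring d m \<le> u \<Longrightarrow> m = n" unfolding one_ring_def by blast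
  have "{p \<in> marks d. t < fst p \<and> fst p \<le> u} = {(ring d n, True)}"
  proof (intro set_eqI iffI)
    fix p assume "p \<in> {p \<in> marks d. t < fst p \<and> fst p \<le> u}"
    then obtain m where m: "p = (ring d m, snd (d m))" "t < ring d m" "ring d m \<le> u" by (auto simp: marks_def)
    from n(4)[OF m(2,3)] n(3) m(1) show "p \<in> {(ring d n, True)}" by simp
  next
    fix p assume "p \<in> {(ring d n, True)}"
    then have "p = (ring d n, snd (d n))" using n(3) by simp
    then show "p \<in> {p \<in> marks d. t < fst p \<and> fst p \<le> u}" using n(1,2) by (simp add: marks_def)
  qed
  then show "\<exists>r. {p \<in> marks d. t < fst p \<and> fst p \<le> u} = {(r, True)}" ..
next
  assume "\<exists>r. {p \<in> marks d. t < fst p \<and> fst p \<le> u} = {(r, True)}"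
  then obtain r where r: "{p \<in> marks d. t < fst p \<and> fst p \<le> u} = {(r, True)}" ..
  have "(r, True) \<in> {p \<in> marks d. t < fst p \<and> fst p \<le> u}" unfolding r by simp
  then have "(r, True) \<in> marks d" "t < r" "r \<le> u" by simp_all
  then obtain n where n: "r = ring d n" "snd (d n)" by (auto simp: marks_ring)
  have "m = n" if "t < ring d m" "ring d m \<le> u" for m
  proof -
    have "(ring d m, snd (d m)) \<in> {p \<in> marks d. t < fst p \<and> fst p \<le> u}" using that by (auto simp: marks_def)
    then have "ring d m = ring d n" unfolding r n(1)[symmetric] by simp
    then show ?thesis using strict_mono_eq[OF strict_mono_ring[OF assms]] by blast
  qed
  moreover have "t < ring d n" "ring d n \<le> u" using n(1) \<open>t < r\<close> \<open>r \<le> u\<close> by simp_all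
  ultimately show "one_ring t u d" using n(2) unfolding one_ring_def by blast
qed

lemma quiet_graft:
  "proper d \<Longrightarrow> proper d' \<Longrightarrow> quiet t (t + h) (graft t d d') \<longleftrightarrow> quiet 0 h d'"
  unfolding quiet_marks window_graft by simp

lemma one_ring_graft:
  assumes "proper d" "proper d'" "proper (graft t d d')"
  shows "one_ring t (t + h) (graft t d d') \<longleftrightarrow> one_ring 0 h d'"
proof -
  have "(\<exists>r. (\<lambda>p. (t + fst p, snd p)) ` A = {(r, True)}) \<longleftrightarrow> (\<exists>r. A = {(r, True)})" for A :: "(real \<times> bool) set"
  proof
    assume "\<exists>r. (\<lambda>p. (t + fst p, snd p)) ` A = {(r, True)}"
    then obtain r where r: "(\<lambda>p. (t + fst p, snd p)) ` A = {(r, True)}" ..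
    then have "A \<noteq> {}" by auto
    moreover have "p = (r - t, True)" if "p \<in> A" for p
    proof -
      have "(t + fst p, snd p) \<in> {(r, True)}" using that by (auto simp: r[symmetric])
      then show ?thesis by (cases p) auto
    qed
    ultimately have "A = {(r - t, True)}" by blast
    then show "\<exists>r. A = {(r, True)}" ..
  qed auto
  then show ?thesis
    unfolding one_ring_marks[OF assms(2)] one_ring_marks[OF assms(3)] window_graft[OF assms(1,2)] .
qed

lemma quiet_pos: "0 < emeasure clk {d. quiet 0 h d}" if "0 \<le> h"
proof -
  have "0 < emeasure gap {z. h < fst z}" using that by (simp add: gap_gt)
  also have "\<dots> = emeasure clk {d. \<forall>i<1. d i \<in> {z. h < fst z}}"
    by (subst emeasure_clk_cylinder) (auto intro: sets_Collect_UNIV)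
  also have "\<dots> \<le> emeasure clk {d. quiet 0 h d}"
  proof (rule emeasure_mono_AE)
    show "AE d in clk. d \<in> {d. \<forall>i<1. d i \<in> {z. h < fst z}} \<longrightarrow> d \<in> {d. quiet 0 h d}"
      using AE_proper by eventually_elim (auto simp: quiet_def not_le intro: less_le_trans[OF _ ring_ge_first])
  qed simp
  finally show ?thesis .
qed

lemma one_ring_pos: "0 < emeasure clk {d. one_ring 0 1 d}"
proof -
  let ?e = "density lborel (\<lambda>x. ennreal (exponential_density 1 x))"
  let ?b = "measure_pmf (bernoulli_pmf (1/2))"
  \<comment> \<open>A first gap at most \<open>1\<close> with a successful coin, then a gap longer
    than \<open>1\<close>, puts exactly one ring into the window.\<close>
  let ?A = "\<lambda>i::nat. if i = 0 then {z :: real \<times> bool. fst z \<le> 1 \<and> snd z} else {z. 1 < fst z}"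
  have A: "?A i \<in> sets gap" for i by (auto intro: sets_Collect_UNIV)
  have A0: "?A 0 = {..1} \<times> {True}" by auto
  have "emeasure gap (?A 0) = emeasure ?e {..1} * emeasure ?b {True}"
    unfolding gap_def A0 by (rule measure_pmf.emeasure_pair_measure_Times; simp)
  also have "\<dots> = ennreal (1 - exp (- 1)) * ennreal (1 / 2)"
    by (simp add: emeasure_erlang_density erlang_CDF_0 emeasure_pmf_single del: ennreal_half)
  also have "0 < \<dots>" by (simp add: ennreal_zero_less_mult_iff del: ennreal_half)
  finally have "0 < emeasure gap (?A 0) * emeasure gap (?A 1)"
    by (simp add: gap_gt ennreal_zero_less_mult_iff)
  also have "\<dots> = emeasure clk {d. \<forall>i<2. d i \<in> ?A i}"
    using A by (subst emeasure_clk_cylinder) (auto simp: numeral_2_eq_2)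
  also have "\<dots> \<le> emeasure clk {d. one_ring 0 1 d}"
  proof (rule emeasure_mono_AE)
    show "AE d in clk. d \<in> {d. \<forall>i<2. d i \<in> ?A i} \<longrightarrow> d \<in> {d. one_ring 0 1 d}"
      using AE_proper
    proof eventually_elim
      case (elim d)
      show ?case
      proof
        assume "d \<in> {d. \<forall>i<2. d i \<in> ?A i}"
        then have *: "\<forall>i<2. d i \<in> ?A i" by blast
        from *[rule_format, of 0] *[rule_format, of 1]
        have d: "fst (d 0) \<le> 1" "snd (d 0)" "1 < fst (d 1)" by simp_all
        have p: "0 < fst (d n)" for n using elim(1) by (auto simp: proper_def)
        have "1 < ring d m" if "m \<noteq> 0" for m
        proof -
          have "ring d 1 \<le> ring d m"
            using that strict_mono_less_eq[OF strict_mono_ring[OF elim(1)]] by simp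
          moreover have "ring d 1 = fst (d 0) + fst (d 1)" by (simp add: ring_def)
          ultimately show ?thesis using d p[of 0] by linarith
        qed
        then show "d \<in> {d. one_ring 0 1 d}"
          using d p[of 0] by (auto simp: one_ring_def intro!: exI[of _ 0] simp: not_le)
      qed
    qed
  qed simp
  finally show ?thesis .
qed

text \<open>A ring time has no atoms because its first gap has none: with the later gaps fixed, the
  first gap would have to take one prescribed value.\<close>

lemma emeasure_ring_eq: "emeasure clk {d. ring d n = c} = 0"
proof -
  have "emeasure clk {d. ring d n = c} = (\<integral>\<^sup>+ d. indicator {d. ring d n = c} d \<partial>clk)"
    by (intro nn_integral_indicator[symmetric] sets_Collect_UNIV) auto
  also have "\<dots> = 0"
  proof (cases n)
    case 0
    have "(\<integral>\<^sup>+ d. indicator {d. ring d n = c} d \<partial>clk) = (\<integral>\<^sup>+ z. indicator {z. fst z = c} z \<partial>gap)"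
    proof -
      have "indicator {d. ring d 0 = c} (case_nat z d) = (indicator {z. fst z = c} z :: ennreal)"
        for z :: "real \<times> bool" and d by (simp add: indicator_def)
      then show ?thesis
        unfolding 0 by (subst nn_integral_clk) (simp_all add: sets_Collect_UNIV)
    qed
    also have "\<dots> = emeasure gap {z. fst z = c}" by (intro nn_integral_indicator sets_Collect_UNIV) auto
    finally show ?thesis by (simp add: gap_eq)
  next
    case (Suc m)
    interpret gc: pair_prob_space gap clk by unfold_locales
    have "(\<integral>\<^sup>+ d. indicator {d. ring d n = c} d \<partial>clk) =
      (\<integral>\<^sup>+ z. \<integral>\<^sup>+ d. indicator {d. ring d n = c} (case_nat z d) \<partial>clk \<partial>gap)"
      by (intro nn_integral_clk borel_measurable_indicator sets_Collect_UNIV) auto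
    also have "\<dots> = (\<integral>\<^sup>+ z. \<integral>\<^sup>+ d. indicator {z. fst z = c - ring d m} z \<partial>clk \<partial>gap)"
      unfolding Suc by (intro nn_integral_cong) (auto simp: indicator_def ring_case_nat)
    also have "\<dots> = (\<integral>\<^sup>+ d. \<integral>\<^sup>+ z. indicator {z. fst z = c - ring d m} z \<partial>gap \<partial>clk)"
    proof (rule gc.Fubini'[symmetric])
      have "(\<lambda>(z, d). indicator {z. fst z = c - ring d m} z :: ennreal) =
          indicator {p. fst (fst p) = c - ring (snd p) m}" by (auto simp: indicator_def fun_eq_iff)
      moreover have "{p. fst (fst p) = c - ring (snd p) m} \<in> sets (gap \<Otimes>\<^sub>M clk)"
        by (rule sets_Collect_UNIV) (auto simp: space_pair_measure)
      ultimately show "(\<lambda>(z, d). indicator {z. fst z = c - ring d m} z :: ennreal) \<in> borel_measurable (gap \<Otimes>\<^sub>M clk)"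
        by simp
    qed
    also have "\<dots> = (\<integral>\<^sup>+ d. emeasure gap {z. fst z = c - ring d m} \<partial>clk)"
      by (intro nn_integral_cong nn_integral_indicator sets_Collect_UNIV) auto
    finally show ?thesis by (simp add: gap_eq)
  qed
  finally show ?thesis .
qed

section \<open>Clocks on the lattice\<close>

interpretation dyn: product_prob_space "\<lambda>_ :: site. clk" UNIV by unfold_locales

lemma prob_space_P_dyn: "prob_space P_dyn"
  unfolding P_dyn_clk by (rule prob_space_PiM) (rule prob_space_clk)

interpretation P_dyn: prob_space P_dyn by (rule prob_space_P_dyn)

lemma sets_P_dyn [measurable_cong]: "sets P_dyn = sets (\<Pi>\<^sub>M x\<in>UNIV. clk)"
  unfolding P_dyn_clk ..

lemma space_P_dyn [simp]: "space P_dyn = UNIV"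
  by (simp add: P_dyn_clk space_PiM)

lemma P_dyn_UNIV [simp]: "emeasure P_dyn UNIV = 1"
  using P_dyn.emeasure_space_1 by simp

lemma measurable_P_dyn_component: "h \<in> N \<rightarrow>\<^sub>M P_dyn \<Longrightarrow> (\<lambda>x. h x y) \<in> N \<rightarrow>\<^sub>M clk"
  by (rule measurable_compose[of h N P_dyn]) (auto simp: P_dyn_clk)

lemma measurable_P_dyn_component' [measurable]: "(\<lambda>d. d y) \<in> P_dyn \<rightarrow>\<^sub>M clk"
  by (rule measurable_P_dyn_component) simp

lemma measurable_P_dynI: "(\<And>y. (\<lambda>x. f x y) \<in> N \<rightarrow>\<^sub>M clk) \<Longrightarrow> (\<lambda>x y. f x y) \<in> N \<rightarrow>\<^sub>M P_dyn"
  by (subst measurable_cong_sets[OF refl sets_P_dyn]) (rule measurable_abs_UNIV)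

lemma sets_P_dyn_cylinder:
  assumes "finite J" "\<And>x. x \<in> J \<Longrightarrow> A x \<in> sets clk"
  shows "{d. \<forall>x\<in>J. d x \<in> A x} \<in> sets P_dyn"
proof (rule sets_Collect_UNIV)
  show "Measurable.pred P_dyn (\<lambda>d. \<forall>x\<in>J. d x \<in> A x)"
  proof (rule pred_intros_finite[OF assms(1)])
    fix x assume "x \<in> J"
    then have [measurable]: "A x \<in> sets clk" using assms by auto
    show "Measurable.pred P_dyn (\<lambda>d. d x \<in> A x)" by measurable
  qed
qed simp

lemma emeasure_P_dyn_cylinder:
  assumes "finite J" "\<And>x. x \<in> J \<Longrightarrow> A x \<in> sets clk"
  shows "emeasure P_dyn {d. \<forall>x\<in>J. d x \<in> A x} = (\<Prod>x\<in>J. emeasure clk (A x))"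
  using dyn.emeasure_PiM_Collect[of J A] assms by (simp add: P_dyn_clk[symmetric])

lemma nn_integral_prod_sites:
  assumes J: "finite J" and g: "\<And>x. x \<in> J \<Longrightarrow> g x \<in> borel_measurable clk"
  shows "(\<integral>\<^sup>+ d. (\<Prod>x\<in>J. g x (d x)) \<partial>P_dyn) = (\<Prod>x\<in>J. \<integral>\<^sup>+ e. g x e \<partial>clk)"
proof -
  have r: "(\<lambda>d. restrict d J) \<in> P_dyn \<rightarrow>\<^sub>M (\<Pi>\<^sub>M x\<in>J. clk)"
    unfolding P_dyn_clk by (rule measurable_restrict_subset) simp
  have "(\<integral>\<^sup>+ d. (\<Prod>x\<in>J. g x (d x)) \<partial>P_dyn) = (\<integral>\<^sup>+ d. (\<Prod>x\<in>J. g x (restrict d J x)) \<partial>P_dyn)"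
    by (intro nn_integral_cong prod.cong) auto
  also have "\<dots> = (\<integral>\<^sup>+ d. (\<Prod>x\<in>J. g x (d x)) \<partial>distr P_dyn (\<Pi>\<^sub>M x\<in>J. clk) (\<lambda>d. restrict d J))"
  proof (rule nn_integral_distr[symmetric, OF r])
    have "(\<lambda>d. g x (d x)) \<in> borel_measurable (\<Pi>\<^sub>M x\<in>J. clk)" if "x \<in> J" for x
      by (rule measurable_compose[OF measurable_component_singleton[OF that] g[OF that]])
    then show "(\<lambda>d. \<Prod>x\<in>J. g x (d x)) \<in> borel_measurable (distr P_dyn (\<Pi>\<^sub>M x\<in>J. clk) (\<lambda>d. restrict d J))"
      by simp
  qed
  also have "distr P_dyn (\<Pi>\<^sub>M x\<in>J. clk) (\<lambda>d. restrict d J) = (\<Pi>\<^sub>M x\<in>J. clk)"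
    unfolding P_dyn_clk by (rule dyn.distr_PiM_restrict_finite[OF J]) simp
  also have "(\<integral>\<^sup>+ d. (\<Prod>x\<in>J. g x (d x)) \<partial>(\<Pi>\<^sub>M x\<in>J. clk)) = (\<Prod>x\<in>J. \<integral>\<^sup>+ e. g x e \<partial>clk)"
    by (rule dyn.product_nn_integral_prod[OF J g])
  finally show ?thesis .
qed

definition dgraft :: "real \<Rightarrow> clocks \<Rightarrow> clocks \<Rightarrow> clocks" where
  "dgraft t d d' x = graft t (d x) (d' x)"

lemma measurable_dgraft [measurable (raw)]:
  "f \<in> N \<rightarrow>\<^sub>M P_dyn \<Longrightarrow> g \<in> N \<rightarrow>\<^sub>M P_dyn \<Longrightarrow> (\<lambda>x. dgraft t (f x) (g x)) \<in> N \<rightarrow>\<^sub>M P_dyn"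
  unfolding dgraft_def[abs_def]
  by (rule measurable_P_dynI, rule measurable_graft, simp, (rule measurable_P_dyn_component, assumption)+)

lemma space_dyn2 [simp]: "space (P_dyn \<Otimes>\<^sub>M P_dyn) = UNIV"
  by (simp add: space_pair_measure)

text \<open>On a cylinder over finitely many sites, independence of the sites turns both
  integrations into products, and \<open>distr_graft\<close> treats each factor.\<close>

lemma distr_dgraft:
  assumes t: "0 \<le> t"
  shows "distr (P_dyn \<Otimes>\<^sub>M P_dyn) P_dyn (\<lambda>p. dgraft t (fst p) (snd p)) = P_dyn"
proof -
  have m: "(\<lambda>p. dgraft t (fst p) (snd p)) \<in> P_dyn \<Otimes>\<^sub>M P_dyn \<rightarrow>\<^sub>M P_dyn" by measurable
  have "distr (P_dyn \<Otimes>\<^sub>M P_dyn) P_dyn (\<lambda>p. dgraft t (fst p) (snd p)) = (\<Pi>\<^sub>M x\<in>UNIV. clk)"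
  proof (rule dyn.PiM_eq)
    fix J :: "site set" and F assume J: "finite J" "J \<subseteq> UNIV" "\<And>j. j \<in> J \<Longrightarrow> F j \<in> sets clk"
    let ?X = "prod_emb UNIV (\<lambda>_. clk) J (Pi\<^sub>E J F)"
    have X: "?X = {d. \<forall>x\<in>J. d x \<in> F x}" by (auto simp: prod_emb_def PiE_iff)
    have Xm: "?X \<in> sets P_dyn" unfolding X using J by (intro sets_P_dyn_cylinder) auto
    define G where "G x e = {e'. graft t e e' \<in> F x}" for x e
    have Gm: "G x e \<in> sets clk" if "x \<in> J" for x e
    proof -
      have "(\<lambda>e'. graft t e e') \<in> clk \<rightarrow>\<^sub>M clk" by measurable
      from measurable_sets[OF this J(3)[OF that]] show ?thesis by (simp add: G_def vimage_def)
    qed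
    have G2: "{p. graft t (fst p) (snd p) \<in> F x} \<in> sets (clk \<Otimes>\<^sub>M clk)" if "x \<in> J" for x
    proof -
      have "(\<lambda>p. graft t (fst p) (snd p)) \<in> clk \<Otimes>\<^sub>M clk \<rightarrow>\<^sub>M clk" by measurable
      from measurable_sets[OF this J(3)[OF that]] show ?thesis by (simp add: vimage_def)
    qed
    have Gi: "(\<lambda>e. emeasure clk (G x e)) \<in> borel_measurable clk" if "x \<in> J" for x
      using clkp.measurable_emeasure_Pair[OF G2[OF that]] by (simp add: G_def vimage_def)
    have "(\<integral>\<^sup>+ e. emeasure clk (G x e) \<partial>clk) = emeasure clk (F x)" if "x \<in> J" for x
    proof -
      have "(\<integral>\<^sup>+ e. emeasure clk (G x e) \<partial>clk) = emeasure (clk \<Otimes>\<^sub>M clk) {p. graft t (fst p) (snd p) \<in> F x}"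
        by (subst clkp.emeasure_pair_measure_alt[OF G2[OF that]]) (simp add: G_def vimage_def)
      also have "\<dots> = emeasure (distr (clk \<Otimes>\<^sub>M clk) clk (\<lambda>p. graft t (fst p) (snd p))) (F x)"
        using J(3)[OF that] by (subst emeasure_distr) (auto simp: vimage_def)
      finally show ?thesis by (simp add: distr_graft[OF t])
    qed
    note Gint = this
    have pre: "(\<lambda>p. dgraft t (fst p) (snd p)) -` ?X \<inter> space (P_dyn \<Otimes>\<^sub>M P_dyn) \<in> sets (P_dyn \<Otimes>\<^sub>M P_dyn)"
      by (rule measurable_sets[OF m Xm])
    have "emeasure (distr (P_dyn \<Otimes>\<^sub>M P_dyn) P_dyn (\<lambda>p. dgraft t (fst p) (snd p))) ?X =
        emeasure (P_dyn \<Otimes>\<^sub>M P_dyn) ((\<lambda>p. dgraft t (fst p) (snd p)) -` ?X \<inter> space (P_dyn \<Otimes>\<^sub>M P_dyn))"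
      by (rule emeasure_distr[OF m Xm])
    also have "\<dots> = (\<integral>\<^sup>+ d. emeasure P_dyn {d'. \<forall>x\<in>J. d' x \<in> G x (d x)} \<partial>P_dyn)"
      by (subst P_dyn.emeasure_pair_measure_alt[OF pre]) (simp add: X G_def vimage_def dgraft_def)
    also have "\<dots> = (\<integral>\<^sup>+ d. (\<Prod>x\<in>J. emeasure clk (G x (d x))) \<partial>P_dyn)"
      using J Gm by (intro nn_integral_cong emeasure_P_dyn_cylinder) auto
    also have "\<dots> = (\<Prod>x\<in>J. emeasure clk (F x))"
      using nn_integral_prod_sites[OF J(1), of "\<lambda>x e. emeasure clk (G x e)"] Gi Gint by simp
    finally show "emeasure (distr (P_dyn \<Otimes>\<^sub>M P_dyn) P_dyn (\<lambda>p. dgraft t (fst p) (snd p))) ?X = (\<Prod>x\<in>J. emeasure clk (F x))" .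
  qed (simp add: sets_P_dyn)
  then show ?thesis by (simp add: P_dyn_clk)
qed

lemma AE_P_dyn_component: "AE e in clk. P e \<Longrightarrow> AE d in P_dyn. P (d x)"
  unfolding P_dyn_clk by (rule AE_PiM_component[of UNIV "\<lambda>_. clk"]) (auto intro: prob_space_clk)

lemma AE_P_dyn_proper: "AE d in P_dyn. \<forall>x. proper (d x)"
  by (simp add: AE_all_countable AE_P_dyn_component AE_proper)

lemma distr_two_sites:
  assumes "x \<noteq> y"
  shows "distr P_dyn (clk \<Otimes>\<^sub>M clk) (\<lambda>d. (d x, d y)) = clk \<Otimes>\<^sub>M clk"
proof (rule sym, rule pair_measure_eqI)
  fix A B assume AB: "A \<in> sets clk" "B \<in> sets clk"
  have "emeasure (distr P_dyn (clk \<Otimes>\<^sub>M clk) (\<lambda>d. (d x, d y))) (A \<times> B) =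
    emeasure P_dyn {d. \<forall>z\<in>{x, y}. d z \<in> (if z = x then A else B)}"
    using assms AB by (subst emeasure_distr) (auto intro!: arg_cong[where f = "emeasure P_dyn"])
  also have "\<dots> = (\<Prod>z\<in>{x, y}. emeasure clk (if z = x then A else B))"
    using AB by (intro emeasure_P_dyn_cylinder) auto
  finally show "emeasure clk A * emeasure clk B = emeasure (distr P_dyn (clk \<Otimes>\<^sub>M clk) (\<lambda>d. (d x, d y))) (A \<times> B)"
    using assms by simp
qed (auto intro: clkp.sigma_finite_measure_axioms)

text \<open>Independent ring times without atoms almost surely differ. Hence each jump in a box
  changes a single spin, which the energy count along a trajectory relies on.\<close>

lemma AE_distinct_rings:
  "AE d in P_dyn. \<forall>x y n m. x \<noteq> y \<longrightarrow> ring (d x) n \<noteq> ring (d y) m"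
proof -
  have "AE d in P_dyn. ring (d x) n \<noteq> ring (d y) m" if xy: "x \<noteq> y" for x y n m
  proof -
    let ?N = "{p. ring (fst p) n = ring (snd p) m}"
    have N: "?N \<in> sets (clk \<Otimes>\<^sub>M clk)" by (rule sets_Collect_UNIV) auto
    have "emeasure (clk \<Otimes>\<^sub>M clk) ?N = (\<integral>\<^sup>+ e. emeasure clk {d. ring d n = ring e m} \<partial>clk)"
      by (subst clk2.emeasure_pair_measure_alt2[OF N]) (simp add: vimage_def)
    then have "emeasure (clk \<Otimes>\<^sub>M clk) ?N = 0" by (simp add: emeasure_ring_eq)
    with N have "AE p in clk \<Otimes>\<^sub>M clk. ring (fst p) n \<noteq> ring (snd p) m"
      by (intro AE_I[of _ _ ?N]) auto
    then have "AE p in distr P_dyn (clk \<Otimes>\<^sub>M clk) (\<lambda>d. (d x, d y)). ring (fst p) n \<noteq> ring (snd p) m"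
      unfolding distr_two_sites[OF xy] .
    from AE_distrD[OF _ this] show ?thesis by simp
  qed
  then show ?thesis by (simp add: AE_all_countable)
qed

section \<open>Absence of percolation of ringing sites\<close>

fun nn_paths :: "nat \<Rightarrow> site \<Rightarrow> site list set" where
  "nn_paths 0 x = {[x]}"
| "nn_paths (Suc n) x = (\<Union>y\<in>nbrs x. (#) x ` nn_paths n y)"

lemma card_nbrs_le: "card (nbrs x) \<le> 4"
  by (cases x) (simp add: nbrs_eq)

lemma finite_nn_paths: "finite (nn_paths n x)"
  by (induction n arbitrary: x) (auto simp: finite_nbrs)

lemma card_nn_paths: "card (nn_paths n x) \<le> 4 ^ n"
proof (induction n arbitrary: x)
  case (Suc n)
  have "card (nn_paths (Suc n) x) \<le> (\<Sum>y\<in>nbrs x. card ((#) x ` nn_paths n y))"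
    by (simp add: card_UN_le finite_nbrs)
  also have "\<dots> \<le> (\<Sum>y\<in>nbrs x. 4 ^ n)"
    by (intro sum_mono order_trans[OF card_image_le Suc]) (simp add: finite_nn_paths)
  also have "\<dots> \<le> 4 * 4 ^ n" using card_nbrs_le[of x] by simp
  finally show ?case by simp
qed simp

lemma length_nn_paths: "xs \<in> nn_paths n x \<Longrightarrow> length xs = Suc n"
  by (induction n arbitrary: x xs) auto

text \<open>Self-avoiding paths of ringing sites from any given site are of bounded length, that is,
  the cluster of ringing sites is finite. Distinctness of the sites makes the probabilities along a
  path multiply.\<close>

definition nonperc :: "real \<Rightarrow> real \<Rightarrow> clocks \<Rightarrow> bool" where
  "nonperc t u d \<longleftrightarrow>
     (\<forall>x. \<exists>n. \<forall>xs\<in>nn_paths n x. distinct xs \<longrightarrow> \<not> (\<forall>y\<in>set xs. \<not> quiet t u (d y)))"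

text \<open>A Peierls count: a window of length \<open>1/8\<close> contains a ring of a given site with probability at most
  \<open>1/8\<close>, and there are at most \<open>4 ^ n\<close> paths of length \<open>n\<close>.\<close>

lemma AE_nonperc:
  assumes "0 \<le> t"
  shows "AE d in P_dyn. nonperc t (t + 1/8) d"
proof -
  have "AE d in P_dyn. \<exists>n. \<forall>xs\<in>nn_paths n x. distinct xs \<longrightarrow> \<not> (\<forall>y\<in>set xs. \<not> quiet t (t + 1/8) (d y))" for x
  proof (rule AE_I)
    let ?R = "{e. \<not> quiet t (t + 1/8) e}"
    let ?A = "\<lambda>xs. {d. \<forall>y\<in>set xs. d y \<in> ?R}"
    let ?P = "\<lambda>n. {xs \<in> nn_paths n x. distinct xs}"
    let ?N = "\<Inter>n. \<Union>xs\<in>?P n. ?A xs"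
    have R: "?R \<in> sets clk" "emeasure clk ?R \<le> ennreal (1/8)"
    proof -
      have *: "?R = {e. \<exists>n. t < ring e n \<and> ring e n \<le> t + 1/8}" by (auto simp: quiet_def)
      show "?R \<in> sets clk" unfolding * by (rule sets_Collect_UNIV) auto
      show "emeasure clk ?R \<le> ennreal (1/8)" unfolding * by (rule emeasure_window) (use assms in auto)
    qed
    have A: "?A xs \<in> sets P_dyn" for xs by (rule sets_P_dyn_cylinder) (use R in auto)
    have fin: "finite (?P n)" for n by (rule finite_subset[OF _ finite_nn_paths[of n x]]) auto
    show N: "?N \<in> sets P_dyn"
      using A fin by (intro sets.countable_INT) (auto intro!: sets.finite_UN)
    have "emeasure P_dyn ?N \<le> ennreal ((1 / 2) ^ n)" for n
    proof -
      have "emeasure P_dyn ?N \<le> emeasure P_dyn (\<Union>xs\<in>?P n. ?A xs)"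
        using A fin by (intro emeasure_mono sets.finite_UN) auto
      also have "\<dots> \<le> (\<Sum>xs\<in>?P n. emeasure P_dyn (?A xs))"
        using A fin by (intro emeasure_subadditive_finite) auto
      also have "\<dots> \<le> (\<Sum>xs\<in>?P n. ennreal ((1/8) ^ Suc n))"
      proof (rule sum_mono)
        fix xs assume xs: "xs \<in> ?P n"
        have "emeasure P_dyn (?A xs) = (\<Prod>y\<in>set xs. emeasure clk ?R)"
          by (rule emeasure_P_dyn_cylinder) (use R in auto)
        also have "\<dots> = emeasure clk ?R ^ Suc n"
          using xs distinct_card[of xs] length_nn_paths[of xs n x] by simp
        also have "\<dots> \<le> ennreal (1/8) ^ Suc n" by (intro power_mono R) simp
        finally show "emeasure P_dyn (?A xs) \<le> ennreal ((1/8) ^ Suc n)" by (simp only: ennreal_power)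
      qed
      also have "\<dots> = ennreal (real (card (?P n)) * (1/8) ^ Suc n)"
        by (simp add: ennreal_mult'[symmetric] ennreal_of_nat_eq_real_of_nat)
      also have "\<dots> \<le> ennreal ((1 / 2) ^ n)"
      proof (rule ennreal_leI)
        have "card (?P n) \<le> card (nn_paths n x)" by (intro card_mono finite_nn_paths) auto
        also have "\<dots> \<le> 4 ^ n" by (rule card_nn_paths)
        finally have "real (card (?P n)) \<le> 4 ^ n" by (metis of_nat_le_iff of_nat_numeral of_nat_power)
        then have "real (card (?P n)) * (1/8) ^ Suc n \<le> 4 ^ n * (1/8) ^ n"
          by (intro mult_mono) (auto simp: power_decreasing)
        also have "\<dots> = (1/2) ^ n" by (simp add: power_mult_distrib[symmetric])
        finally show "real (card (?P n)) * (1/8) ^ Suc n \<le> (1/2) ^ n" .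
      qed
      finally show ?thesis .
    qed
    moreover have "(\<lambda>n. ennreal ((1 / 2) ^ n)) \<longlonglongrightarrow> ennreal 0"
      by (intro tendsto_ennrealI LIMSEQ_power_zero) auto
    ultimately have "emeasure P_dyn ?N \<le> 0" by (intro LIMSEQ_le_const) auto
    then show "emeasure P_dyn ?N = 0" by simp
    show "{d \<in> space P_dyn. \<not> (\<exists>n. \<forall>xs\<in>nn_paths n x. distinct xs \<longrightarrow> \<not> (\<forall>y\<in>set xs. \<not> quiet t (t + 1/8) (d y)))} \<subseteq> ?N"
      by auto
  qed
  then show ?thesis unfolding nonperc_def by (simp add: AE_all_countable)
qed

section \<open>Uniqueness of trajectories\<close>

text \<open>Absence of percolation holds only over short windows; the windows of length
  \<open>1/8\<close> cover the half line, so uniqueness can be passed from each to the next.\<close>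

definition regular :: "clocks \<Rightarrow> bool" where
  "regular d \<longleftrightarrow> (\<forall>x. proper (d x)) \<and> (\<forall>x y n m. x \<noteq> y \<longrightarrow> ring (d x) n \<noteq> ring (d y) m) \<and>
     (\<forall>k :: nat. nonperc (k / 8) (k / 8 + 1 / 8) d)"

lemma AE_regular: "AE d in P_dyn. regular d"
proof -
  have "AE d in P_dyn. \<forall>k :: nat. nonperc (k / 8) (k / 8 + 1 / 8) d"
    by (simp add: AE_all_countable AE_nonperc)
  with AE_P_dyn_proper AE_distinct_rings show ?thesis
    unfolding regular_def by eventually_elim blast
qed

lemma follows_marks:
  "follows_dynamics \<eta> d s \<longleftrightarrow> s 0 = \<eta> \<and>
     (\<forall>x t u. 0 \<le> t \<longrightarrow> t \<le> u \<longrightarrow> (\<forall>p\<in>marks (d x). \<not> (t < fst p \<and> fst p \<le> u)) \<longrightarrow> s u x = s t x) \<and>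
     (\<forall>x. \<forall>p\<in>marks (d x). \<exists>\<zeta>. left_limit s (fst p) \<zeta> \<and> s (fst p) x = updated_spin \<zeta> x (snd p))"
  unfolding follows_dynamics_def ring_time_ring coin_def marks_def
  by (simp add: greaterThanAtMost_iff) blast

lemma updated_spin_cong:
  assumes "\<And>y. y \<in> insert x (nbrs x) \<Longrightarrow> \<zeta> y = \<zeta>' y"
  shows "updated_spin \<zeta> x c = updated_spin \<zeta>' x c"
proof -
  have "{y \<in> nbrs x. \<zeta> y \<noteq> \<zeta> x} = {y \<in> nbrs x. \<zeta>' y \<noteq> \<zeta>' x}" using assms by auto
  then show ?thesis using assms[of x] by (simp add: updated_spin_def disagreements_def)
qed

lemma nn_paths_successively:
  "xs \<noteq> [] \<Longrightarrow> successively (\<lambda>a b. b \<in> nbrs a) xs \<Longrightarrow> xs \<in> nn_paths (length xs - 1) (hd xs)"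
proof (induction xs)
  case (Cons a xs)
  show ?case
  proof (cases xs)
    case (Cons b ys)
    with Cons.prems Cons.IH have "b \<in> nbrs a" "xs \<in> nn_paths (length xs - 1) b" by auto
    then show ?thesis using Cons by auto
  qed simp
qed simp

text \<open>The cluster consists of the end points of self-avoiding paths of ringing sites. A long
  path would have a forbidden prefix, so there are finitely many. A ringing neighbour of an end
  point either extends the path or already lies on it, where the path can be cut.\<close>

lemma finite_cluster:
  assumes "nonperc t u d" "\<not> quiet t u (d x)"
  obtains C where "finite C" "x \<in> C" "\<And>y z. y \<in> C \<Longrightarrow> z \<in> nbrs y \<Longrightarrow> \<not> quiet t u (d z) \<Longrightarrow> z \<in> C"
proof -
  define path where "path xs \<longleftrightarrow> xs \<noteq> [] \<and> hd xs = x \<and> successively (\<lambda>a b. b \<in> nbrs a) xs \<and> distinct xs \<and>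
    (\<forall>y\<in>set xs. \<not> quiet t u (d y))" for xs
  define C where "C = last ` Collect path"
  obtain n where n: "\<And>xs. xs \<in> nn_paths n x \<Longrightarrow> distinct xs \<Longrightarrow> \<not> (\<forall>y\<in>set xs. \<not> quiet t u (d y))"
    using assms(1) unfolding nonperc_def by blast
  have prefix: "path ys" if "path (ys @ zs)" "ys \<noteq> []" for ys zs
    using that by (auto simp: path_def successively_append_iff)
  have "length xs \<le> n" if "path xs" for xs
  proof (rule ccontr)
    assume "\<not> length xs \<le> n"
    let ?ys = "take (Suc n) xs"
    have "path ?ys" by (rule prefix[of _ "drop (Suc n) xs"]) (use that \<open>\<not> length xs \<le> n\<close> in auto)
    moreover have "length ?ys - 1 = n" using \<open>\<not> length xs \<le> n\<close> by simp
    ultimately have "?ys \<in> nn_paths n x" using nn_paths_successively[of ?ys] by (simp add: path_def)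
    with n[of ?ys] \<open>path ?ys\<close> show False by (simp add: path_def)
  qed
  then have "Collect path \<subseteq> (\<Union>m\<le>n. nn_paths m x)"
    using nn_paths_successively by (fastforce simp: path_def)
  then have "finite (Collect path)" by (rule finite_subset) (simp add: finite_nn_paths)
  then have "finite C" by (simp add: C_def)
  moreover have "path [x]" using assms(2) by (simp add: path_def)
  then have "x \<in> C" unfolding C_def by force
  moreover have "z \<in> C" if y: "y \<in> C" and z: "z \<in> nbrs y" "\<not> quiet t u (d z)" for y z
  proof -
    obtain xs where xs: "path xs" "last xs = y" using y unfolding C_def by blast
    show "z \<in> C"
    proof (cases "z \<in> set xs")
      case True
      then obtain ys zs where "xs = (ys @ [z]) @ zs" by (metis append.assoc append_Cons append_Nil split_list)
      with xs prefix[of "ys @ [z]" zs] have "path (ys @ [z])" by auto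
      then show ?thesis unfolding C_def by force
    next
      case False
      then have "path (xs @ [z])"
        using xs z by (auto simp: path_def successively_append_iff)
      then show ?thesis unfolding C_def by force
    qed
  qed
  ultimately show thesis by (rule that)
qed

text \<open>A discrepancy at a ring requires an earlier one at the same site or a neighbour, and
  that one in turn goes back to a still earlier ring. Within a short window all these rings belong
  to a finite cluster, so the descent cannot continue. The clocks need to agree only up to
  \<open>T\<close>, which allows comparison with a grafted clock.\<close>

lemma trajectory_unique:
  assumes s: "follows_dynamics \<eta> d s" and s': "follows_dynamics \<eta> d' s'" and reg: "regular d"
    and same: "\<And>x. {p \<in> marks (d x). fst p \<le> T} = {p \<in> marks (d' x). fst p \<le> T}"
    and u: "0 \<le> u" "u \<le> T"
  shows "s u = s' u"
proof -
  have proper: "proper (d x)" for x using reg unfolding regular_def by blast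
  have const: "s u x = s t x" if "0 \<le> t" "t \<le> u" "\<And>p. p \<in> marks (d x) \<Longrightarrow> t < fst p \<Longrightarrow> fst p \<le> u \<Longrightarrow> False" for x t u
    using s that unfolding follows_marks by blast
  have const': "s' u x = s' t x" if "0 \<le> t" "t \<le> u" "u \<le> T" "\<And>p. p \<in> marks (d x) \<Longrightarrow> t < fst p \<Longrightarrow> fst p \<le> u \<Longrightarrow> False" for x t u
  proof -
    have "\<not> (t < fst p \<and> fst p \<le> u)" if "p \<in> marks (d' x)" for p
    proof
      assume *: "t < fst p \<and> fst p \<le> u"
      with that \<open>u \<le> T\<close> have "p \<in> {p \<in> marks (d' x). fst p \<le> T}" by auto
      then have "p \<in> marks (d x)" unfolding same[symmetric] by simp
      with * \<open>\<And>p. p \<in> marks (d x) \<Longrightarrow> t < fst p \<Longrightarrow> fst p \<le> u \<Longrightarrow> False\<close> show False by blast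
    qed
    with s' that(1,2) show ?thesis unfolding follows_marks by blast
  qed
  have upd: "\<exists>\<zeta>. left_limit s (fst p) \<zeta> \<and> s (fst p) x = updated_spin \<zeta> x (snd p)"
    if "p \<in> marks (d x)" for p x using s that unfolding follows_marks by blast
  have upd': "\<exists>\<zeta>. left_limit s' (fst p) \<zeta> \<and> s' (fst p) x = updated_spin \<zeta> x (snd p)"
    if "p \<in> marks (d x)" "fst p \<le> T" for p x
  proof -
    have "p \<in> {p \<in> marks (d x). fst p \<le> T}" using that by simp
    then have "p \<in> marks (d' x)" unfolding same by simp
    with s' show ?thesis unfolding follows_marks by blast
  qed
  \<comment> \<open>Both spins rest between rings, so a discrepancy that arises after
    \<open>a\<close> is already present at the last ring of the site up to time
    \<open>u\<close>.\<close>
  have last_ring: "\<exists>p\<in>marks (d x). a < fst p \<and> fst p \<le> u \<and> s (fst p) x \<noteq> s' (fst p) x"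
    if a: "0 \<le> a" "s a x = s' a x" and u: "a \<le> u" "u \<le> T" "s u x \<noteq> s' u x" for a u x
  proof -
    let ?N = "{n. a < ring (d x) n \<and> ring (d x) n \<le> u}"
    have "?N \<noteq> {}"
    proof
      assume e: "?N = {}"
      have "p \<in> marks (d x) \<Longrightarrow> a < fst p \<Longrightarrow> fst p \<le> u \<Longrightarrow> False" for p
        using e by (auto simp: marks_def)
      with const[of a u x] const'[of a u x] a u show False by metis
    qed
    moreover have fin: "finite ?N" by (rule finite_window[OF proper])
    ultimately have M: "Max ?N \<in> ?N" by (rule Max_in[rotated])
    let ?r = "ring (d x) (Max ?N)"
    have none: "p \<in> marks (d x) \<Longrightarrow> ?r < fst p \<Longrightarrow> fst p \<le> u \<Longrightarrow> False" for p
    proof -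
      assume p: "p \<in> marks (d x)" "?r < fst p" "fst p \<le> u"
      then obtain m where m: "fst p = ring (d x) m" by (auto simp: marks_def)
      then have "m \<in> ?N" using p M by auto
      then have "m \<le> Max ?N" by (rule Max_ge[OF fin])
      then have "ring (d x) m \<le> ?r" by (simp add: strict_mono_less_eq[OF strict_mono_ring[OF proper]])
      with p m show False by simp
    qed
    have r: "a < ?r" "?r \<le> u" using M by auto
    have "s u x = s ?r x" "s' u x = s' ?r x"
      using const[of ?r u x] const'[of ?r u x] none r a u by auto
    then have "s ?r x \<noteq> s' ?r x" using u by simp
    moreover have "(?r, snd (d x (Max ?N))) \<in> marks (d x)" by (auto simp: marks_def)
    ultimately show ?thesis using r by force
  qed
  \<comment> \<open>Both updates use the same coin, so different results force different left limits
    at \<open>x\<close> or a neighbour, hence a discrepancy strictly before the ring.\<close>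
  have earlier: "\<exists>y v. y \<in> insert x (nbrs x) \<and> a \<le> v \<and> v < fst p \<and> s v y \<noteq> s' v y"
    if p: "p \<in> marks (d x)" "a < fst p" "fst p \<le> T" "s (fst p) x \<noteq> s' (fst p) x" for a p x
  proof -
    obtain \<zeta> where z: "left_limit s (fst p) \<zeta>" "s (fst p) x = updated_spin \<zeta> x (snd p)" using upd[OF p(1)] by blast
    obtain \<zeta>' where z': "left_limit s' (fst p) \<zeta>'" "s' (fst p) x = updated_spin \<zeta>' x (snd p)" using upd'[OF p(1,3)] by blast
    from p(4) z(2) z'(2) obtain y where y: "y \<in> insert x (nbrs x)" "\<zeta> y \<noteq> \<zeta>' y"
      using updated_spin_cong[of x \<zeta> \<zeta>' "snd p"] by auto
    have "eventually (\<lambda>v. s v y = \<zeta> y) (at_left (fst p))" "eventually (\<lambda>v. s' v y = \<zeta>' y) (at_left (fst p))"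
      using z(1) z'(1) unfolding left_limit_def by blast+
    moreover have "eventually (\<lambda>v. v \<in> {a<..<fst p}) (at_left (fst p))" by (rule eventually_at_left_real[OF p(2)])
    ultimately have "eventually (\<lambda>v. s v y = \<zeta> y \<and> s' v y = \<zeta>' y \<and> v \<in> {a<..<fst p}) (at_left (fst p))"
      by eventually_elim auto
    then obtain v where "s v y = \<zeta> y" "s' v y = \<zeta>' y" "v \<in> {a<..<fst p}"
      using eventually_happens'[OF trivial_limit_at_left_real] by blast
    then have "a \<le> v" "v < fst p" "s v y \<noteq> s' v y" using y(2) by simp_all
    with y(1) show ?thesis by blast
  qed
  have "\<forall>u. 0 \<le> u \<and> u \<le> T \<and> u \<le> real k / 8 \<longrightarrow> s u = s' u" for k :: nat
  proof (induction k)
    case 0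
    have "s 0 = s' 0" using s s' by (simp add: follows_marks)
    then show ?case by auto
  next
    case (Suc k)
    define a where "a = real k / 8"
    have a0: "0 \<le> a" by (simp add: a_def)
    show ?case
    proof (rule ccontr)
      assume "\<not> ?thesis"
      moreover have "real (Suc k) / 8 = a + 1 / 8" by (simp add: a_def add_divide_distrib)
      ultimately obtain u where u': "0 \<le> u" "u \<le> T" "u \<le> a + 1 / 8" "s u \<noteq> s' u" by auto
      from u'(4) have "\<not> (\<forall>x. s u x = s' u x)" unfolding fun_eq_iff .
      then obtain x where "s u x \<noteq> s' u x" by blast
      with u' have ux: "0 \<le> u" "u \<le> T" "u \<le> a + 1 / 8" "s u x \<noteq> s' u x" by blast+
      have au: "a \<le> u"
      proof (rule ccontr)
        assume "\<not> a \<le> u"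
        with Suc ux show False by (auto simp: a_def)
      qed
      then have "s a = s' a" using Suc a0 ux by (auto simp: a_def)
      then have sa: "s a y = s' a y" for y by simp
      have nq: "\<not> quiet a (a + 1/8) (d y)" if "p \<in> marks (d y)" "a < fst p" "fst p \<le> u" for p y
      proof -
        have "fst p \<le> a + 1/8" using that(3) ux(3) by linarith
        with that(1,2) show ?thesis unfolding quiet_marks by blast
      qed
      from last_ring[OF a0 sa au ux(2,4)] obtain p where
        p: "p \<in> marks (d x)" "a < fst p" "fst p \<le> u" "s (fst p) x \<noteq> s' (fst p) x" by blast
      have "nonperc a (a + 1/8) d" using reg unfolding regular_def a_def by blast
      from finite_cluster[OF this nq[OF p(1-3)]] obtain C where
        C: "finite C" "x \<in> C" "\<And>y z. y \<in> C \<Longrightarrow> z \<in> nbrs y \<Longrightarrow> \<not> quiet a (a + 1/8) (d z) \<Longrightarrow> z \<in> C" by metis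
      \<comment> \<open>The times of discrepant rings in the cluster: a finite nonempty set, whose
        minimum is refuted by producing a smaller element.\<close>
      define R where "R = {r. \<exists>y\<in>C. \<exists>p\<in>marks (d y). r = fst p \<and> a < r \<and> r \<le> u \<and> s r y \<noteq> s' r y}"
      have RD: "\<exists>y\<in>C. \<exists>p\<in>marks (d y). r = fst p \<and> a < fst p \<and> fst p \<le> u \<and> s (fst p) y \<noteq> s' (fst p) y"
        if "r \<in> R" for r using that unfolding R_def by blast
      have "R \<subseteq> (\<Union>y\<in>C. ring (d y) ` {n. ring (d y) n \<le> u})"
        by (auto simp: R_def marks_def)
      then have finR: "finite R" by (rule finite_subset) (auto simp: C(1) finite_rings_le proper)
      have "fst p \<in> R" unfolding R_def using p C(2) by blast
      with finR have "Min R \<in> R" by (intro Min_in) auto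
      then obtain y q where q: "y \<in> C" "q \<in> marks (d y)" "Min R = fst q" "a < fst q" "fst q \<le> u" "s (fst q) y \<noteq> s' (fst q) y"
        using RD[of "Min R"] by blast
      have "fst q \<le> T" using q ux by linarith
      from earlier[OF q(2,4) this q(6)] obtain z v where
        z: "z \<in> insert y (nbrs y)" "a \<le> v" "v < fst q" "s v z \<noteq> s' v z" by blast
      have "v \<le> T" using z q ux by linarith
      from last_ring[OF a0 sa z(2) this z(4)] obtain p' where
        p': "p' \<in> marks (d z)" "a < fst p'" "fst p' \<le> v" "s (fst p') z \<noteq> s' (fst p') z" by blast
      have pu: "fst p' \<le> u" using p'(3) z(3) q(5) by linarith
      \<comment> \<open>The earlier discrepancy at \<open>z\<close> goes back to a ring in the
        window, so \<open>z\<close> is a ringing site and the cluster is closed under stepping to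
        it.\<close>
      have "z \<in> C" using C(3)[OF q(1) _ nq[OF p'(1,2) pu]] z(1) q(1) by blast
      then have "fst p' \<in> R" unfolding R_def using p'(1,2,4) pu by blast
      then have "Min R \<le> fst p'" by (rule Min_le[OF finR])
      with q(3) p'(3) z(3) show False by simp
    qed
  qed
  moreover obtain k :: nat where "u * 8 \<le> real k" using real_arch_simple by blast
  ultimately show ?thesis using u by (auto dest: spec[of _ k])
qed

section \<open>Translations of trajectories\<close>

definition translate :: "site \<Rightarrow> (site \<Rightarrow> 'a) \<Rightarrow> site \<Rightarrow> 'a" where
  "translate v f x = f (x + v)"

lemma nbrs_translate: "nbrs (x + v) = (\<lambda>y. y + v) ` nbrs x"
  by (cases x; cases v) (auto simp: nbrs_eq algebra_simps)

lemma disagreements_translate: "disagreements (translate v \<sigma>) x = disagreements \<sigma> (x + v)"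
proof -
  have "{y \<in> nbrs (x + v). \<sigma> y \<noteq> \<sigma> (x + v)} = (\<lambda>y. y + v) ` {y \<in> nbrs x. translate v \<sigma> y \<noteq> translate v \<sigma> x}"
    unfolding nbrs_translate translate_def by auto
  then show ?thesis by (simp add: disagreements_def card_image inj_on_def)
qed

lemma follows_translate:
  assumes "follows_dynamics \<eta> d s"
  shows "follows_dynamics (translate v \<eta>) (translate v d) (\<lambda>t. translate v (s t))"
proof -
  have upd: "updated_spin (translate v \<zeta>) x c = updated_spin \<zeta> (x + v) c" for \<zeta> x c
    unfolding updated_spin_def disagreements_translate by (simp add: translate_def)
  have lim: "left_limit (\<lambda>t. translate v (s t)) r (translate v \<zeta>)" if "left_limit s r \<zeta>" for r \<zeta>
    using that unfolding left_limit_def translate_def by blast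
  show ?thesis
    unfolding follows_marks
  proof (intro conjI allI impI ballI)
    show "translate v (s 0) = translate v \<eta>" using assms by (simp add: follows_marks)
    fix x
    show "translate v (s u) x = translate v (s t) x"
      if "0 \<le> t" "t \<le> u" "\<forall>p\<in>marks (translate v d x). \<not> (t < fst p \<and> fst p \<le> u)" for t u
      using assms that unfolding follows_marks translate_def by blast
    fix p assume "p \<in> marks (translate v d x)"
    then obtain \<zeta> where "left_limit s (fst p) \<zeta>" "s (fst p) (x + v) = updated_spin \<zeta> (x + v) (snd p)"
      using assms unfolding follows_marks translate_def by blast
    then show "\<exists>\<zeta>. left_limit (\<lambda>t. translate v (s t)) (fst p) \<zeta> \<and> translate v (s (fst p)) x = updated_spin \<zeta> x (snd p)"
      using lim upd by (metis translate_def)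
  qed
qed

section \<open>Translation invariance and the Markov property\<close>

abbreviation conf :: "config measure" where "conf \<equiv> (\<Pi>\<^sub>M x\<in>UNIV. count_space UNIV)"

lemma space_conf [simp]: "space conf = UNIV"
  by (simp add: space_PiM)

lemma sets_\<mu>0 [measurable_cong]: "sets \<mu>0 = sets conf"
  unfolding \<mu>0_def by (intro sets_PiM_cong) auto

lemma space_\<mu>0 [simp]: "space \<mu>0 = UNIV"
  by (simp add: \<mu>0_def space_PiM)

lemma prob_space_\<mu>0: "prob_space \<mu>0"
  unfolding \<mu>0_def by (intro prob_space_PiM measure_pmf.prob_space_axioms)

interpretation \<mu>0: prob_space \<mu>0 by (rule prob_space_\<mu>0)
interpretation P_joint: prob_space P_joint by (rule prob_space_P_joint)

lemma space_P_joint [simp]: "space P_joint = UNIV"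
  by (simp add: P_joint_def space_pair_measure)

lemma sets_P_joint [measurable_cong]: "sets P_joint = sets (\<mu>0 \<Otimes>\<^sub>M P_dyn)"
  by (simp add: P_joint_def)

lemma distr_translate_PiM:
  assumes "prob_space M"
  shows "distr (\<Pi>\<^sub>M x\<in>UNIV. M) (\<Pi>\<^sub>M x\<in>UNIV. M) (translate v) = (\<Pi>\<^sub>M x\<in>UNIV. M)"
proof -
  have "distr (\<Pi>\<^sub>M x\<in>UNIV. M) (\<Pi>\<^sub>M x\<in>UNIV. M) (\<lambda>\<omega>. \<lambda>x\<in>UNIV. \<omega> (x + v)) = (\<Pi>\<^sub>M x\<in>UNIV. M)"
    by (rule distr_PiM_reindex[of UNIV "\<lambda>_. M" "\<lambda>x. x + v" UNIV]) (auto simp: assms inj_on_def)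
  then show ?thesis by (simp add: translate_def[abs_def] restrict_def)
qed

lemma measurable_translate: "translate v \<in> (\<Pi>\<^sub>M x\<in>UNIV. M) \<rightarrow>\<^sub>M (\<Pi>\<^sub>M x\<in>UNIV. M)"
  unfolding translate_def[abs_def] by (rule measurable_abs_UNIV) (rule measurable_component_singleton, simp)

definition joint_translate :: "site \<Rightarrow> config \<times> clocks \<Rightarrow> config \<times> clocks" where
  "joint_translate v = map_prod (translate v) (translate v)"

lemma joint_translate_simps [simp]: "fst (joint_translate v \<omega>) = translate v (fst \<omega>)" "snd (joint_translate v \<omega>) = translate v (snd \<omega>)"
  by (simp_all add: joint_translate_def)

lemma measurable_joint_translate: "joint_translate v \<in> P_joint \<rightarrow>\<^sub>M P_joint"
proof -
  have "translate v \<in> \<mu>0 \<rightarrow>\<^sub>M \<mu>0" "translate v \<in> P_dyn \<rightarrow>\<^sub>M P_dyn"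
    unfolding \<mu>0_def P_dyn_clk by (rule measurable_translate)+
  then show ?thesis
    unfolding P_joint_def joint_translate_def map_prod_def by measurable
qed

lemma distr_joint_translate: "distr P_joint P_joint (joint_translate v) = P_joint"
proof -
  have 1: "distr \<mu>0 \<mu>0 (translate v) = \<mu>0"
    unfolding \<mu>0_def by (rule distr_translate_PiM) (rule measure_pmf.prob_space_axioms)
  have 2: "distr P_dyn P_dyn (translate v) = P_dyn"
    unfolding P_dyn_clk by (rule distr_translate_PiM) (rule prob_space_clk)
  have "translate v \<in> \<mu>0 \<rightarrow>\<^sub>M \<mu>0" "translate v \<in> P_dyn \<rightarrow>\<^sub>M P_dyn"
    unfolding \<mu>0_def P_dyn_clk by (rule measurable_translate)+
  then have "distr \<mu>0 \<mu>0 (translate v) \<Otimes>\<^sub>M distr P_dyn P_dyn (translate v) =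
      distr (\<mu>0 \<Otimes>\<^sub>M P_dyn) (\<mu>0 \<Otimes>\<^sub>M P_dyn) (\<lambda>(x, y). (translate v x, translate v y))"
    by (intro pair_measure_distr) (simp_all add: 2 P_dyn.sigma_finite_measure_axioms)
  then show ?thesis
    unfolding 1 2 P_joint_def joint_translate_def map_prod_def by simp
qed

definition joint_graft :: "real \<Rightarrow> (config \<times> clocks) \<times> clocks \<Rightarrow> config \<times> clocks" where
  "joint_graft t p = (fst (fst p), dgraft t (snd (fst p)) (snd p))"

lemma joint_graft_simps [simp]:
  "fst (joint_graft t p) = fst (fst p)" "snd (joint_graft t p) = dgraft t (snd (fst p)) (snd p)"
  by (simp_all add: joint_graft_def)

lemma measurable_fst_joint: "fst \<in> P_joint \<rightarrow>\<^sub>M \<mu>0" and measurable_snd_joint [measurable]: "snd \<in> P_joint \<rightarrow>\<^sub>M P_dyn"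
  unfolding P_joint_def by measurable

lemma measurable_joint_graft: "joint_graft t \<in> P_joint \<Otimes>\<^sub>M P_dyn \<rightarrow>\<^sub>M P_joint"
  unfolding joint_graft_def[abs_def]
  by (subst (2) P_joint_def)
    (intro measurable_Pair measurable_dgraft measurable_compose[OF measurable_fst measurable_fst_joint]
      measurable_compose[OF measurable_fst measurable_snd_joint] measurable_snd)

lemma distr_joint_graft:
  assumes t: "0 \<le> t"
  shows "distr (P_joint \<Otimes>\<^sub>M P_dyn) P_joint (joint_graft t) = P_joint"
proof (rule measure_eqI)
  fix A assume "A \<in> sets (distr (P_joint \<Otimes>\<^sub>M P_dyn) P_joint (joint_graft t))"
  then have A: "A \<in> sets P_joint" by simp
  then have A': "A \<in> sets (\<mu>0 \<Otimes>\<^sub>M P_dyn)" by (simp add: P_joint_def)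
  have sec: "{d. (\<eta>, d) \<in> A} \<in> sets P_dyn" for \<eta>
    using sets_Pair1[OF A', of \<eta>] by (simp add: vimage_def)
  have pre: "joint_graft t -` A \<inter> space (P_joint \<Otimes>\<^sub>M P_dyn) \<in> sets (P_joint \<Otimes>\<^sub>M P_dyn)"
    by (rule measurable_sets[OF measurable_joint_graft A])
  have m: "(\<lambda>p. dgraft t (fst p) (snd p)) \<in> P_dyn \<Otimes>\<^sub>M P_dyn \<rightarrow>\<^sub>M P_dyn" by measurable
  have inner: "{p. (\<eta>, dgraft t (fst p) (snd p)) \<in> A} \<in> sets (P_dyn \<Otimes>\<^sub>M P_dyn)" for \<eta>
    using measurable_sets[OF m sec[of \<eta>]] by (simp add: vimage_def)
  have "emeasure (distr (P_joint \<Otimes>\<^sub>M P_dyn) P_joint (joint_graft t)) A =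
      emeasure (P_joint \<Otimes>\<^sub>M P_dyn) (joint_graft t -` A \<inter> space (P_joint \<Otimes>\<^sub>M P_dyn))"
    by (rule emeasure_distr[OF measurable_joint_graft A])
  also have "\<dots> = (\<integral>\<^sup>+ \<omega>. emeasure P_dyn {d'. (fst \<omega>, dgraft t (snd \<omega>) d') \<in> A} \<partial>P_joint)"
    by (subst P_dyn.emeasure_pair_measure_alt[OF pre])
      (simp add: vimage_def joint_graft_def space_pair_measure)
  also have "\<dots> = (\<integral>\<^sup>+ \<eta>. \<integral>\<^sup>+ d. emeasure P_dyn {d'. (\<eta>, dgraft t d d') \<in> A} \<partial>P_dyn \<partial>\<mu>0)"
  proof -
    have "(\<lambda>\<omega>. emeasure P_dyn {d'. (fst \<omega>, dgraft t (snd \<omega>) d') \<in> A}) \<in> borel_measurable P_joint"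
      using P_dyn.measurable_emeasure_Pair[OF pre] by (simp add: vimage_def joint_graft_def space_pair_measure)
    then show ?thesis
      unfolding P_joint_def by (subst P_dyn.nn_integral_fst[symmetric]) simp_all
  qed
  also have "\<dots> = (\<integral>\<^sup>+ \<eta>. emeasure (P_dyn \<Otimes>\<^sub>M P_dyn) {p. (\<eta>, dgraft t (fst p) (snd p)) \<in> A} \<partial>\<mu>0)"
    by (intro nn_integral_cong, subst P_dyn.emeasure_pair_measure_alt[OF inner]) (simp add: vimage_def)
  also have "\<dots> = (\<integral>\<^sup>+ \<eta>. emeasure (distr (P_dyn \<Otimes>\<^sub>M P_dyn) P_dyn (\<lambda>p. dgraft t (fst p) (snd p))) {d. (\<eta>, d) \<in> A} \<partial>\<mu>0)"
    by (intro nn_integral_cong) (simp add: emeasure_distr[OF m sec] vimage_def)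
  also have "\<dots> = (\<integral>\<^sup>+ \<eta>. emeasure P_dyn {d. (\<eta>, d) \<in> A} \<partial>\<mu>0)"
    by (simp add: distr_dgraft[OF t])
  also have "\<dots> = emeasure P_joint A"
    unfolding P_joint_def by (subst P_dyn.emeasure_pair_measure_alt[OF A']) (simp add: vimage_def)
  finally show "emeasure (distr (P_joint \<Otimes>\<^sub>M P_dyn) P_joint (joint_graft t)) A = emeasure P_joint A" .
qed simp

lemma regular_proper: "regular d \<Longrightarrow> proper (d x)"
  unfolding regular_def by blast

definition good :: "(real \<Rightarrow> config \<times> clocks \<Rightarrow> config) \<Rightarrow> config \<times> clocks \<Rightarrow> bool" where
  "good \<sigma> \<omega> \<longleftrightarrow> follows_dynamics (fst \<omega>) (snd \<omega>) (\<lambda>t. \<sigma> t \<omega>) \<and> regular (snd \<omega>)"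

section \<open>Processes that follow the dynamics\<close>

locale ising =
  fixes \<sigma> :: "real \<Rightarrow> config \<times> clocks \<Rightarrow> config"
  assumes ising: "zero_temp_ising \<sigma>"
begin

lemma measurable_\<sigma>: "0 \<le> t \<Longrightarrow> \<sigma> t \<in> P_joint \<rightarrow>\<^sub>M conf"
  using ising by (simp add: zero_temp_ising_def)

lemma sets_\<sigma>: "0 \<le> t \<Longrightarrow> A \<in> sets conf \<Longrightarrow> {\<omega>. \<sigma> t \<omega> \<in> A} \<in> sets P_joint"
  using measurable_sets[OF measurable_\<sigma>] by (simp add: vimage_def)

lemma AE_good: "AE \<omega> in P_joint. good \<sigma> \<omega>"
proof -
  have "AE \<omega> in P_joint. regular (snd \<omega>)"
    unfolding P_joint_def by (rule AE_pair_snd[OF prob_space_P_dyn AE_regular])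
  moreover have "AE \<omega> in P_joint. follows_dynamics (fst \<omega>) (snd \<omega>) (\<lambda>t. \<sigma> t \<omega>)"
    using ising by (simp add: zero_temp_ising_def)
  ultimately show ?thesis unfolding good_def by eventually_elim simp
qed

text \<open>Both sides follow the dynamics of the translated data, and translation preserves the
  joint law, so the translated data are almost surely regular. Uniqueness identifies the two
  trajectories at all times at once.\<close>

lemma AE_translate: "AE \<omega> in P_joint. \<forall>t\<ge>0. \<sigma> t (joint_translate v \<omega>) = translate v (\<sigma> t \<omega>)"
proof -
  have "AE \<omega> in distr P_joint P_joint (joint_translate v). good \<sigma> \<omega>"
    unfolding distr_joint_translate by (rule AE_good)
  then have "AE \<omega> in P_joint. good \<sigma> (joint_translate v \<omega>)"
    by (rule AE_distrD[OF measurable_joint_translate])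
  with AE_good show ?thesis
  proof eventually_elim
    case (elim \<omega>)
    have f: "follows_dynamics (translate v (fst \<omega>)) (translate v (snd \<omega>)) (\<lambda>t. translate v (\<sigma> t \<omega>))"
      by (rule follows_translate) (use elim in \<open>simp add: good_def\<close>)
    have "\<sigma> t (joint_translate v \<omega>) = translate v (\<sigma> t \<omega>)" if "0 \<le> t" for t
      by (rule trajectory_unique[OF _ f, where T = t]) (use elim that in \<open>auto simp: good_def\<close>)
    then show ?case by blast
  qed
qed

lemma law_translate:
  assumes "0 \<le> t" "A \<in> sets conf"
  shows "emeasure P_joint {\<omega>. translate v (\<sigma> t \<omega>) \<in> A} = emeasure P_joint {\<omega>. \<sigma> t \<omega> \<in> A}"
proof -
  let ?S = "{\<omega>. \<sigma> t \<omega> \<in> A}"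
  have S: "?S \<in> sets P_joint" by (rule sets_\<sigma>[OF assms])
  have sv: "translate v -` A \<in> sets conf"
    using measurable_sets[OF measurable_translate assms(2)] by simp
  have "emeasure P_joint ?S = emeasure (distr P_joint P_joint (joint_translate v)) ?S"
    by (simp add: distr_joint_translate)
  also have "\<dots> = emeasure P_joint (joint_translate v -` ?S \<inter> space P_joint)"
    by (rule emeasure_distr[OF measurable_joint_translate S])
  also have "\<dots> = emeasure P_joint {\<omega>. \<sigma> t \<omega> \<in> translate v -` A}"
  proof (rule emeasure_eq_AE)
    show "AE \<omega> in P_joint. \<omega> \<in> joint_translate v -` ?S \<inter> space P_joint \<longleftrightarrow> \<omega> \<in> {\<omega>. \<sigma> t \<omega> \<in> translate v -` A}"
      using AE_translate[of v] by eventually_elim (use assms(1) in auto)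
    show "joint_translate v -` ?S \<inter> space P_joint \<in> sets P_joint"
      by (rule measurable_sets[OF measurable_joint_translate S])
  qed (rule sets_\<sigma>[OF assms(1) sv])
  finally show ?thesis by simp
qed

text \<open>The graft at time \<open>t\<close> leaves all marks up to \<open>t\<close> unchanged, so
  uniqueness up to \<open>t\<close> makes the state at time \<open>t\<close> independent of the
  fresh clocks.\<close>

lemma AE_joint_graft:
  assumes "0 \<le> t"
  shows "AE p in P_joint \<Otimes>\<^sub>M P_dyn. good \<sigma> (fst p) \<and> regular (snd p) \<and> good \<sigma> (joint_graft t p) \<and>
    \<sigma> t (joint_graft t p) = \<sigma> t (fst p)"
proof -
  have "AE \<omega> in distr (P_joint \<Otimes>\<^sub>M P_dyn) P_joint (joint_graft t). good \<sigma> \<omega>"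
    unfolding distr_joint_graft[OF assms] by (rule AE_good)
  then have "AE p in P_joint \<Otimes>\<^sub>M P_dyn. good \<sigma> (joint_graft t p)"
    by (rule AE_distrD[OF measurable_joint_graft])
  with AE_pair_fst[OF prob_space_P_dyn AE_good] AE_pair_snd[OF prob_space_P_dyn AE_regular]
  show ?thesis
  proof eventually_elim
    case (elim p)
    let ?d = "snd (fst p)" and ?d' = "snd p"
    have p: "proper (?d x)" "proper (?d' x)" for x
      using elim regular_proper unfolding good_def by blast+
    have "{q \<in> marks (dgraft t ?d ?d' x). fst q \<le> t} = {q \<in> marks (?d x). fst q \<le> t}" for x
    proof -
      obtain k where k: "t < ring (?d x) k" using p(1)[of x] unfolding proper_def by blast
      have pos: "0 < fst (?d x n)" for n using p(1)[of x] unfolding proper_def by blast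
      have "\<not> fst q \<le> t" if "q \<in> (\<lambda>q. (t + fst q, snd q)) ` marks (?d' x)" for q
      proof -
        from that obtain n where "fst q = t + ring (?d' x) n" by (auto simp: marks_def)
        with ring_pos[OF p(2), of x n] show ?thesis by simp
      qed
      then show ?thesis
        unfolding dgraft_def marks_graft[OF pos k] by blast
    qed
    then have "\<sigma> t (joint_graft t p) = \<sigma> t (fst p)"
      using elim assms unfolding good_def
      by (intro trajectory_unique[where T = t and d = "dgraft t ?d ?d'" and d' = ?d and \<eta> = "fst (fst p)"
            and s = "\<lambda>u. \<sigma> u (joint_graft t p)" and s' = "\<lambda>u. \<sigma> u (fst p)"]) simp_all
    with elim show ?case by blast
  qed
qed

text \<open>Under the graft, the state at time \<open>t\<close> is read from the old clocks, while
  the events \<open>G x\<close> about rings after \<open>t\<close> become events \<open>G' x\<close>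
  about the fresh ones. The joint event thus becomes a rectangle of independent factors.\<close>

lemma markov:
  assumes t: "0 \<le> t" and A: "A \<in> sets conf" and J: "finite J"
    and G: "\<And>x. x \<in> J \<Longrightarrow> G x \<in> sets clk" "\<And>x. x \<in> J \<Longrightarrow> G' x \<in> sets clk"
    and eq: "\<And>x e e'. x \<in> J \<Longrightarrow> proper e \<Longrightarrow> proper e' \<Longrightarrow> proper (graft t e e') \<Longrightarrow>
      graft t e e' \<in> G x \<longleftrightarrow> e' \<in> G' x"
  shows "emeasure P_joint {\<omega>. \<sigma> t \<omega> \<in> A \<and> (\<forall>x\<in>J. snd \<omega> x \<in> G x)} =
    emeasure P_joint {\<omega>. \<sigma> t \<omega> \<in> A} * (\<Prod>x\<in>J. emeasure clk (G' x))"
proof -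
  let ?B = "{\<omega>. \<sigma> t \<omega> \<in> A \<and> (\<forall>x\<in>J. snd \<omega> x \<in> G x)}" and ?D = "{d. \<forall>x\<in>J. d x \<in> G' x}"
  have SA: "{\<omega>. \<sigma> t \<omega> \<in> A} \<in> sets P_joint" by (rule sets_\<sigma>[OF t A])
  have "{\<omega>. \<forall>x\<in>J. snd \<omega> x \<in> G x} \<in> sets P_joint"
    using measurable_sets[OF measurable_snd_joint sets_P_dyn_cylinder[OF J G(1)]] by (simp add: vimage_def)
  then have B: "?B \<in> sets P_joint" using sets.Int[OF SA] by (simp add: Collect_conj_eq)
  have D: "?D \<in> sets P_dyn" by (rule sets_P_dyn_cylinder[OF J G(2)])
  have "emeasure P_joint ?B = emeasure (distr (P_joint \<Otimes>\<^sub>M P_dyn) P_joint (joint_graft t)) ?B"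
    by (simp add: distr_joint_graft[OF t])
  also have "\<dots> = emeasure (P_joint \<Otimes>\<^sub>M P_dyn) (joint_graft t -` ?B \<inter> space (P_joint \<Otimes>\<^sub>M P_dyn))"
    by (rule emeasure_distr[OF measurable_joint_graft B])
  also have "\<dots> = emeasure (P_joint \<Otimes>\<^sub>M P_dyn) ({\<omega>. \<sigma> t \<omega> \<in> A} \<times> ?D)"
  proof (rule emeasure_eq_AE)
    show "AE p in P_joint \<Otimes>\<^sub>M P_dyn. p \<in> joint_graft t -` ?B \<inter> space (P_joint \<Otimes>\<^sub>M P_dyn) \<longleftrightarrow>
        p \<in> {\<omega>. \<sigma> t \<omega> \<in> A} \<times> ?D"
      using AE_joint_graft[OF t]
    proof eventually_elim
      case (elim p)
      have "graft t (snd (fst p) x) (snd p x) \<in> G x \<longleftrightarrow> snd p x \<in> G' x" if "x \<in> J" for x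
      proof (rule eq[OF that])
        have "regular (snd (fst p))" "regular (snd p)" "regular (dgraft t (snd (fst p)) (snd p))"
          using elim by (simp_all add: good_def)
        then show "proper (snd (fst p) x)" "proper (snd p x)" "proper (graft t (snd (fst p) x) (snd p x))"
          using regular_proper by (auto simp: dgraft_def[symmetric])
      qed
      then show ?case
        using elim by (cases p) (auto simp: space_pair_measure dgraft_def)
    qed
    show "joint_graft t -` ?B \<inter> space (P_joint \<Otimes>\<^sub>M P_dyn) \<in> sets (P_joint \<Otimes>\<^sub>M P_dyn)"
      by (rule measurable_sets[OF measurable_joint_graft B])
  qed (use SA D in auto)
  also have "\<dots> = emeasure P_joint {\<omega>. \<sigma> t \<omega> \<in> A} * emeasure P_dyn ?D"
    by (rule P_dyn.emeasure_pair_measure_Times[OF SA D])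
  also have "emeasure P_dyn ?D = (\<Prod>x\<in>J. emeasure clk (G' x))"
    by (rule emeasure_P_dyn_cylinder[OF J G(2)])
  finally show ?thesis .
qed

end

section \<open>Energy along a trajectory\<close>

lemma left_limit_eq:
  assumes "left_limit s r \<zeta>" "eventually (\<lambda>v. s v y = c) (at_left r)"
  shows "\<zeta> y = c"
proof -
  have "eventually (\<lambda>v. s v y = \<zeta> y) (at_left r)" using assms(1) unfolding left_limit_def by blast
  with assms(2) have "eventually (\<lambda>v. \<zeta> y = c) (at_left r)" by eventually_elim simp
  then show ?thesis by (simp add: eventually_const_iff)
qed

lemma follows_const:
  assumes "follows_dynamics \<eta> d s" "0 \<le> t" "t \<le> u" "quiet t u (d x)"
  shows "s u x = s t x"
  using assms(1-3) assms(4)[unfolded quiet_marks] unfolding follows_marks by blast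

lemma follows_update:
  assumes "follows_dynamics \<eta> d s" "p \<in> marks (d x)"
  obtains \<zeta> where "left_limit s (fst p) \<zeta>" "s (fst p) x = updated_spin \<zeta> x (snd p)"
  using assms unfolding follows_marks by blast

text \<open>No other site of \<open>B\<close> rings, so on \<open>B\<close> the left limit at the
  ring of \<open>x\<close> is still the state at time \<open>t\<close>. The coin is
  \<open>True\<close>, so two disagreeing neighbours suffice for a flip.\<close>

lemma single_update:
  assumes f: "follows_dynamics \<eta> d s" and reg: "regular d" and t: "0 \<le> t"
    and x: "x \<in> B" "nbrs x \<subseteq> B" and one: "one_ring t u (d x)"
    and q: "\<And>y. y \<in> B \<Longrightarrow> y \<noteq> x \<Longrightarrow> quiet t u (d y)"
  obtains r \<zeta> where "(r, True) \<in> marks (d x)" "t < r" "r \<le> u" "left_limit s r \<zeta>"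
    "disagreements \<zeta> x = disagreements (s t) x"
    "\<And>y. y \<in> B \<Longrightarrow> s u y = (if y = x \<and> 2 \<le> disagreements (s t) x then \<not> s t x else s t y)"
proof -
  from one obtain r where r: "{p \<in> marks (d x). t < fst p \<and> fst p \<le> u} = {(r, True)}"
    unfolding one_ring_marks[OF regular_proper[OF reg]] by blast
  have "(r, True) \<in> {p \<in> marks (d x). t < fst p \<and> fst p \<le> u}" unfolding r by simp
  then have rm: "(r, True) \<in> marks (d x)" "t < r" "r \<le> u" by simp_all
  from follows_update[OF f rm(1)] obtain \<zeta> where \<zeta>: "left_limit s r \<zeta>" "s r x = updated_spin \<zeta> x True" by auto
  have qv: "quiet t v (d y)" if "y \<in> B" "v < r" for y v
  proof (cases "y = x")
    case True
    have "p \<notin> marks (d x) \<or> \<not> (t < fst p \<and> fst p \<le> v)" for p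
    proof (rule ccontr)
      assume "\<not> ?thesis"
      then have "p \<in> {p \<in> marks (d x). t < fst p \<and> fst p \<le> u}" using that(2) rm(3) by auto
      then have "fst p = r" unfolding r by simp
      with \<open>\<not> ?thesis\<close> that(2) show False by auto
    qed
    then show ?thesis unfolding quiet_marks True by blast
  next
    case False
    then show ?thesis using q[OF that(1)] that(2) rm(3) unfolding quiet_def
      by (meson less_le_trans less_imp_le order_trans)
  qed
  have \<zeta>B: "\<zeta> y = s t y" if "y \<in> B" for y
  proof (rule left_limit_eq[OF \<zeta>(1)])
    have "eventually (\<lambda>v. v \<in> {t<..<r}) (at_left r)" by (rule eventually_at_left_real[OF rm(2)])
    then show "eventually (\<lambda>v. s v y = s t y) (at_left r)"
      by eventually_elim (rule follows_const[OF f t], use that qv in auto)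
  qed
  have dis: "disagreements \<zeta> x = disagreements (s t) x"
  proof -
    have "{y \<in> nbrs x. \<zeta> y \<noteq> \<zeta> x} = {y \<in> nbrs x. s t y \<noteq> s t x}" using \<zeta>B x by blast
    then show ?thesis by (simp add: disagreements_def)
  qed
  have "s u y = (if y = x \<and> 2 \<le> disagreements (s t) x then \<not> s t x else s t y)" if y: "y \<in> B" for y
  proof (cases "y = x")
    case False
    then show ?thesis using follows_const[OF f t _ q[OF y]] rm by simp
  next
    case True
    have "p \<notin> marks (d x) \<or> \<not> (r < fst p \<and> fst p \<le> u)" for p
    proof (rule ccontr)
      assume "\<not> ?thesis"
      then have "p \<in> {p \<in> marks (d x). t < fst p \<and> fst p \<le> u}" using rm(2) by auto
      then have "fst p = r" unfolding r by simp
      with \<open>\<not> ?thesis\<close> show False by auto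
    qed
    then have "quiet r u (d x)" unfolding quiet_marks by blast
    then have "s u x = s r x" using follows_const[OF f, of r u x] rm t by simp
    also have "\<dots> = (if 2 \<le> disagreements (s t) x then \<not> s t x else s t x)"
      unfolding \<zeta>(2) updated_spin_def dis using \<zeta>B[OF x(1)] by auto
    finally show ?thesis using True by simp
  qed
  with rm \<zeta>(1) dis show thesis by (rule that)
qed

text \<open>A site counts once, however many energy-lowering rings it has; the cardinality is a
  lower bound for the number of such rings, which is the direction needed.\<close>

definition drops :: "(real \<Rightarrow> config) \<Rightarrow> clocks \<Rightarrow> nat \<Rightarrow> real \<Rightarrow> real \<Rightarrow> site set" where
  "drops s d N t u = {x \<in> core N. \<exists>p\<in>marks (d x). t < fst p \<and> fst p \<le> u \<and>
     (\<exists>\<zeta>. left_limit s (fst p) \<zeta> \<and> 3 \<le> disagreements \<zeta> x)}"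

lemma finite_drops [simp]: "finite (drops s d N t u)"
  by (rule finite_subset[of _ "core N"]) (auto simp: drops_def)

lemma window_count_mono: "proper e \<Longrightarrow> v \<le> u \<Longrightarrow> window_count t v e \<le> window_count t u e"
  unfolding window_count_def by (rule card_mono) (auto intro: finite_window)

lemma window_count_less:
  assumes "proper e" "v < r" "t < r" "r \<le> u" "(r, c) \<in> marks e"
  shows "window_count t v e < window_count t u e"
  unfolding window_count_def
proof (rule psubset_card_mono)
  obtain n where "r = ring e n" using assms(5) by (auto simp: marks_ring)
  then have "n \<in> {n. t < ring e n \<and> ring e n \<le> u}" "n \<notin> {n. t < ring e n \<and> ring e n \<le> v}" using assms by auto
  moreover have "{n. t < ring e n \<and> ring e n \<le> v} \<subseteq> {n. t < ring e n \<and> ring e n \<le> u}" using assms by auto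
  ultimately show "{n. t < ring e n \<and> ring e n \<le> v} \<subset> {n. t < ring e n \<and> ring e n \<le> u}" by blast
qed (rule finite_window[OF assms(1)])

text \<open>Flips in the core do not raise the energy of the box, and each flip with at least three disagreeing
  neighbours lowers it by at least \<open>2\<close>; a ring on the boundary of the box raises it by at most \<open>4\<close>.\<close>

lemma energy_window:
  assumes f: "follows_dynamics \<eta> d s" and reg: "regular d" and t: "0 \<le> t" and tu: "t \<le> u"
  shows "energy N (s u) + 2 * card (drops s d N t u) \<le>
    energy N (s t) + 4 * (\<Sum>x\<in>Q N - core N. window_count t u (d x))"
  using tu
\<comment> \<open>The induction is on the number of rings in the box, and the last ring is peeled
  off in each step.\<close>
proof (induction "\<Sum>x\<in>Q N. window_count t u (d x)" arbitrary: u rule: less_induct)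
  case less
  note proper = regular_proper[OF reg]
  define R where "R = (\<Union>x\<in>Q N. ring (d x) ` {n. t < ring (d x) n \<and> ring (d x) n \<le> u})"
  have RI: "fst p \<in> R" if "x \<in> Q N" "p \<in> marks (d x)" "t < fst p" "fst p \<le> u" for x p
    using that unfolding R_def marks_def by force
  have finR: "finite R" unfolding R_def by (auto simp: finite_window proper)
  show ?case
  proof (cases "R = {}")
    case True
    have qt: "quiet t u (d x)" if "x \<in> Q N" for x
      using RI[OF that] True unfolding quiet_marks by blast
    then have "energy N (s u) = energy N (s t)"
      by (intro energy_cong follows_const[OF f t less.prems])
    moreover have "drops s d N t u = {}"
      using qt core_subset_Q[of N] unfolding drops_def quiet_marks by blast
    ultimately show ?thesis by simp
  next
    case False
    define r where "r = Max R"
    have "r \<in> R" unfolding r_def using finR False by (rule Max_in)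
    then obtain x n where x: "x \<in> Q N" and rn: "r = ring (d x) n" "t < r" "r \<le> u" by (auto simp: R_def)
    define c where "c = snd (d x n)"
    have rc: "(r, c) \<in> marks (d x)" by (auto simp: c_def rn(1) marks_def)
    have only_x: "y = x" if p: "p \<in> marks (d y)" "fst p = r" for y p
    proof (rule ccontr)
      assume "y \<noteq> x"
      obtain m where "fst p = ring (d y) m" using p(1) by (auto simp: marks_def)
      with p(2) rn have "ring (d y) m = ring (d x) n" by simp
      with \<open>y \<noteq> x\<close> reg show False unfolding regular_def by blast
    qed
    from follows_update[OF f rc] obtain \<zeta> where \<zeta>: "left_limit s r \<zeta>" "s r x = updated_spin \<zeta> x c" by auto
    have "eventually (\<lambda>v. \<forall>y\<in>Q N. s v y = \<zeta> y) (at_left r)"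
      using \<zeta>(1) unfolding left_limit_def by (intro eventually_ball_finite) auto
    \<comment> \<open>The time \<open>v\<close> is taken just before the last ring time
      \<open>r\<close>: after \<open>t\<close> and all other rings of the box, and so late that the
      box already shows the left limit \<open>\<zeta>\<close>.\<close>
    moreover have "eventually (\<lambda>v. v \<in> {Max (insert t (R - {r}))<..<r}) (at_left r)"
    proof (rule eventually_at_left_real)
      have "z < r" if "z \<in> insert t (R - {r})" for z
        using that Max_ge[OF finR, of z] rn(2) unfolding r_def[symmetric] by auto
      then show "Max (insert t (R - {r})) < r" using finR by simp
    qed
    ultimately have "eventually (\<lambda>v. (\<forall>y\<in>Q N. s v y = \<zeta> y) \<and> v \<in> {Max (insert t (R - {r}))<..<r}) (at_left r)"
      by eventually_elim blast
    then have "\<exists>v. (\<forall>y\<in>Q N. s v y = \<zeta> y) \<and> v \<in> {Max (insert t (R - {r}))<..<r}"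
      by (rule eventually_happens'[OF trivial_limit_at_left_real])
    then obtain v where v: "\<And>y. y \<in> Q N \<Longrightarrow> s v y = \<zeta> y" "Max (insert t (R - {r})) < v" "v < r"
      by auto
    have below: "z < v" if "z \<in> insert t (R - {r})" for z
      using Max_ge[of "insert t (R - {r})" z] that finR v(2) by auto
    have tv: "t < v" using below by simp
    have vR: "fst p \<le> v \<or> fst p = r" if "y \<in> Q N" "p \<in> marks (d y)" "t < fst p" "fst p \<le> u" for y p
      using below[of "fst p"] RI[OF that] by auto
    have vu: "v \<le> u" using v(3) rn(3) by simp
    have wm: "window_count t v (d y) \<le> window_count t u (d y)" for y
      by (rule window_count_mono[OF proper vu])
    have wl: "window_count t v (d x) < window_count t u (d x)"
      by (rule window_count_less[OF proper v(3) rn(2,3) rc])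
    have "(\<Sum>x\<in>Q N. window_count t v (d x)) < (\<Sum>x\<in>Q N. window_count t u (d x))"
      by (rule sum_strict_mono_ex1) (use wm wl x in auto)
    from less.hyps[OF this] tv
    have IH: "energy N (s v) + 2 * card (drops s d N t v) \<le>
      energy N (s t) + 4 * (\<Sum>x\<in>Q N - core N. window_count t v (d x))" by simp
    have ev: "energy N (s v) = energy N \<zeta>" by (rule energy_cong) (rule v(1))
    have su: "s u y = (if y = x then updated_spin \<zeta> x c else \<zeta> y)" if y: "y \<in> Q N" for y
    proof (cases "y = x")
      case True
      have "quiet r u (d x)"
        unfolding quiet_marks using vR[OF x] rn(2) v(3) by fastforce
      then show ?thesis using follows_const[OF f, of r u x] \<zeta>(2) rn t True by simp
    next
      case False
      have "quiet v u (d y)"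
        unfolding quiet_marks using vR[OF y] only_x[of _ y] False tv by fastforce
      then show ?thesis using follows_const[OF f, of v u y] v(1)[OF y] tv vu t False by simp
    qed
    have drops_sub: "y = x \<or> y \<in> drops s d N t v" if "y \<in> drops s d N t u" for y
    proof -
      from that obtain p \<xi> where p: "y \<in> core N" "p \<in> marks (d y)" "t < fst p" "fst p \<le> u"
        "left_limit s (fst p) \<xi>" "3 \<le> disagreements \<xi> y" unfolding drops_def by blast
      from vR[OF subsetD[OF core_subset_Q p(1)] p(2-4)] show ?thesis
      proof
        assume "fst p \<le> v"
        with p show ?thesis unfolding drops_def by blast
      next
        assume "fst p = r"
        with only_x[OF p(2)] show ?thesis by blast
      qed
    qed
    have x_drop: "x \<in> drops s d N t v \<or> 3 \<le> disagreements \<zeta> x" if "x \<in> drops s d N t u"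
    proof -
      from that obtain p \<xi> where p: "x \<in> core N" "p \<in> marks (d x)" "t < fst p" "fst p \<le> u"
        "left_limit s (fst p) \<xi>" "3 \<le> disagreements \<xi> x" unfolding drops_def by blast
      from vR[OF x p(2-4)] show ?thesis
      proof
        assume "fst p \<le> v"
        with p show ?thesis unfolding drops_def by blast
      next
        assume "fst p = r"
        with p(5) have "\<xi> y = \<zeta> y" for y
          using left_limit_eq[OF p(5), of y "\<zeta> y"] \<zeta>(1) unfolding left_limit_def by simp
        then have "\<xi> = \<zeta>" by (rule ext)
        with p(6) show ?thesis by simp
      qed
    qed
    have bd: "(\<Sum>x\<in>Q N - core N. window_count t v (d x)) \<le> (\<Sum>x\<in>Q N - core N. window_count t u (d x))"
      by (intro sum_mono wm)
    have eu: "energy N (s u) = energy N (if updated_spin \<zeta> x c = \<zeta> x then \<zeta> else flip \<zeta> x)"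
      by (rule energy_cong) (auto simp: su flip_apply)
    show ?thesis
    proof (cases "x \<in> core N \<and> 3 \<le> disagreements \<zeta> x")
      case True
      then have "updated_spin \<zeta> x c \<noteq> \<zeta> x" by (simp add: updated_spin_def)
      with eu have "energy N (s u) = energy N (flip \<zeta> x)" by simp
      moreover have "energy N (flip \<zeta> x) + 2 * disagreements \<zeta> x = energy N \<zeta> + 4"
        using True by (intro energy_flip_core) auto
      ultimately have 1: "energy N (s u) + 2 \<le> energy N \<zeta>" using True by linarith
      have "card (drops s d N t u) \<le> card (insert x (drops s d N t v))"
        using drops_sub by (intro card_mono) auto
      also have "\<dots> \<le> card (drops s d N t v) + 1" by (simp add: card_insert_if)
      finally show ?thesis using 1 IH bd ev by linarith
    next
      case False
      have "drops s d N t u \<subseteq> drops s d N t v"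
      proof
        fix y assume y: "y \<in> drops s d N t u"
        show "y \<in> drops s d N t v"
        proof (cases "y = x")
          case True
          then have "x \<in> core N" using y by (simp add: drops_def)
          then show ?thesis using x_drop y False True by blast
        qed (use drops_sub[OF y] in blast)
      qed
      then have dr: "card (drops s d N t u) \<le> card (drops s d N t v)" by (intro card_mono) auto
      show ?thesis
      proof (cases "x \<in> core N")
        case True
        have "energy N (s u) \<le> energy N \<zeta>"
        proof (cases "updated_spin \<zeta> x c = \<zeta> x")
          case True
          then show ?thesis using eu by simp
        next
          case ne: False
          then have "2 \<le> disagreements \<zeta> x" by (auto simp: updated_spin_def split: if_splits)
          then show ?thesis using eu ne energy_flip_core[OF True, of \<zeta>] by simp
        qed
        then show ?thesis using dr IH bd ev by linarith
      next
        case nc: False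
        have "energy N (s u) \<le> energy N \<zeta> + 4"
          using eu energy_flip_le[of N \<zeta> x] by (simp split: if_splits)
        moreover have "(\<Sum>x\<in>Q N - core N. window_count t v (d x)) < (\<Sum>x\<in>Q N - core N. window_count t u (d x))"
          by (rule sum_strict_mono_ex1) (use wm wl x nc in auto)
        ultimately show ?thesis using dr IH ev by linarith
      qed
    qed
  qed
qed

section \<open>Extension to an absorbing configuration\<close>

lemma absorbing_iff: "\<sigma> \<in> absorbing \<longleftrightarrow> (\<forall>x. disagreements \<sigma> x \<le> 1)"
proof -
  have "card {y \<in> nbrs x. \<sigma> y = \<sigma> x} + disagreements \<sigma> x = 4" for x
  proof -
    have "nbrs x = {y \<in> nbrs x. \<sigma> y = \<sigma> x} \<union> {y \<in> nbrs x. \<sigma> y \<noteq> \<sigma> x}" by auto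
    then have "card (nbrs x) = card {y \<in> nbrs x. \<sigma> y = \<sigma> x} + card {y \<in> nbrs x. \<sigma> y \<noteq> \<sigma> x}"
      by (subst card_Un_disjoint[symmetric]) auto
    moreover have "card (nbrs x) = 4" by (cases x) (simp add: nbrs_eq)
    ultimately show ?thesis by (simp add: disagreements_def)
  qed
  then have "3 \<le> card {y \<in> nbrs x. \<sigma> y = \<sigma> x} \<longleftrightarrow> disagreements \<sigma> x \<le> 1" for x
    proof -
    have "card {y \<in> nbrs x. \<sigma> y = \<sigma> x} + disagreements \<sigma> x = 4" by fact
    then show ?thesis by presburger
  qed
  then show ?thesis by (simp add: absorbing_def)
qed

lemma Q_iff [simp]: "(a, b) \<in> Q L \<longleftrightarrow> \<bar>a\<bar> \<le> int L \<and> \<bar>b\<bar> \<le> int L"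
  by (auto simp: Q_def)

lemma swap_Q [simp]: "prod.swap x \<in> Q L \<longleftrightarrow> x \<in> Q L"
  by (cases x) auto

text \<open>The two sites beside a vertical wall use up their one allowed disagreement on each
  other. Their upper and lower neighbours must agree with them, so the wall continues straight
  across the box.\<close>

lemma wall_extends:
  assumes st: "\<And>x. x \<in> Q L \<Longrightarrow> disagreements \<sigma> x \<le> 1"
    and ab: "(a, b) \<in> Q L" "(a + 1, b) \<in> Q L" "\<sigma> (a, b) \<noteq> \<sigma> (a + 1, b)" and y: "\<bar>y\<bar> \<le> int L"
  shows "\<sigma> (a, y) = \<sigma> (a, b) \<and> \<sigma> (a + 1, y) = \<sigma> (a + 1, b)"
proof -
  have up: "\<sigma> (a, z + 1) = \<sigma> (a, z)" "\<sigma> (a + 1, z + 1) = \<sigma> (a + 1, z)"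
    "\<sigma> (a, z - 1) = \<sigma> (a, z)" "\<sigma> (a + 1, z - 1) = \<sigma> (a + 1, z)"
    if "\<bar>z\<bar> \<le> int L" "\<sigma> (a, z) \<noteq> \<sigma> (a + 1, z)" for z
  proof -
    have "(a, z) \<in> Q L" "(a + 1, z) \<in> Q L" using that(1) ab(1,2) by simp_all
    from this[THEN st] have "disagreements \<sigma> (a, z) \<le> 1" "disagreements \<sigma> (a + 1, z) \<le> 1" .
    then show "\<sigma> (a, z + 1) = \<sigma> (a, z)" "\<sigma> (a + 1, z + 1) = \<sigma> (a + 1, z)"
      "\<sigma> (a, z - 1) = \<sigma> (a, z)" "\<sigma> (a + 1, z - 1) = \<sigma> (a + 1, z)"
      using that(2) unfolding disagreements_eq by (auto split: if_splits simp: of_bool_def)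
  qed
  let ?P = "\<lambda>y. \<sigma> (a, y) = \<sigma> (a, b) \<and> \<sigma> (a + 1, y) = \<sigma> (a + 1, b)"
  have "b \<le> y \<Longrightarrow> y \<le> int L \<longrightarrow> ?P y"
  proof (induction y rule: int_ge_induct)
    case (step i)
    show ?case
    proof
      assume "i + 1 \<le> int L"
      with step ab have "?P i" "\<bar>i\<bar> \<le> int L" by auto
      then show "?P (i + 1)" using up(1,2)[of i] ab(3) by metis
    qed
  qed simp
  moreover have "y \<le> b \<Longrightarrow> - int L \<le> y \<longrightarrow> ?P y"
  proof (induction y rule: int_le_induct)
    case (step i)
    show ?case
    proof
      assume "- int L \<le> i - 1"
      with step ab have "?P i" "\<bar>i\<bar> \<le> int L" by auto
      then show "?P (i - 1)" using up(3,4)[of i] ab(3) by metis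
    qed
  qed simp
  ultimately show ?thesis using y by (meson abs_le_D1 abs_le_D2 linear minus_le_iff)
qed

text \<open>Spins are constant along columns of the box, so the pattern extends to all rows, and the
  two outermost columns are repeated outwards by clamping the first coordinate. A clamped site
  agrees with its outer neighbour and so has at most one disagreement.\<close>

lemma vertical_extension:
  assumes st: "\<And>x. x \<in> Q L \<Longrightarrow> disagreements \<sigma> x \<le> 1"
    and no: "\<And>a b. (a, b) \<in> Q L \<Longrightarrow> (a, b + 1) \<in> Q L \<Longrightarrow> \<sigma> (a, b) = \<sigma> (a, b + 1)"
  obtains \<tau> where "\<tau> \<in> absorbing" "\<And>x. x \<in> Q L \<Longrightarrow> \<tau> x = \<sigma> x"
proof -
  define c where "c a = max (- int L) (min (int L) a)" for a
  define \<tau> where "\<tau> x = \<sigma> (c (fst x), 0)" for x :: site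
  have c_in: "\<bar>a\<bar> \<le> int L \<Longrightarrow> c a = a" for a by (auto simp: c_def)
  have col: "\<sigma> (a, b) = \<sigma> (a, 0)" if "\<bar>a\<bar> \<le> int L" "\<bar>b\<bar> \<le> int L" for a b
  proof (cases "0 \<le> b")
    case True
    have "\<sigma> (a, 0) = \<sigma> (a, b)"
      by (rule constant_on_interval[OF True, of "\<lambda>b. \<sigma> (a, b)"], rule no) (use that in auto)
    then show ?thesis by simp
  next
    case False
    show ?thesis
      by (rule constant_on_interval[of b 0 "\<lambda>b. \<sigma> (a, b)"]) (use False that in \<open>auto intro!: no\<close>)
  qed
  have "disagreements \<tau> (a, b) \<le> 1" for a b
  proof -
    consider "int L \<le> a" | "a \<le> - int L" | "\<bar>a\<bar> < int L" by linarith
    then have "\<tau> (a + 1, b) = \<tau> (a, b) \<or> \<tau> (a - 1, b) = \<tau> (a, b)"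
    proof cases
      case 1
      then have "c (a + 1) = c a" by (simp add: c_def)
      then show ?thesis by (simp add: \<tau>_def)
    next
      case 2
      then have "c (a - 1) = c a" by (simp add: c_def)
      then show ?thesis by (simp add: \<tau>_def)
    next
      case 3
      have "disagreements \<sigma> (a, 0) \<le> 1" using 3 by (intro st) auto
      then have "\<sigma> (a + 1, 0) = \<sigma> (a, 0) \<or> \<sigma> (a - 1, 0) = \<sigma> (a, 0)"
        unfolding disagreements_eq by auto
      moreover have "c (a + 1) = a + 1" "c a = a" "c (a - 1) = a - 1" using 3 by (auto intro!: c_in)
      ultimately show ?thesis by (simp add: \<tau>_def)
    qed
    moreover have "\<tau> (a, b + 1) = \<tau> (a, b)" "\<tau> (a, b - 1) = \<tau> (a, b)" by (simp_all add: \<tau>_def)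
    ultimately show ?thesis unfolding disagreements_eq by auto
  qed
  then have "\<tau> \<in> absorbing" unfolding absorbing_iff by (metis surj_pair)
  moreover have "\<tau> x = \<sigma> x" if "x \<in> Q L" for x
    using that col[of "fst x" "snd x"] by (cases x) (simp add: \<tau>_def c_in)
  ultimately show thesis by (rule that)
qed

text \<open>A vertical and a horizontal wall cannot both occur: extended across the box they would
  cross, and each makes the spins constant along its own direction. Up to exchange of coordinates,
  the pattern therefore has only vertical walls.\<close>

lemma stable_local_ext:
  assumes st: "\<And>x. x \<in> Q L \<Longrightarrow> disagreements \<sigma> x \<le> 1"
  shows "\<sigma> \<in> local_ext L absorbing"
proof -
  have st': "disagreements (\<sigma> \<circ> prod.swap) x \<le> 1" if "x \<in> Q L" for x
    using st[of "prod.swap x"] that by (simp only: disagreements_sym[OF lattice_sym_swap] swap_Q)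
  have "\<exists>\<tau>\<in>absorbing. \<forall>x\<in>Q L. \<tau> x = \<sigma> x"
  proof (cases "\<forall>a b. (a, b) \<in> Q L \<longrightarrow> (a, b + 1) \<in> Q L \<longrightarrow> \<sigma> (a, b) = \<sigma> (a, b + 1)")
    case True
    obtain \<tau> where "\<tau> \<in> absorbing" "\<And>x. x \<in> Q L \<Longrightarrow> \<tau> x = \<sigma> x"
      by (rule vertical_extension[of L \<sigma>]) (use st True in blast)+
    then show ?thesis by blast
  next
    case False
    then obtain a b where ab: "(a, b) \<in> Q L" "(a, b + 1) \<in> Q L" "\<sigma> (a, b) \<noteq> \<sigma> (a, b + 1)" by blast
    have no: "\<sigma> (x, y) = \<sigma> (x + 1, y)" if xy: "(x, y) \<in> Q L" "(x + 1, y) \<in> Q L" for x y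
    proof (rule ccontr)
      assume ne: "\<sigma> (x, y) \<noteq> \<sigma> (x + 1, y)"
      have "\<bar>b\<bar> \<le> int L" "\<bar>b + 1\<bar> \<le> int L" "\<bar>x\<bar> \<le> int L" using ab xy by auto
      then have 1: "\<sigma> (x, b) = \<sigma> (x, b + 1)"
        using wall_extends[OF st xy ne, of b] wall_extends[OF st xy ne, of "b + 1"] by simp
      have "(\<sigma> \<circ> prod.swap) (b, x) = (\<sigma> \<circ> prod.swap) (b, a) \<and> (\<sigma> \<circ> prod.swap) (b + 1, x) = (\<sigma> \<circ> prod.swap) (b + 1, a)"
        by (rule wall_extends[OF st']) (use ab \<open>\<bar>x\<bar> \<le> int L\<close> in auto)
      with 1 ab(3) show False by auto
    qed
    obtain \<tau> where \<tau>: "\<tau> \<in> absorbing" "\<And>x. x \<in> Q L \<Longrightarrow> \<tau> x = (\<sigma> \<circ> prod.swap) x"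
      by (rule vertical_extension[OF st']) (use no in auto)
    have "\<tau> \<circ> prod.swap \<in> absorbing"
      using \<tau>(1) unfolding absorbing_iff disagreements_sym[OF lattice_sym_swap] by blast
    moreover have "(\<tau> \<circ> prod.swap) x = \<sigma> x" if "x \<in> Q L" for x
      using \<tau>(2)[of "prod.swap x"] that by simp
    ultimately show ?thesis by blast
  qed
  then obtain \<tau> where "\<tau> \<in> absorbing" "\<forall>x\<in>Q L. \<tau> x = \<sigma> x" by blast
  then show ?thesis
    unfolding local_ext_def by (auto intro!: bexI[of _ \<tau>] simp: restrict_def fun_eq_iff)
qed

section \<open>Convergence\<close>

definition cyl :: "site set \<Rightarrow> config \<Rightarrow> config set" where
  "cyl B \<zeta> = {\<tau>. \<forall>x\<in>B. \<tau> x = \<zeta> x}"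

lemma sets_cyl: "finite B \<Longrightarrow> cyl B \<zeta> \<in> sets conf"
proof -
  assume B: "finite B"
  show ?thesis
    unfolding cyl_def
  proof (rule sets_Collect_UNIV)
    show "Measurable.pred conf (\<lambda>\<tau>. \<forall>x\<in>B. \<tau> x = \<zeta> x)"
      by (rule pred_intros_finite[OF B]) measurable
  qed simp
qed

text \<open>A pattern on \<open>B\<close> is coded by the set of its plus sites, so a finite
  \<open>B\<close> gives a finite union of cylinders.\<close>

lemma local_event_cyl:
  assumes "\<And>\<tau> \<tau>'. (\<And>x. x \<in> B \<Longrightarrow> \<tau> x = \<tau>' x) \<Longrightarrow> P \<tau> \<Longrightarrow> P \<tau>'"
  shows "{\<tau>. P \<tau>} = (\<Union>S\<in>{S \<in> Pow B. P (\<lambda>x. x \<in> S)}. cyl B (\<lambda>x. x \<in> S))"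
proof (intro set_eqI iffI)
  fix \<tau> assume "\<tau> \<in> {\<tau>. P \<tau>}"
  then have P: "P \<tau>" by simp
  let ?S = "{x \<in> B. \<tau> x}"
  have "\<tau> x \<longleftrightarrow> x \<in> ?S" if "x \<in> B" for x using that by simp
  from assms[OF this P] have "P (\<lambda>x. x \<in> ?S)" .
  then have "?S \<in> {S \<in> Pow B. P (\<lambda>x. x \<in> S)}" by simp
  moreover have "\<tau> \<in> cyl B (\<lambda>x. x \<in> ?S)" by (simp add: cyl_def)
  ultimately show "\<tau> \<in> (\<Union>S\<in>{S \<in> Pow B. P (\<lambda>x. x \<in> S)}. cyl B (\<lambda>x. x \<in> S))" by (rule UN_I)
next
  fix \<tau> assume "\<tau> \<in> (\<Union>S\<in>{S \<in> Pow B. P (\<lambda>x. x \<in> S)}. cyl B (\<lambda>x. x \<in> S))"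
  then obtain S where "S \<in> {S \<in> Pow B. P (\<lambda>x. x \<in> S)}" "\<tau> \<in> cyl B (\<lambda>x. x \<in> S)" by (rule UN_E)
  then have S: "P (\<lambda>x. x \<in> S)" "\<tau> \<in> cyl B (\<lambda>x. x \<in> S)" by simp_all
  have "x \<in> S \<longleftrightarrow> \<tau> x" if "x \<in> B" for x using S(2) that unfolding cyl_def by blast
  from assms[OF this S(1)] have "P \<tau>" .
  then show "\<tau> \<in> {\<tau>. P \<tau>}" by simp
qed

lemma sets_local_event:
  assumes "finite B" "\<And>\<tau> \<tau>'. (\<And>x. x \<in> B \<Longrightarrow> \<tau> x = \<tau>' x) \<Longrightarrow> P \<tau> \<Longrightarrow> P \<tau>'"
  shows "{\<tau>. P \<tau>} \<in> sets conf"
proof -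
  have "{\<tau>. P \<tau>} = (\<Union>S\<in>{S \<in> Pow B. P (\<lambda>x. x \<in> S)}. cyl B (\<lambda>x. x \<in> S))"
    by (rule local_event_cyl) (rule assms(2))
  also have "\<dots> \<in> sets conf"
    by (rule sets.finite_UN) (use assms(1) sets_cyl in auto)
  finally show ?thesis .
qed

lemma disagreements_cong:
  assumes "\<And>y. y \<in> insert x (nbrs x) \<Longrightarrow> \<tau> y = \<tau>' y"
  shows "disagreements \<tau> x = disagreements \<tau>' x"
proof -
  have "{y \<in> nbrs x. \<tau> y \<noteq> \<tau> x} = {y \<in> nbrs x. \<tau>' y \<noteq> \<tau>' x}" using assms by auto
  then show ?thesis by (simp add: disagreements_def)
qed

lemma core_nbrs_Q: "x \<in> core M \<Longrightarrow> y \<in> insert x (nbrs x) \<Longrightarrow> y \<in> Q M"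
  using core_subset_Q[of M] nbrs_core_subset_Q[of x M] by blast

lemma bad_cong:
  assumes "bad M \<tau>" "\<And>x. x \<in> Q M \<Longrightarrow> \<tau> x = \<tau>' x"
  shows "bad M \<tau>'"
  using assms
proof (induction arbitrary: \<tau>')
  case (lower x \<tau>)
  have "disagreements \<tau> x = disagreements \<tau>' x"
    by (rule disagreements_cong, rule lower.prems, rule core_nbrs_Q[OF lower.hyps(1)])
  with lower.hyps(2) have "3 \<le> disagreements \<tau>' x" by simp
  with lower.hyps(1) show ?case by (rule bad.lower)
next
  case (step x \<tau>)
  have "disagreements \<tau> x = disagreements \<tau>' x"
    by (rule disagreements_cong, rule step.prems, rule core_nbrs_Q[OF step.hyps(1)])
  with step.hyps(2) have "2 \<le> disagreements \<tau>' x" by simp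
  moreover have "bad M (flip \<tau>' x)"
  proof (rule step.IH)
    fix y assume "y \<in> Q M"
    moreover have "x \<in> Q M" using step.hyps(1) core_subset_Q by blast
    ultimately show "flip \<tau> x y = flip \<tau>' x y"
      using step.prems[of x] step.prems[of y] by (simp add: flip_apply)
  qed
  ultimately show ?case by (rule bad.step[OF step.hyps(1)])
qed

lemma sets_disagreements: "{\<tau>. 2 \<le> disagreements \<tau> x} \<in> sets conf"
proof (rule sets_local_event[of "insert x (nbrs x)"])
  fix \<tau> \<tau>' :: config
  assume *: "\<And>y. y \<in> insert x (nbrs x) \<Longrightarrow> \<tau> y = \<tau>' y" "2 \<le> disagreements \<tau> x"
  from disagreements_cong[of x \<tau> \<tau>', OF *(1)] *(2) show "2 \<le> disagreements \<tau>' x" by simp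
qed simp

lemma sets_bad: "{\<tau>. bad M \<tau>} \<in> sets conf"
  by (rule sets_local_event[of "Q M"], simp) (rule bad_cong)

lemma sets_local_ext: "{\<tau>. \<tau> \<in> local_ext L U} \<in> sets conf"
proof (rule sets_local_event[of "Q L"])
  fix \<tau> \<tau>' :: config
  assume *: "\<And>x. x \<in> Q L \<Longrightarrow> \<tau> x = \<tau>' x" "\<tau> \<in> local_ext L U"
  have "restrict \<tau> (Q L) = restrict \<tau>' (Q L)" by (rule restrict_ext) (rule *(1))
  with *(2) show "\<tau>' \<in> local_ext L U" by (simp add: local_ext_def)
qed simp

lemma sets_differ: "{\<tau>. \<tau> x \<noteq> \<tau> y} \<in> sets conf"
  by (rule sets_local_event[of "{x, y}"]) auto

section \<open>Mean energy of a box\<close>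

lemma card_Q: "card (Q N) = (2 * N + 1) * (2 * N + 1)"
  by (simp add: Q_def card_cartesian_product nat_add_distrib nat_mult_distrib)

lemma card_core: "card (core (Suc N)) = (2 * N + 1) * (2 * N + 1)"
  by (simp only: core_Suc card_Q)

lemma card_boundary: "card (Q (Suc N) - core (Suc N)) = 8 * Suc N"
proof -
  have "card (Q (Suc N) - core (Suc N)) = card (Q (Suc N)) - card (core (Suc N))"
    by (rule card_Diff_subset[OF finite_core core_subset_Q])
  then show ?thesis unfolding card_core card_Q by (simp add: algebra_simps)
qed

lemma nn_integral_site:
  assumes f: "f \<in> borel_measurable clk"
  shows "(\<integral>\<^sup>+ \<omega>. f (snd \<omega> x) \<partial>P_joint) = (\<integral>\<^sup>+ e. f e \<partial>clk)"
proof -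
  note [measurable] = f
  have "(\<integral>\<^sup>+ \<omega>. f (snd \<omega> x) \<partial>P_joint) = (\<integral>\<^sup>+ \<eta>. \<integral>\<^sup>+ d. f (d x) \<partial>P_dyn \<partial>\<mu>0)"
    unfolding P_joint_def by (subst P_dyn.nn_integral_fst[symmetric]) auto
  also have "\<dots> = (\<integral>\<^sup>+ d. f (d x) \<partial>P_dyn)"
    using \<mu>0.emeasure_space_1 by simp
  also have "\<dots> = (\<integral>\<^sup>+ e. f e \<partial>clk)"
    using nn_integral_prod_sites[of "{x}" "\<lambda>_. f"] f by simp
  finally show ?thesis .
qed

context ising
begin

definition pr :: "config set \<Rightarrow> real \<Rightarrow> real" where
  "pr A t = measure P_joint {\<omega>. \<sigma> t \<omega> \<in> A}"

lemma emeasure_pr: "emeasure P_joint {\<omega>. \<sigma> t \<omega> \<in> A} = ennreal (pr A t)"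
  by (simp add: pr_def P_joint.emeasure_eq_measure)

lemma pr_nonneg [simp]: "0 \<le> pr A t" and pr_le_1: "pr A t \<le> 1"
  by (simp_all add: pr_def)

lemma pr_translate: "0 \<le> t \<Longrightarrow> A \<in> sets conf \<Longrightarrow> pr {\<tau>. translate v \<tau> \<in> A} t = pr A t"
  using law_translate[of t A v] by (simp add: emeasure_pr[of t A] emeasure_pr[of t "{\<tau>. translate v \<tau> \<in> A}", simplified])

text \<open>The expected number of walls per site. Only translation invariance is used, so the two
  directions enter separately.\<close>

definition wall_density :: "real \<Rightarrow> real" where
  "wall_density t = pr {\<tau>. \<tau> (0, 0) \<noteq> \<tau> (0, 1)} t + pr {\<tau>. \<tau> (0, 0) \<noteq> \<tau> (1, 0)} t"

lemma nn_integral_card: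
  assumes t: "0 \<le> t" and D: "finite D" and p: "\<And>z. z \<in> D \<Longrightarrow> {\<tau>. p \<tau> z} \<in> sets conf"
    and c: "\<And>z. z \<in> D \<Longrightarrow> pr {\<tau>. p \<tau> z} t = c" and c0: "0 \<le> c"
  shows "(\<integral>\<^sup>+ \<omega>. ennreal (real (card {z \<in> D. p (\<sigma> t \<omega>) z})) \<partial>P_joint) = ennreal (real (card D) * c)"
proof -
  have "ennreal (real (card {z \<in> D. p (\<sigma> t \<omega>) z})) = (\<Sum>z\<in>D. indicator {\<omega>. \<sigma> t \<omega> \<in> {\<tau>. p \<tau> z}} \<omega>)" for \<omega>
    using D by (simp add: indicator_def sum.If_cases Int_def ennreal_of_nat_eq_real_of_nat)
  then have "(\<integral>\<^sup>+ \<omega>. ennreal (real (card {z \<in> D. p (\<sigma> t \<omega>) z})) \<partial>P_joint) =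
      (\<integral>\<^sup>+ \<omega>. (\<Sum>z\<in>D. indicator {\<omega>. \<sigma> t \<omega> \<in> {\<tau>. p \<tau> z}} \<omega>) \<partial>P_joint)" by simp
  also have "\<dots> = (\<Sum>z\<in>D. \<integral>\<^sup>+ \<omega>. indicator {\<omega>. \<sigma> t \<omega> \<in> {\<tau>. p \<tau> z}} \<omega> \<partial>P_joint)"
    by (rule nn_integral_sum) (intro borel_measurable_indicator sets_\<sigma>[OF t] p)
  also have "\<dots> = (\<Sum>z\<in>D. ennreal c)"
  proof (rule sum.cong[OF refl])
    fix z assume z: "z \<in> D"
    have "(\<integral>\<^sup>+ \<omega>. indicator {\<omega>. \<sigma> t \<omega> \<in> {\<tau>. p \<tau> z}} \<omega> \<partial>P_joint) = emeasure P_joint {\<omega>. \<sigma> t \<omega> \<in> {\<tau>. p \<tau> z}}"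
      by (rule nn_integral_indicator[OF sets_\<sigma>[OF t p[OF z]]])
    also have "\<dots> = ennreal c" unfolding emeasure_pr c[OF z] ..
    finally show "(\<integral>\<^sup>+ \<omega>. indicator {\<omega>. \<sigma> t \<omega> \<in> {\<tau>. p \<tau> z}} \<omega> \<partial>P_joint) = ennreal c" .
  qed
  also have "\<dots> = ennreal (real (card D) * c)"
    using c0 by (simp add: ennreal_mult ennreal_of_nat_eq_real_of_nat)
  finally show ?thesis .
qed

lemma measurable_card:
  assumes t: "0 \<le> t" and D: "finite D" and p: "\<And>z. z \<in> D \<Longrightarrow> {\<tau>. p \<tau> z} \<in> sets conf"
  shows "(\<lambda>\<omega>. ennreal (real (card {z \<in> D. p (\<sigma> t \<omega>) z}))) \<in> borel_measurable P_joint"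
proof -
  have "(\<lambda>\<omega>. ennreal (real (card {z \<in> D. p (\<sigma> t \<omega>) z}))) =
      (\<lambda>\<omega>. \<Sum>z\<in>D. indicator {\<omega>. \<sigma> t \<omega> \<in> {\<tau>. p \<tau> z}} \<omega>)"
    using D by (simp add: indicator_def sum.If_cases Int_def ennreal_of_nat_eq_real_of_nat)
  then show ?thesis
    by (simp only:) (intro borel_measurable_sum borel_measurable_indicator sets_\<sigma>[OF t] p)
qed

text \<open>The box has \<open>(2 * N + 1) * (2 * N)\<close> edges in each direction, and by
  translation invariance edges of the same direction are equally likely to be walls.\<close>

lemma mean_energy:
  assumes t: "0 \<le> t"
  shows "(\<integral>\<^sup>+ \<omega>. ennreal (real (energy N (\<sigma> t \<omega>))) \<partial>P_joint) = ennreal (real ((2 * N + 1) * (2 * N)) * wall_density t)"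
    and "(\<lambda>\<omega>. ennreal (real (energy N (\<sigma> t \<omega>)))) \<in> borel_measurable P_joint"
proof -
  define DH where "DH = {- int N..int N} \<times> {- int N..<int N}"
  define DV where "DV = {- int N..<int N} \<times> {- int N..int N}"
  define pH where "pH \<tau> z \<longleftrightarrow> \<tau> z \<noteq> \<tau> (fst z, snd z + 1)" for \<tau> :: config and z
  define pV where "pV \<tau> z \<longleftrightarrow> \<tau> z \<noteq> \<tau> (fst z + 1, snd z)" for \<tau> :: config and z
  have fin: "finite DH" "finite DV" by (simp_all add: DH_def DV_def)
  have H: "hwalls N \<tau> = {z \<in> DH. pH \<tau> z}" for \<tau> by (auto simp: hwalls_def DH_def pH_def)
  have V: "vwalls N \<tau> = {z \<in> DV. pV \<tau> z}" for \<tau> by (auto simp: vwalls_def DV_def pV_def)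
  have cH: "card DH = (2 * N + 1) * (2 * N)" and cV: "card DV = (2 * N + 1) * (2 * N)"
    by (simp_all add: DH_def DV_def card_cartesian_product nat_add_distrib nat_mult_distrib)
  have sH: "{\<tau>. pH \<tau> z} \<in> sets conf" and sV: "{\<tau>. pV \<tau> z} \<in> sets conf" for z
    unfolding pH_def pV_def by (rule sets_differ)+
  have prH: "pr {\<tau>. pH \<tau> z} t = pr {\<tau>. \<tau> (0, 0) \<noteq> \<tau> (0, 1)} t" for z
    using pr_translate[OF t sets_differ[of "(0, 0)" "(0, 1)"], of z]
    by (cases z) (simp add: pH_def translate_def add.commute)
  have prV: "pr {\<tau>. pV \<tau> z} t = pr {\<tau>. \<tau> (0, 0) \<noteq> \<tau> (1, 0)} t" for z
    using pr_translate[OF t sets_differ[of "(0, 0)" "(1, 0)"], of z]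
    by (cases z) (simp add: pV_def translate_def add.commute)
  have en: "ennreal (real (energy N \<tau>)) = ennreal (real (card {z \<in> DH. pH \<tau> z})) + ennreal (real (card {z \<in> DV. pV \<tau> z}))" for \<tau>
    by (simp add: energy_def H V)
  have mH: "(\<lambda>\<omega>. ennreal (real (card {z \<in> DH. pH (\<sigma> t \<omega>) z}))) \<in> borel_measurable P_joint"
    by (rule measurable_card[OF t fin(1) sH])
  have mV: "(\<lambda>\<omega>. ennreal (real (card {z \<in> DV. pV (\<sigma> t \<omega>) z}))) \<in> borel_measurable P_joint"
    by (rule measurable_card[OF t fin(2) sV])
  show "(\<lambda>\<omega>. ennreal (real (energy N (\<sigma> t \<omega>)))) \<in> borel_measurable P_joint"
    unfolding en by (rule borel_measurable_add[OF mH mV])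
  have "(\<integral>\<^sup>+ \<omega>. ennreal (real (energy N (\<sigma> t \<omega>))) \<partial>P_joint) =
      ennreal (real (card DH) * pr {\<tau>. \<tau> (0, 0) \<noteq> \<tau> (0, 1)} t) + ennreal (real (card DV) * pr {\<tau>. \<tau> (0, 0) \<noteq> \<tau> (1, 0)} t)"
    unfolding en nn_integral_add[OF mH mV]
    using nn_integral_card[OF t fin(1) sH prH] nn_integral_card[OF t fin(2) sV prV] by simp
  also have "\<dots> = ennreal (real ((2 * N + 1) * (2 * N)) * wall_density t)"
    unfolding cH cV by (subst ennreal_plus[symmetric]) (simp_all add: wall_density_def distrib_left)
  finally show "(\<integral>\<^sup>+ \<omega>. ennreal (real (energy N (\<sigma> t \<omega>))) \<partial>P_joint) = ennreal (real ((2 * N + 1) * (2 * N)) * wall_density t)" .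
qed

lemma wall_density_nonneg: "0 \<le> wall_density t"
  by (simp add: wall_density_def)

text \<open>The mean of the pathwise bound \<open>energy_window\<close>. The events
  \<open>Low v\<close> force drops at distinct sites \<open>g v\<close>. The boundary has
  \<open>8 * Suc N\<close> sites, each with at most \<open>exp h\<close> rings on average and a cost
  of \<open>4\<close> per ring, which gives \<open>32\<close>.\<close>

lemma energy_balance:
  fixes Low :: "'v \<Rightarrow> (config \<times> clocks) set"
  assumes t: "0 \<le> t" and h: "0 \<le> h" and V: "finite V" "\<And>v. v \<in> V \<Longrightarrow> Low v \<in> sets P_joint" "inj_on g V"
    and low: "AE \<omega> in P_joint. \<forall>v\<in>V. \<omega> \<in> Low v \<longrightarrow> g v \<in> drops (\<lambda>t. \<sigma> t \<omega>) (snd \<omega>) (Suc N) t (t + h)"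
  shows "real ((2 * Suc N + 1) * (2 * Suc N)) * wall_density (t + h) + 2 * (\<Sum>v\<in>V. measure P_joint (Low v)) \<le>
    real ((2 * Suc N + 1) * (2 * Suc N)) * wall_density t + 32 * real (Suc N) * exp h"
proof -
  let ?E = "\<lambda>t \<omega>. ennreal (real (energy (Suc N) (\<sigma> t \<omega>)))"
  let ?B = "Q (Suc N) - core (Suc N)"
  let ?W = "\<lambda>\<omega> x. (\<Sum>n. indicator {t<..t + h} (ring (snd \<omega> x) n)) :: ennreal"
  have th: "0 \<le> t + h" using t h by simp
  have Wm: "(\<lambda>\<omega>. ?W \<omega> x) \<in> borel_measurable P_joint" for x
  proof -
    have "(\<lambda>d. (\<Sum>n. indicator {t<..t + h} (ring d n)) :: ennreal) \<in> borel_measurable clk" by measurable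
    moreover have "(\<lambda>\<omega>. snd \<omega> x) \<in> P_joint \<rightarrow>\<^sub>M clk"
      by (rule measurable_P_dyn_component[OF measurable_snd_joint])
    ultimately show ?thesis by (rule measurable_compose[rotated])
  qed
  have "(\<integral>\<^sup>+ \<omega>. ?E (t + h) \<omega> + 2 * (\<Sum>v\<in>V. indicator (Low v) \<omega>) \<partial>P_joint) \<le>
    (\<integral>\<^sup>+ \<omega>. ?E t \<omega> + 4 * (\<Sum>x\<in>?B. ?W \<omega> x) \<partial>P_joint)"
  proof (rule nn_integral_mono_AE)
    show "AE \<omega> in P_joint. ?E (t + h) \<omega> + 2 * (\<Sum>v\<in>V. indicator (Low v) \<omega>) \<le> ?E t \<omega> + 4 * (\<Sum>x\<in>?B. ?W \<omega> x)"
      using AE_good low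
    proof eventually_elim
      case (elim \<omega>)
      let ?d = "snd \<omega>" and ?s = "\<lambda>t. \<sigma> t \<omega>"
      have reg: "regular ?d" and f: "follows_dynamics (fst \<omega>) ?d ?s" using elim(1) by (auto simp: good_def)
      have "card {v \<in> V. \<omega> \<in> Low v} \<le> card (drops ?s ?d (Suc N) t (t + h))"
        using elim(2) by (intro card_inj_on_le[of g] inj_on_subset[OF V(3)]) auto
      with energy_window[OF f reg t, of "t + h" "Suc N"] h
      have "energy (Suc N) (\<sigma> (t + h) \<omega>) + 2 * card {v \<in> V. \<omega> \<in> Low v} \<le>
        energy (Suc N) (\<sigma> t \<omega>) + 4 * (\<Sum>x\<in>?B. window_count t (t + h) (?d x))" by simp
      then have "real (energy (Suc N) (\<sigma> (t + h) \<omega>)) + 2 * real (card {v \<in> V. \<omega> \<in> Low v}) \<le>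
        real (energy (Suc N) (\<sigma> t \<omega>)) + 4 * (\<Sum>x\<in>?B. real (window_count t (t + h) (?d x)))"
        by (simp flip: of_nat_sum of_nat_mult of_nat_add add: numeral_eq_of_nat)
      then have "ennreal (real (energy (Suc N) (\<sigma> (t + h) \<omega>)) + 2 * real (card {v \<in> V. \<omega> \<in> Low v})) \<le>
        ennreal (real (energy (Suc N) (\<sigma> t \<omega>)) + 4 * (\<Sum>x\<in>?B. real (window_count t (t + h) (?d x))))"
        by (rule ennreal_leI)
      moreover have "(\<Sum>v\<in>V. indicator (Low v) \<omega>) = ennreal (real (card {v \<in> V. \<omega> \<in> Low v}))"
        using V(1) by (simp add: indicator_def sum.If_cases Int_def ennreal_of_nat_eq_real_of_nat)
      moreover have "(\<Sum>x\<in>?B. ?W \<omega> x) = ennreal (\<Sum>x\<in>?B. real (window_count t (t + h) (?d x)))"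
        by (simp add: window_count_suminf[OF regular_proper[OF reg], symmetric] sum_ennreal)
      ultimately show ?case
        by (simp add: ennreal_plus ennreal_mult sum_nonneg)
    qed
  qed
  also have "(\<integral>\<^sup>+ \<omega>. ?E (t + h) \<omega> + 2 * (\<Sum>v\<in>V. indicator (Low v) \<omega>) \<partial>P_joint) =
      ennreal (real ((2 * Suc N + 1) * (2 * Suc N)) * wall_density (t + h)) + 2 * (\<Sum>v\<in>V. emeasure P_joint (Low v))"
    using V by (subst nn_integral_add) (simp_all add: mean_energy[OF th] nn_integral_cmult nn_integral_sum borel_measurable_indicator)
  also have "(\<integral>\<^sup>+ \<omega>. ?E t \<omega> + 4 * (\<Sum>x\<in>?B. ?W \<omega> x) \<partial>P_joint) =
      ennreal (real ((2 * Suc N + 1) * (2 * Suc N)) * wall_density t) + 4 * (\<Sum>x\<in>?B. \<integral>\<^sup>+ \<omega>. ?W \<omega> x \<partial>P_joint)"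
    using Wm by (subst nn_integral_add) (simp_all add: mean_energy[OF t] nn_integral_cmult nn_integral_sum)
  also have "4 * (\<Sum>x\<in>?B. \<integral>\<^sup>+ \<omega>. ?W \<omega> x \<partial>P_joint) \<le> 4 * (\<Sum>x\<in>?B. ennreal (exp h))"
  proof (intro mult_left_mono sum_mono)
    fix x
    have "(\<integral>\<^sup>+ \<omega>. ?W \<omega> x \<partial>P_joint) = (\<integral>\<^sup>+ d. (\<Sum>n. indicator {t<..t + h} (ring d n)) \<partial>clk)"
      by (rule nn_integral_site) measurable
    also have "\<dots> \<le> ennreal (exp h)" by (rule nn_integral_window_count[OF t h])
    finally show "(\<integral>\<^sup>+ \<omega>. ?W \<omega> x \<partial>P_joint) \<le> ennreal (exp h)" .
  qed simp
  also have "4 * (\<Sum>x\<in>?B. ennreal (exp h)) = ennreal (32 * real (Suc N) * exp h)"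
  proof -
    have 1: "(\<Sum>x\<in>?B. ennreal (exp h)) = ennreal (real (8 * Suc N)) * ennreal (exp h)"
      by (simp only: sum_constant card_boundary ennreal_of_nat_eq_real_of_nat)
    have 2: "ennreal 4 * (ennreal (real (8 * Suc N)) * ennreal (exp h)) = ennreal (4 * (real (8 * Suc N) * exp h))"
      by (simp only: ennreal_mult' zero_le_numeral of_nat_0_le_iff)
    have 3: "4 * (real (8 * Suc N) * exp h) = 32 * real (Suc N) * exp h" by simp
    have 4: "(4 :: ennreal) = ennreal 4" by simp
    show ?thesis by (simp only: 1 4 2 3)
  qed
  finally have "ennreal (real ((2 * Suc N + 1) * (2 * Suc N)) * wall_density (t + h)) + 2 * (\<Sum>v\<in>V. emeasure P_joint (Low v)) \<le>
      ennreal (real ((2 * Suc N + 1) * (2 * Suc N)) * wall_density t) + ennreal (32 * real (Suc N) * exp h)"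
    by (simp add: add_left_mono)
  also have "2 * (\<Sum>v\<in>V. emeasure P_joint (Low v)) = ennreal (2 * (\<Sum>v\<in>V. measure P_joint (Low v)))"
    by (simp add: P_joint.emeasure_eq_measure sum_ennreal ennreal_mult sum_nonneg)
  finally have "ennreal (real ((2 * Suc N + 1) * (2 * Suc N)) * wall_density (t + h) + 2 * (\<Sum>v\<in>V. measure P_joint (Low v))) \<le>
      ennreal (real ((2 * Suc N + 1) * (2 * Suc N)) * wall_density t + 32 * real (Suc N) * exp h)"
    by (subst (1 2) ennreal_plus) (simp_all add: wall_density_nonneg sum_nonneg)
  then show ?thesis
    by (subst (asm) ennreal_le_iff) (simp_all add: wall_density_nonneg)
qed

end

section \<open>Monotone decay of the wall density\<close>

context ising
begin

text \<open>Dividing by the area lets the boundary term vanish as the box grows, so drops of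
  probability \<open>q\<close> at each core site lower the density by at least
  \<open>2 * q\<close>.\<close>

lemma wall_density_drop_limit:
  assumes t: "0 \<le> t" and h: "0 \<le> h" and q: "0 \<le> q"
    and le: "\<And>N. real ((2 * Suc N + 1) * (2 * Suc N)) * wall_density (t + h) + 2 * (real (card (core (Suc N))) * q) \<le>
      real ((2 * Suc N + 1) * (2 * Suc N)) * wall_density t + 32 * real (Suc N) * exp h"
  shows "wall_density (t + h) + 2 * q \<le> wall_density t"
proof (rule ccontr)
  define \<epsilon> where "\<epsilon> = wall_density (t + h) + 2 * q - wall_density t"
  assume "\<not> ?thesis"
  then have \<epsilon>: "0 < \<epsilon>" by (simp add: \<epsilon>_def)
  \<comment> \<open>This bounds the coefficient of all terms linear in \<open>m\<close>. An excess
    \<open>\<epsilon>\<close> would contribute \<open>4 * m * m * \<epsilon>\<close>, which exceeds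
    \<open>m * K\<close> once \<open>m\<close> is above \<open>K / (4 * \<epsilon>)\<close>.\<close>
  define K where "K = 32 * exp h + 16 * q + 2 * wall_density t"
  obtain n :: nat where n: "K / (4 * \<epsilon>) < real n" using reals_Archimedean2 by blast
  define m where "m = real (Suc n)"
  have m: "K / (4 * \<epsilon>) < m" "1 \<le> m" using n by (simp_all add: m_def)
  have sides: "real ((2 * Suc n + 1) * (2 * Suc n)) = 4 * m\<^sup>2 + 2 * m"
    by (simp add: m_def power2_eq_square algebra_simps)
  have area: "real (card (core (Suc n))) = 4 * m\<^sup>2 - 4 * m + 1"
    unfolding card_core by (simp add: m_def power2_eq_square algebra_simps)
  have "(4 * m\<^sup>2 + 2 * m) * wall_density (t + h) + 2 * ((4 * m\<^sup>2 - 4 * m + 1) * q) \<le> (4 * m\<^sup>2 + 2 * m) * wall_density t + 32 * m * exp h"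
    using le[of n] unfolding sides area m_def[symmetric] .
  then have "4 * m\<^sup>2 * \<epsilon> \<le> m * (32 * exp h + 8 * q + 2 * wall_density t) - 2 * m * wall_density (t + h) - 2 * q"
    by (simp add: \<epsilon>_def algebra_simps)
  also have "\<dots> \<le> m * K"
  proof -
    have "0 \<le> m * q" "0 \<le> m * wall_density (t + h)" using m q wall_density_nonneg by simp_all
    then show ?thesis using q by (simp add: K_def algebra_simps)
  qed
  finally have "m * (4 * m * \<epsilon>) \<le> m * K" by (simp add: power2_eq_square algebra_simps)
  then have "4 * m * \<epsilon> \<le> K" using m by (simp add: mult_le_cancel_left)
  with m(1) \<epsilon> show False by (simp add: divide_less_eq mult.commute mult.left_commute)
qed

lemma wall_density_antimono: "0 \<le> t \<Longrightarrow> t \<le> u \<Longrightarrow> wall_density u \<le> wall_density t"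
proof -
  assume t: "0 \<le> t" "t \<le> u"
  have "wall_density (t + (u - t)) + 2 * 0 \<le> wall_density t"
  proof (rule wall_density_drop_limit)
    fix N
    show "real ((2 * Suc N + 1) * (2 * Suc N)) * wall_density (t + (u - t)) + 2 * (real (card (core (Suc N))) * 0)
      \<le> real ((2 * Suc N + 1) * (2 * Suc N)) * wall_density t + 32 * real (Suc N) * exp (u - t)"
      using energy_balance[of t "u - t" "{} :: nat set" "\<lambda>_. {}" "\<lambda>_. undefined" N] t by simp
  qed (use t in auto)
  then show ?thesis by simp
qed

text \<open>The density is decreasing and bounded below, so once it is within
  \<open>\<epsilon>\<close> of its infimum no unit of time can lower it by
  \<open>\<epsilon>\<close>.\<close>

lemma wall_density_diff_tendsto: "((\<lambda>t. wall_density t - wall_density (t + 1)) \<longlongrightarrow> 0) at_top"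
proof (rule tendstoI)
  fix \<epsilon> :: real assume \<epsilon>: "0 < \<epsilon>"
  define I where "I = Inf (wall_density ` {0..})"
  have bdd: "bdd_below (wall_density ` {0..})" by (rule bdd_belowI[of _ 0]) (use wall_density_nonneg in auto)
  have "\<exists>x\<in>wall_density ` {0..}. x < I + \<epsilon>"
    unfolding I_def by (rule cInf_lessD) (use \<epsilon> in auto)
  then obtain T where T: "0 \<le> T" "wall_density T < I + \<epsilon>" by auto
  have "dist (wall_density t - wall_density (t + 1)) 0 < \<epsilon>" if "T \<le> t" for t
  proof -
    have "wall_density t \<le> wall_density T" "wall_density (t + 1) \<le> wall_density t" using that T by (auto intro: wall_density_antimono)
    moreover have "I \<le> wall_density (t + 1)" unfolding I_def by (rule cInf_lower[OF _ bdd]) (use that T in auto)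
    ultimately show ?thesis using T by (simp add: dist_real_def)
  qed
  then show "eventually (\<lambda>t. dist (wall_density t - wall_density (t + 1)) 0 < \<epsilon>) at_top"
    by (auto simp: eventually_at_top_linorder)
qed

end

section \<open>Forcing a single flip\<close>

definition lone :: "site \<Rightarrow> real \<Rightarrow> site \<Rightarrow> (nat \<Rightarrow> real \<times> bool) set" where
  "lone x t y = (if y = x then {d. one_ring t (t + 1) d} else {d. quiet t (t + 1) d})"

lemma sets_lone: "lone x t y \<in> sets clk"
  by (simp add: lone_def sets_one_ring sets_quiet)

lemma graft_lone:
  "proper d \<Longrightarrow> proper d' \<Longrightarrow> proper (graft t d d') \<Longrightarrow> graft t d d' \<in> lone x t y \<longleftrightarrow> d' \<in> lone x 0 y"
  using quiet_graft[of d d' t 1] one_ring_graft[of d d' t 1] by (simp add: lone_def)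

text \<open>The probability that in one unit of time \<open>x\<close> rings once with a successful
  coin while the rest of the box is silent. It is positive and does not depend on the starting
  time.\<close>

definition lone_prob :: "nat \<Rightarrow> site \<Rightarrow> real" where
  "lone_prob M x = (\<Prod>y\<in>Q M. measure clk (lone x 0 y))"

lemma lone_prob_pos: "0 < lone_prob M x"
  unfolding lone_prob_def
proof (rule prod_pos)
  fix y
  have "0 < emeasure clk (lone x 0 y)"
    using one_ring_pos quiet_pos[of 1] by (simp add: lone_def)
  then show "0 < measure clk (lone x 0 y)" by (simp add: clkp.emeasure_eq_measure)
qed

context ising
begin

lemma lone_event:
  assumes t: "0 \<le> t"
  shows "measure P_joint {\<omega>. translate v (\<sigma> t \<omega>) \<in> cyl (Q M) \<zeta> \<and> (\<forall>y\<in>Q M. snd \<omega> (y + v) \<in> lone x t y)} =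
      pr (cyl (Q M) \<zeta>) t * lone_prob M x"
    and "{\<omega>. translate v (\<sigma> t \<omega>) \<in> cyl (Q M) \<zeta> \<and> (\<forall>y\<in>Q M. snd \<omega> (y + v) \<in> lone x t y)} \<in> sets P_joint"
proof -
  let ?A = "{\<tau>. translate v \<tau> \<in> cyl (Q M) \<zeta>}" and ?J = "(\<lambda>y. y + v) ` Q M"
  have cyl: "cyl (Q M) \<zeta> \<in> sets conf" by (rule sets_cyl) simp
  have A: "?A \<in> sets conf"
    using measurable_sets[OF measurable_translate cyl] by (simp add: vimage_def)
  have inj: "inj_on (\<lambda>y. y + v) (Q M)" by (simp add: inj_on_def)
  let ?S = "{\<omega>. translate v (\<sigma> t \<omega>) \<in> cyl (Q M) \<zeta> \<and> (\<forall>y\<in>Q M. snd \<omega> (y + v) \<in> lone x t y)}"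
  have eq: "?S = {\<omega>. \<sigma> t \<omega> \<in> ?A \<and> (\<forall>z\<in>?J. snd \<omega> z \<in> lone x t (z - v))}" by auto
  have "emeasure P_joint ?S = emeasure P_joint {\<omega>. \<sigma> t \<omega> \<in> ?A} * (\<Prod>z\<in>?J. emeasure clk (lone x 0 (z - v)))"
    unfolding eq by (rule markov[OF t A]) (simp_all add: sets_lone graft_lone)
  also have "emeasure P_joint {\<omega>. \<sigma> t \<omega> \<in> ?A} = ennreal (pr (cyl (Q M) \<zeta>) t)"
    unfolding emeasure_pr pr_translate[OF t cyl] ..
  also have "(\<Prod>z\<in>?J. emeasure clk (lone x 0 (z - v))) = (\<Prod>y\<in>Q M. emeasure clk (lone x 0 y))"
    by (simp add: prod.reindex[OF inj])
  also have "\<dots> = ennreal (lone_prob M x)"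
    by (simp add: lone_prob_def clkp.emeasure_eq_measure prod_ennreal)
  also have "ennreal (pr (cyl (Q M) \<zeta>) t) * ennreal (lone_prob M x) = ennreal (pr (cyl (Q M) \<zeta>) t * lone_prob M x)"
    by (simp add: ennreal_mult less_imp_le[OF lone_prob_pos])
  finally show "measure P_joint ?S = pr (cyl (Q M) \<zeta>) t * lone_prob M x"
    using less_imp_le[OF lone_prob_pos[of M x]] by (simp add: P_joint.emeasure_eq_measure)
  have "{\<omega>. \<forall>y\<in>?J. snd \<omega> y \<in> lone x t (y - v)} \<in> sets P_joint"
    using measurable_sets[OF measurable_snd_joint sets_P_dyn_cylinder[of ?J "\<lambda>y. lone x t (y - v)"]]
    by (simp add: vimage_def sets_lone)
  then show "?S \<in> sets P_joint"
    using sets.Int[OF sets_\<sigma>[OF t A]] unfolding eq by (simp add: Collect_conj_eq)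
qed

lemma lone_update:
  assumes good: "good \<sigma> \<omega>" and t: "0 \<le> t" and x: "x \<in> core M"
    and cyl: "translate v (\<sigma> t \<omega>) \<in> cyl (Q M) \<zeta>" and lone: "\<forall>y\<in>Q M. snd \<omega> (y + v) \<in> lone x t y"
  obtains r \<xi> where "(r, True) \<in> marks (snd \<omega> (x + v))" "t < r" "r \<le> t + 1" "left_limit (\<lambda>t. \<sigma> t \<omega>) r \<xi>"
    "disagreements \<xi> (x + v) = disagreements \<zeta> x"
    "2 \<le> disagreements \<zeta> x \<Longrightarrow> translate v (\<sigma> (t + 1) \<omega>) \<in> cyl (Q M) (flip \<zeta> x)"
proof -
  have f: "follows_dynamics (fst \<omega>) (snd \<omega>) (\<lambda>t. \<sigma> t \<omega>)" and reg: "regular (snd \<omega>)"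
    using good by (auto simp: good_def)
  let ?B = "(\<lambda>y. y + v) ` Q M"
  have xQ: "x \<in> Q M" using x core_subset_Q by blast
  have st: "\<sigma> t \<omega> (y + v) = \<zeta> y" if "y \<in> Q M" for y
    using cyl that by (simp add: cyl_def translate_def)
  have dis: "disagreements (\<sigma> t \<omega>) (x + v) = disagreements \<zeta> x"
  proof -
    have "disagreements (translate v (\<sigma> t \<omega>)) x = disagreements \<zeta> x"
      by (rule disagreements_cong) (simp add: translate_def st core_nbrs_Q[OF x])
    then show ?thesis by (simp add: disagreements_translate)
  qed
  have "x + v \<in> ?B" using xQ by blast
  moreover have "nbrs (x + v) \<subseteq> ?B" unfolding nbrs_translate using nbrs_core_subset_Q[OF x] by (rule image_mono)
  moreover have "one_ring t (t + 1) (snd \<omega> (x + v))" using lone xQ by (auto simp: lone_def)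
  moreover have "quiet t (t + 1) (snd \<omega> y)" if "y \<in> ?B" "y \<noteq> x + v" for y
    using lone that by (auto simp: lone_def)
  ultimately obtain r \<xi> where r: "(r, True) \<in> marks (snd \<omega> (x + v))" "t < r" "r \<le> t + 1" "left_limit (\<lambda>t. \<sigma> t \<omega>) r \<xi>"
    "disagreements \<xi> (x + v) = disagreements (\<sigma> t \<omega>) (x + v)"
    "\<And>y. y \<in> ?B \<Longrightarrow> \<sigma> (t + 1) \<omega> y =
      (if y = x + v \<and> 2 \<le> disagreements (\<sigma> t \<omega>) (x + v) then \<not> \<sigma> t \<omega> (x + v) else \<sigma> t \<omega> y)"
    using single_update[OF f reg t, of "x + v" ?B "t + 1"] by metis
  have "translate v (\<sigma> (t + 1) \<omega>) \<in> cyl (Q M) (flip \<zeta> x)" if "2 \<le> disagreements \<zeta> x"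
    unfolding cyl_def
  proof (intro CollectI ballI)
    fix y assume y: "y \<in> Q M"
    then have "\<sigma> (t + 1) \<omega> (y + v) = (if y + v = x + v \<and> 2 \<le> disagreements (\<sigma> t \<omega>) (x + v) then \<not> \<sigma> t \<omega> (x + v) else \<sigma> t \<omega> (y + v))"
      by (intro r(6)) blast
    then show "translate v (\<sigma> (t + 1) \<omega>) y = flip \<zeta> x y"
      using that y xQ by (simp add: translate_def dis st flip_apply)
  qed
  with r dis that show thesis by metis
qed

text \<open>Seeing \<open>\<zeta>\<close> at time \<open>t\<close> is independent of the rings
  afterwards, and together with a lone ring of \<open>x\<close> it leads to the flipped pattern one
  unit of time later.\<close>

lemma pattern_step:
  assumes t: "0 \<le> t" and x: "x \<in> core M" "2 \<le> disagreements \<zeta> x"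
  shows "pr (cyl (Q M) \<zeta>) t * lone_prob M x \<le> pr (cyl (Q M) (flip \<zeta> x)) (t + 1)"
proof -
  let ?S = "{\<omega>. translate 0 (\<sigma> t \<omega>) \<in> cyl (Q M) \<zeta> \<and> (\<forall>y\<in>Q M. snd \<omega> (y + 0) \<in> lone x t y)}"
  have "measure P_joint ?S \<le> measure P_joint {\<omega>. \<sigma> (t + 1) \<omega> \<in> cyl (Q M) (flip \<zeta> x)}"
  proof (rule P_joint.finite_measure_mono_AE)
    show "AE \<omega> in P_joint. \<omega> \<in> ?S \<longrightarrow> \<omega> \<in> {\<omega>. \<sigma> (t + 1) \<omega> \<in> cyl (Q M) (flip \<zeta> x)}"
      using AE_good
    proof eventually_elim
      case (elim \<omega>)
      have "\<sigma> (t + 1) \<omega> \<in> cyl (Q M) (flip \<zeta> x)" if "\<omega> \<in> ?S"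
      proof -
        have "translate 0 (\<sigma> (t + 1) \<omega>) \<in> cyl (Q M) (flip \<zeta> x)"
          by (rule lone_update[OF elim t x(1), of 0 \<zeta>]) (use that x(2) in auto)
        then show ?thesis by (simp add: translate_def[abs_def])
      qed
      then show ?case by simp
    qed
    show "{\<omega>. \<sigma> (t + 1) \<omega> \<in> cyl (Q M) (flip \<zeta> x)} \<in> sets P_joint"
      by (rule sets_\<sigma>) (use t sets_cyl in auto)
  qed
  then show ?thesis unfolding lone_event(1)[OF t] by (simp add: pr_def)
qed

text \<open>Each translate of the pattern followed by a lone ring causes a drop at the translate of
  \<open>x\<close>, and distinct translates give distinct sites. Drops thus have a positive density,
  which the decrease of the wall density must pay for.\<close>

lemma pattern_drop:
  assumes t: "0 \<le> t" and x: "x \<in> core M" "3 \<le> disagreements \<zeta> x"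
  shows "2 * (pr (cyl (Q M) \<zeta>) t * lone_prob M x) \<le> wall_density t - wall_density (t + 1)"
proof -
  let ?q = "pr (cyl (Q M) \<zeta>) t * lone_prob M x"
  let ?Low = "\<lambda>v. {\<omega>. translate v (\<sigma> t \<omega>) \<in> cyl (Q M) \<zeta> \<and> (\<forall>y\<in>Q M. snd \<omega> (y + v) \<in> lone x t y)}"
  have "wall_density (t + 1) + 2 * ?q \<le> wall_density t"
  proof (rule wall_density_drop_limit[OF t])
    fix N
    \<comment> \<open>These translations move \<open>x\<close> to each site of the core exactly
      once.\<close>
    let ?V = "(\<lambda>y. y - x) ` core (Suc N)"
    have cV: "card ?V = card (core (Suc N))" by (rule card_image) (simp add: inj_on_def)
    have "real ((2 * Suc N + 1) * (2 * Suc N)) * wall_density (t + 1) + 2 * (\<Sum>v\<in>?V. measure P_joint (?Low v)) \<le>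
      real ((2 * Suc N + 1) * (2 * Suc N)) * wall_density t + 32 * real (Suc N) * exp 1"
    proof (rule energy_balance[OF t, where g = "\<lambda>v. x + v"])
      show "AE \<omega> in P_joint. \<forall>v\<in>?V. \<omega> \<in> ?Low v \<longrightarrow> x + v \<in> drops (\<lambda>t. \<sigma> t \<omega>) (snd \<omega>) (Suc N) t (t + 1)"
        using AE_good
      proof eventually_elim
        case (elim \<omega>)
        show ?case
        proof (intro ballI impI)
          fix v assume v: "v \<in> ?V" "\<omega> \<in> ?Low v"
          then have "x + v \<in> core (Suc N)" by auto
          moreover obtain r \<xi> where "(r, True) \<in> marks (snd \<omega> (x + v))" "t < r" "r \<le> t + 1"
            "left_limit (\<lambda>t. \<sigma> t \<omega>) r \<xi>" "disagreements \<xi> (x + v) = disagreements \<zeta> x"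
            by (rule lone_update[OF elim t x(1), of v \<zeta>]) (use v in auto)
          ultimately show "x + v \<in> drops (\<lambda>t. \<sigma> t \<omega>) (snd \<omega>) (Suc N) t (t + 1)"
            using x(2) unfolding drops_def by force
        qed
      qed
    qed (simp_all add: inj_on_def lone_event(2)[OF t])
    also have "(\<Sum>v\<in>?V. measure P_joint (?Low v)) = real (card (core (Suc N))) * ?q"
      unfolding lone_event(1)[OF t] by (simp add: cV)
    finally show "real ((2 * Suc N + 1) * (2 * Suc N)) * wall_density (t + 1) + 2 * (real (card (core (Suc N))) * ?q)
      \<le> real ((2 * Suc N + 1) * (2 * Suc N)) * wall_density t + 32 * real (Suc N) * exp 1" .
  qed (simp_all add: less_imp_le[OF lone_prob_pos])
  then show ?thesis by simp
qed

text \<open>Induction along the path of flips, from its end. The energy-lowering pattern is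
  controlled by the vanishing decrements of the wall density; each earlier pattern is controlled by
  its successor one unit of time later, up to the positive factor \<open>lone_prob\<close>.\<close>

lemma bad_pattern_vanishes:
  assumes "bad M \<zeta>"
  shows "((\<lambda>t. pr (cyl (Q M) \<zeta>) t) \<longlongrightarrow> 0) at_top"
  using assms
proof induction
  case (lower x \<zeta>)
  let ?c = "lone_prob M x"
  have lim: "((\<lambda>t. (wall_density t - wall_density (t + 1)) / (2 * ?c)) \<longlongrightarrow> 0) at_top"
    using tendsto_divide[OF wall_density_diff_tendsto tendsto_const[of "2 * ?c"]] lone_prob_pos[of M x] by simp
  show ?case
  proof (rule tendsto_sandwich[OF _ _ tendsto_const lim])
    show "\<forall>\<^sub>F t in at_top. pr (cyl (Q M) \<zeta>) t \<le> (wall_density t - wall_density (t + 1)) / (2 * ?c)"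
      using eventually_ge_at_top[of 0]
    proof eventually_elim
      case (elim t)
      from pattern_drop[OF elim lower] lone_prob_pos[of M x] show ?case
        by (simp add: pos_le_divide_eq mult_ac)
    qed
  qed simp
next
  case (step x \<zeta>)
  let ?c = "lone_prob M x"
  have "filterlim (\<lambda>t :: real. 1 + t) at_top at_top"
    by (rule filterlim_tendsto_add_at_top[OF tendsto_const filterlim_ident])
  from filterlim_compose[OF step.IH this] tendsto_const[of ?c]
  have lim: "((\<lambda>t. pr (cyl (Q M) (flip \<zeta> x)) (t + 1) / ?c) \<longlongrightarrow> 0) at_top"
    using lone_prob_pos[of M x] tendsto_divide[of "\<lambda>t. pr (cyl (Q M) (flip \<zeta> x)) (1 + t)" 0 at_top "\<lambda>_. ?c" ?c]
    by (simp add: add.commute)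
  show ?case
  proof (rule tendsto_sandwich[OF _ _ tendsto_const lim])
    show "\<forall>\<^sub>F t in at_top. pr (cyl (Q M) \<zeta>) t \<le> pr (cyl (Q M) (flip \<zeta> x)) (t + 1) / ?c"
      using eventually_ge_at_top[of 0]
    proof eventually_elim
      case (elim t)
      from pattern_step[OF elim step.hyps(1,2)] lone_prob_pos[of M x] show ?case
        by (simp add: pos_le_divide_eq)
    qed
  qed simp
qed

lemma bad_vanishes: "((\<lambda>t. pr {\<tau>. bad M \<tau>} t) \<longlongrightarrow> 0) at_top"
proof -
  let ?I = "{S \<in> Pow (Q M). bad M (\<lambda>x. x \<in> S)}"
  let ?C = "\<lambda>S. cyl (Q M) (\<lambda>x. x \<in> S)"
  have eq: "{\<tau>. bad M \<tau>} = (\<Union>S\<in>?I. ?C S)"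
    by (rule local_event_cyl) (rule bad_cong)
  have fin: "finite ?I" by simp
  have lim: "((\<lambda>t. \<Sum>S\<in>?I. pr (?C S) t) \<longlongrightarrow> (\<Sum>S\<in>?I. 0)) at_top"
    by (rule tendsto_sum) (simp add: bad_pattern_vanishes)
  show ?thesis
  proof (rule tendsto_sandwich[OF _ _ tendsto_const])
    show "((\<lambda>t. \<Sum>S\<in>?I. pr (?C S) t) \<longlongrightarrow> 0) at_top" using lim by simp
    show "\<forall>\<^sub>F t in at_top. pr {\<tau>. bad M \<tau>} t \<le> (\<Sum>S\<in>?I. pr (?C S) t)"
      using eventually_ge_at_top[of 0]
    proof eventually_elim
      case (elim t)
      have "{\<omega>. \<sigma> t \<omega> \<in> {\<tau>. bad M \<tau>}} = (\<Union>S\<in>?I. {\<omega>. \<sigma> t \<omega> \<in> ?C S})" unfolding eq by blast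
      then show ?case
        unfolding pr_def by (simp only:) (rule P_joint.finite_measure_subadditive_finite[OF fin],
          use sets_\<sigma>[OF elim] sets_cyl in auto)
    qed
  qed simp
qed

section \<open>Flippable sites become rare\<close>

definition flippable_prob :: "real \<Rightarrow> real" where
  "flippable_prob t = pr {\<tau>. 2 \<le> disagreements \<tau> (0, 0)} t"

lemma pr_flippable: "0 \<le> t \<Longrightarrow> pr {\<tau>. 2 \<le> disagreements \<tau> x} t = flippable_prob t"
  using pr_translate[OF _ sets_disagreements[of "(0, 0)"], of t x]
  by (cases x) (simp add: flippable_prob_def disagreements_translate)

text \<open>The mean number of flippable sites in the core is its area times the probability at one
  site. With \<open>M = k + 3\<close> the core has side \<open>a = 2 * k + 3\<close> and
  \<open>2 * M + 1 \<le> 3 * a\<close>, so the geometric bound per site is at most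
  \<open>96 * 3 / a\<close>. A bad pattern is charged with the whole area.\<close>

lemma flippable_bound:
  assumes t: "0 \<le> t"
  shows "flippable_prob t \<le> 288 / real (Suc k) + pr {\<tau>. bad (k + 3) \<tau>} t"
proof -
  let ?M = "k + 3" and ?D = "core (k + 2)"
  let ?b = "{\<omega>. \<sigma> t \<omega> \<in> {\<tau>. bad ?M \<tau>}}" and ?c = "96 * (2 * ?M + 1) :: nat"
  have b: "?b \<in> sets P_joint" by (rule sets_\<sigma>[OF t sets_bad])
  have cD: "card ?D = (2 * k + 3) * (2 * k + 3)"
  proof -
    have "?D = core (Suc (Suc k))" "2 * Suc k + 1 = 2 * k + 3" by simp_all
    then show ?thesis using card_core[of "Suc k"] by (simp only:)
  qed
  have "(\<integral>\<^sup>+ \<omega>. ennreal (real (card {x \<in> ?D. 2 \<le> disagreements (\<sigma> t \<omega>) x})) \<partial>P_joint) = ennreal (real (card ?D) * flippable_prob t)"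
    by (rule nn_integral_card[OF t finite_core sets_disagreements pr_flippable[OF t]]) (simp add: flippable_prob_def)
  moreover have "(\<integral>\<^sup>+ \<omega>. ennreal (real (card {x \<in> ?D. 2 \<le> disagreements (\<sigma> t \<omega>) x})) \<partial>P_joint) \<le>
    (\<integral>\<^sup>+ \<omega>. ennreal (real ?c) + ennreal (real (card ?D)) * indicator ?b \<omega> \<partial>P_joint)"
  proof (rule nn_integral_mono)
    fix \<omega>
    show "ennreal (real (card {x \<in> ?D. 2 \<le> disagreements (\<sigma> t \<omega>) x})) \<le>
      ennreal (real ?c) + ennreal (real (card ?D)) * indicator ?b \<omega>"
    proof (cases "bad ?M (\<sigma> t \<omega>)")
      case True
      have "card {x \<in> ?D. 2 \<le> disagreements (\<sigma> t \<omega>) x} \<le> card ?D" by (rule card_mono) auto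
      then have "ennreal (real (card {x \<in> ?D. 2 \<le> disagreements (\<sigma> t \<omega>) x})) \<le> ennreal (real (card ?D))"
        by (intro ennreal_leI) simp
      also have "\<dots> \<le> ennreal (real ?c) + ennreal (real (card ?D)) * indicator ?b \<omega>" using True by simp
      finally show ?thesis .
    next
      case False
      have "card {x \<in> core (?M - 1). 2 \<le> disagreements (\<sigma> t \<omega>) x} \<le> ?c"
        by (rule few_flippable[OF False]) simp
      then have "real (card {x \<in> ?D. 2 \<le> disagreements (\<sigma> t \<omega>) x}) \<le> real ?c" by simp
      then have "ennreal (real (card {x \<in> ?D. 2 \<le> disagreements (\<sigma> t \<omega>) x})) \<le> ennreal (real ?c)"
        by (rule ennreal_leI)
      then show ?thesis using False by simp
    qed
  qed
  moreover have "(\<integral>\<^sup>+ \<omega>. ennreal (real ?c) + ennreal (real (card ?D)) * indicator ?b \<omega> \<partial>P_joint) =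
      ennreal (real ?c + real (card ?D) * pr {\<tau>. bad ?M \<tau>} t)"
  proof -
    have "(\<integral>\<^sup>+ \<omega>. ennreal (real ?c) + ennreal (real (card ?D)) * indicator ?b \<omega> \<partial>P_joint) =
      ennreal (real ?c) * emeasure P_joint (space P_joint) + ennreal (real (card ?D)) * emeasure P_joint ?b"
      using b by (subst nn_integral_add) (simp_all add: nn_integral_cmult_indicator)
    also have "\<dots> = ennreal (real ?c) + ennreal (real (card ?D)) * ennreal (pr {\<tau>. bad ?M \<tau>} t)"
      unfolding P_joint.emeasure_space_1 emeasure_pr by simp
    also have "\<dots> = ennreal (real ?c + real (card ?D) * pr {\<tau>. bad ?M \<tau>} t)"
      by (subst ennreal_plus) (simp_all only: ennreal_mult of_nat_0_le_iff pr_nonneg mult_nonneg_nonneg)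
    finally show ?thesis .
  qed
  ultimately have "ennreal (real (card ?D) * flippable_prob t) \<le> ennreal (real ?c + real (card ?D) * pr {\<tau>. bad ?M \<tau>} t)"
    by simp
  then have le: "real (card ?D) * flippable_prob t \<le> real ?c + real (card ?D) * pr {\<tau>. bad ?M \<tau>} t"
    by (subst (asm) ennreal_le_iff) simp_all
  define a where "a = real (2 * k + 3)"
  have a: "0 < a" "real (Suc k) \<le> a" "real (2 * ?M + 1) \<le> 3 * a" by (simp_all add: a_def)
  have "real (card ?D) = a * a" unfolding cD a_def by simp
  with le have "a * a * (flippable_prob t - pr {\<tau>. bad ?M \<tau>} t) \<le> 96 * real (2 * ?M + 1)" by (simp add: algebra_simps)
  also have "\<dots> \<le> a * 288" using a(3) by simp
  finally have "a * (flippable_prob t - pr {\<tau>. bad ?M \<tau>} t) \<le> 288" using a(1) by (simp add: mult.assoc mult_le_cancel_left)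
  then have "flippable_prob t - pr {\<tau>. bad ?M \<tau>} t \<le> 288 / a" using a(1) by (simp add: pos_le_divide_eq mult.commute)
  also have "\<dots> \<le> 288 / real (Suc k)" using a by (intro divide_left_mono) auto
  finally show ?thesis by simp
qed

text \<open>The box is fixed first, large enough for the geometric term; then time is taken large
  enough for bad patterns of this box to be unlikely.\<close>

lemma flippable_vanishes: "(flippable_prob \<longlongrightarrow> 0) at_top"
proof (rule tendstoI)
  fix \<epsilon> :: real assume \<epsilon>: "0 < \<epsilon>"
  obtain k :: nat where k: "288 / (\<epsilon> / 2) < real k" using reals_Archimedean2 by blast
  have small: "288 / real (Suc k) < \<epsilon> / 2"
  proof -
    have "288 / (\<epsilon> / 2) < real (Suc k)" using k by simp
    then show ?thesis using \<epsilon> by (simp add: divide_less_eq mult.commute)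
  qed
  have "\<forall>\<^sub>F t in at_top. pr {\<tau>. bad (k + 3) \<tau>} t < \<epsilon> / 2"
    by (rule order_tendstoD(2)[OF bad_vanishes]) (use \<epsilon> in simp)
  then show "\<forall>\<^sub>F t in at_top. dist (flippable_prob t) 0 < \<epsilon>"
    using eventually_ge_at_top[of 0]
  proof eventually_elim
    case (elim t)
    have "0 \<le> flippable_prob t" by (simp add: flippable_prob_def)
    with elim small flippable_bound[of t k] show ?case by (simp add: dist_real_def)
  qed
qed

text \<open>By \<open>stable_local_ext\<close>, failure requires a flippable site in
  \<open>Q L\<close>, and a union bound over this fixed finite box suffices.\<close>

lemma local_ext_tendsto: "((\<lambda>t. pr {\<tau>. \<tau> \<in> local_ext L absorbing} t) \<longlongrightarrow> 1) at_top"
proof -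
  let ?E = "\<lambda>t x. {\<omega>. \<sigma> t \<omega> \<in> {\<tau>. 2 \<le> disagreements \<tau> x}}"
  let ?G = "\<lambda>t. {\<omega>. \<sigma> t \<omega> \<in> {\<tau>. \<tau> \<in> local_ext L absorbing}}"
  have bound: "1 - real (card (Q L)) * flippable_prob t \<le> pr {\<tau>. \<tau> \<in> local_ext L absorbing} t" if t: "0 \<le> t" for t
  proof -
    have E: "?E t x \<in> sets P_joint" for x by (rule sets_\<sigma>[OF t sets_disagreements])
    have G: "?G t \<in> sets P_joint" by (rule sets_\<sigma>[OF t sets_local_ext])
    have "space P_joint - ?G t \<subseteq> (\<Union>x\<in>Q L. ?E t x)"
    proof
      fix \<omega> assume "\<omega> \<in> space P_joint - ?G t"
      then have "\<sigma> t \<omega> \<notin> local_ext L absorbing" by simp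
      then obtain x where "x \<in> Q L" "\<not> disagreements (\<sigma> t \<omega>) x \<le> 1" using stable_local_ext by blast
      moreover from this(2) have "2 \<le> disagreements (\<sigma> t \<omega>) x" by linarith
      ultimately show "\<omega> \<in> (\<Union>x\<in>Q L. ?E t x)" by blast
    qed
    then have "measure P_joint (space P_joint - ?G t) \<le> measure P_joint (\<Union>x\<in>Q L. ?E t x)"
      using E by (intro P_joint.finite_measure_mono sets.finite_UN) auto
    also have "\<dots> \<le> (\<Sum>x\<in>Q L. measure P_joint (?E t x))"
      using E by (intro P_joint.finite_measure_subadditive_finite) auto
    also have "\<dots> = real (card (Q L)) * flippable_prob t"
      using pr_flippable[OF t] by (simp add: pr_def)
    finally show ?thesis
      using P_joint.prob_compl[OF G] by (simp add: pr_def)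
  qed
  have "((\<lambda>t. 1 - real (card (Q L)) * flippable_prob t) \<longlongrightarrow> 1 - real (card (Q L)) * 0) at_top"
    by (intro tendsto_intros flippable_vanishes)
  then have lim: "((\<lambda>t. 1 - real (card (Q L)) * flippable_prob t) \<longlongrightarrow> 1) at_top" by simp
  show ?thesis
  proof (rule tendsto_sandwich[OF _ _ lim tendsto_const])
    show "\<forall>\<^sub>F t in at_top. 1 - real (card (Q L)) * flippable_prob t \<le> pr {\<tau>. \<tau> \<in> local_ext L absorbing} t"
      using eventually_ge_at_top[of 0] by eventually_elim (rule bound)
  qed (simp add: pr_le_1)
qed

end

theorem theorem2:
  fixes \<sigma> :: "real \<Rightarrow> config \<times> clocks \<Rightarrow> config" and L :: nat
  assumes "zero_temp_ising \<sigma>"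
  shows "((\<lambda>t. measure P_joint {\<omega> \<in> space P_joint. \<sigma> t \<omega> \<in> local_ext L absorbing}) \<longlongrightarrow> 1) at_top"
proof -
  interpret ising \<sigma> by unfold_locales fact
  show ?thesis using local_ext_tendsto[of L] by (simp add: pr_def)
qed

end
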